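(* Let $\Omega\subseteq\mathbb{S}^2$ be a domain, let $0<\sigma_1(\Omega)\le\sigma_2(\Omega)\le\cdots$ be the eigenvalues (counted with multiplicity) of the buckling problem on $\Omega$, and let $R_1^B(z)=\sum_j(z-\sigma_j(\Omega))_+$. Then for all $z\ge0$ $$ R_1^B(z)\leq\frac{|\Omega|}{8\pi}\left(z-\frac12\right)^2 $$ and $$ R_1^B(z)\leq\frac{|\Omega|}{8\pi}z^2 . $$
   Context: $\mathbb{S}^2$ is the round unit sphere in $\mathbb{R}^3$. A domain is an open connected set (possibly $\Omega=\mathbb{S}^2$); $|\Omega|$ is its surface measure; $a_+=\max(a,0)$. The buckling problem is $-\Delta^2u=\sigma\Delta u$ in $\Omega$, $u=\partial_\nu u=0$ on $\partial\Omega$, understood weakly: find $\sigma\in\mathbb{R}$ and $0\ne u\in H^2_0(\Omega)$ (closure of $C_c^\infty(\Omega)$ in $H^2(\Omega)$) with $\int_\Omega\Delta u\,\Delta\phi=\sigma\int_\Omega\nabla u\cdot\nabla\phi$ for all $\phi\in H_0^2(\Omega)$. When $\Omega=\mathbb{S}^2$ (where $H^2_0=H^2$), the problem is considered in the subspace of functions in $H^2(\mathbb{S}^2)$ with zero mean, for both $u$ and $\phi$. *)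

theory Defs
  imports "HOL-Analysis.Analysis"
begin

section \<open>Surface measure on the unit sphere of three-dimensional space\<close>

abbreviation S2 :: "(real^3) set" where
  "S2 \<equiv> sphere 0 1"

text \<open>
  The surface measure, realised as a Borel measure on the ambient space that is concentrated on
  the sphere. By polar coordinates the surface area of a Borel set \<open>A\<close> of the unit sphere is
  three times the volume of the cone of all \<open>r x\<close> with \<open>x\<close> in \<open>A\<close> and \<open>0 < r < 1\<close>;
  the map \<^term>\<open>sgn\<close> is the radial projection \<open>x / norm x\<close>.
\<close>
definition surf :: "(real^3) measure" where
  "surf = distr (density lborel (\<lambda>x. 3 * indicator (ball 0 1) x)) borel sgn"

section \<open>Smooth functions and tangential derivatives\<close>

definition partial_deriv :: "3 \<Rightarrow> (real^3 \<Rightarrow> real) \<Rightarrow> real^3 \<Rightarrow> real" where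
  "partial_deriv i f x = frechet_derivative f (at x) (axis i 1)"

primrec Ck_on :: "nat \<Rightarrow> (real^3) set \<Rightarrow> (real^3 \<Rightarrow> real) \<Rightarrow> bool" where
  "Ck_on 0 U f \<longleftrightarrow> continuous_on U f"
| "Ck_on (Suc k) U f \<longleftrightarrow> f differentiable_on U \<and> (\<forall>i. Ck_on k U (partial_deriv i f))"

text \<open>
  A function on the sphere is represented by a function on the ambient space of which only the
  values on the sphere matter. It is differentiated through its extension that is constant along
  rays (which is well behaved away from the origin): at points of the sphere the Euclidean
  gradient of this extension is the Riemannian gradient on the sphere.
\<close>
definition radial_ext :: "(real^3 \<Rightarrow> real) \<Rightarrow> real^3 \<Rightarrow> real" where
  "radial_ext f x = f (sgn x)"

definition tang_deriv :: "3 \<Rightarrow> (real^3 \<Rightarrow> real) \<Rightarrow> real^3 \<Rightarrow> real" where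
  "tang_deriv i f = partial_deriv i (radial_ext f)"

text \<open>
  The smooth functions on the sphere with compact support in \<open>\<Omega>\<close>. As the sphere is compact,
  every closed subset of it is compact.
\<close>
definition test_functions :: "(real^3) set \<Rightarrow> (real^3 \<Rightarrow> real) set" where
  "test_functions \<Omega> =
     {f. (\<forall>k. Ck_on k (- {0}) (radial_ext f)) \<and> closure {x \<in> S2. f x \<noteq> 0} \<subseteq> \<Omega>}"

section \<open>Sobolev spaces\<close>

definition L2 :: "(real^3) set \<Rightarrow> (real^3 \<Rightarrow> real) set" where
  "L2 \<Omega> = {u. set_borel_measurable surf \<Omega> u \<and> set_integrable surf \<Omega> (\<lambda>x. (u x)\<^sup>2)}"

text \<open>
  The integration by parts formula on the sphere for the \<open>i\<close>-th component of the tangential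
  gradient reads: the integral of \<open>D\<^sub>i (u \<phi>)\<close> is the integral of \<open>2 u \<phi> x\<^sub>i\<close>, where \<open>2\<close> is the
  mean curvature (sum of the principal curvatures) and \<open>x\<close> is the outer unit normal.
\<close>
definition weak_deriv :: "(real^3) set \<Rightarrow> 3 \<Rightarrow> (real^3 \<Rightarrow> real) \<Rightarrow> (real^3 \<Rightarrow> real) \<Rightarrow> bool" where
  "weak_deriv \<Omega> i u v \<longleftrightarrow>
     (\<forall>\<phi>\<in>test_functions \<Omega>.
        (LINT x:\<Omega>|surf. u x * tang_deriv i \<phi> x)
        = - (LINT x:\<Omega>|surf. v x * \<phi> x) + (LINT x:\<Omega>|surf. 2 * u x * \<phi> x * x $ i))"

text \<open>
  \<open>D \<Omega> i u\<close> is a representative of the weak derivative, which is unique up to null sets;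
  it is meaningful only if a square integrable weak derivative exists.
\<close>
definition D :: "(real^3) set \<Rightarrow> 3 \<Rightarrow> (real^3 \<Rightarrow> real) \<Rightarrow> real^3 \<Rightarrow> real" where
  "D \<Omega> i u = (SOME v. v \<in> L2 \<Omega> \<and> weak_deriv \<Omega> i u v)"

definition H1 :: "(real^3) set \<Rightarrow> (real^3 \<Rightarrow> real) set" where
  "H1 \<Omega> = {u \<in> L2 \<Omega>. \<forall>i. \<exists>v\<in>L2 \<Omega>. weak_deriv \<Omega> i u v}"

definition H2 :: "(real^3) set \<Rightarrow> (real^3 \<Rightarrow> real) set" where
  "H2 \<Omega> = {u \<in> H1 \<Omega>. \<forall>i. D \<Omega> i u \<in> H1 \<Omega>}"

text \<open>
  The sum of the squares of all \<open>D\<^sub>j D\<^sub>i u\<close> equals the squared norm of the covariant Hessian of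
  \<open>u\<close> plus the squared norm of its gradient, so this is the usual norm up to equivalence.
\<close>
definition H2_norm :: "(real^3) set \<Rightarrow> (real^3 \<Rightarrow> real) \<Rightarrow> real" where
  "H2_norm \<Omega> u = sqrt ((LINT x:\<Omega>|surf. (u x)\<^sup>2)
     + (\<Sum>i\<in>UNIV. LINT x:\<Omega>|surf. (D \<Omega> i u x)\<^sup>2)
     + (\<Sum>i\<in>UNIV. \<Sum>j\<in>UNIV. LINT x:\<Omega>|surf. (D \<Omega> j (D \<Omega> i u) x)\<^sup>2))"

definition H20 :: "(real^3) set \<Rightarrow> (real^3 \<Rightarrow> real) set" where
  "H20 \<Omega> = {u \<in> H2 \<Omega>. \<forall>\<epsilon>>0. \<exists>\<phi>\<in>test_functions \<Omega>. H2_norm \<Omega> (\<lambda>x. u x - \<phi> x) < \<epsilon>}"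

definition surf_grad :: "(real^3) set \<Rightarrow> (real^3 \<Rightarrow> real) \<Rightarrow> real^3 \<Rightarrow> real^3" where
  "surf_grad \<Omega> u x = (\<chi> i. D \<Omega> i u x)"

definition surf_laplacian :: "(real^3) set \<Rightarrow> (real^3 \<Rightarrow> real) \<Rightarrow> real^3 \<Rightarrow> real" where
  "surf_laplacian \<Omega> u x = (\<Sum>i\<in>UNIV. D \<Omega> i (D \<Omega> i u) x)"

section \<open>The buckling problem\<close>

definition buckling_space :: "(real^3) set \<Rightarrow> (real^3 \<Rightarrow> real) set" where
  "buckling_space \<Omega> =
     (if \<Omega> = S2 then {u \<in> H20 \<Omega>. (LINT x:\<Omega>|surf. u x) = 0} else H20 \<Omega>)"

definition buckling_eigenspace :: "(real^3) set \<Rightarrow> real \<Rightarrow> (real^3 \<Rightarrow> real) set" where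
  "buckling_eigenspace \<Omega> s = {u \<in> buckling_space \<Omega>. \<forall>\<phi>\<in>buckling_space \<Omega>.
     (LINT x:\<Omega>|surf. surf_laplacian \<Omega> u x * surf_laplacian \<Omega> \<phi> x)
     = s * (LINT x:\<Omega>|surf. surf_grad \<Omega> u x \<bullet> surf_grad \<Omega> \<phi> x)}"

text \<open>
  \<open>E\<close>, taken modulo equality almost everywhere on \<open>\<Omega>\<close>, has dimension \<open>n\<close>: it has a basis
  \<open>b 0, \<dots>, b (n - 1)\<close> modulo null functions.
\<close>
definition has_dim_ae :: "(real^3) set \<Rightarrow> (real^3 \<Rightarrow> real) set \<Rightarrow> nat \<Rightarrow> bool" where
  "has_dim_ae \<Omega> E n \<longleftrightarrow> (\<exists>b :: nat \<Rightarrow> real^3 \<Rightarrow> real.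
     (\<forall>i<n. b i \<in> E) \<and>
     (\<forall>c. (AE x in surf. x \<in> \<Omega> \<longrightarrow> (\<Sum>i<n. c i * b i x) = 0) \<longrightarrow> (\<forall>i<n. c i = 0)) \<and>
     (\<forall>u\<in>E. \<exists>c. AE x in surf. x \<in> \<Omega> \<longrightarrow> u x = (\<Sum>i<n. c i * b i x)))"

text \<open>
  \<open>\<sigma> 0 \<le> \<sigma> 1 \<le> \<dots>\<close> lists the buckling eigenvalues on \<open>\<Omega>\<close>, counted with multiplicity: every
  real number occurs as often as the dimension of its eigenspace tells (never, if it is not an
  eigenvalue).
\<close>
definition buckling_eigenvalues :: "(real^3) set \<Rightarrow> (nat \<Rightarrow> real) \<Rightarrow> bool" where
  "buckling_eigenvalues \<Omega> \<sigma> \<longleftrightarrow> (\<forall>j. 0 < \<sigma> j) \<and> mono \<sigma> \<and>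
     (\<forall>s. finite {j. \<sigma> j = s} \<and> has_dim_ae \<Omega> (buckling_eigenspace \<Omega> s) (card {j. \<sigma> j = s}))"

text \<open>The sum is taken in the extended nonnegative reals, so that no convergence is presupposed.\<close>
definition riesz_mean1 :: "(nat \<Rightarrow> real) \<Rightarrow> real \<Rightarrow> ennreal" where
  "riesz_mean1 \<sigma> z = (\<Sum>j. ennreal (max (z - \<sigma> j) 0))"

end

theory Submission
  imports Defs "HOL-Library.Discrete_Functions"
begin

text \<open>
  The idea is to compare \<open>\<Omega>\<close> with the whole sphere by averaging the variational principle over the
  spherical harmonics, as in the inequalities of Berezin and of Li and Yau. Let \<open>u\<^sub>j\<close> be
  eigenfunctions for \<open>\<sigma>\<^sub>j\<close> whose gradients are orthonormal on \<open>\<Omega>\<close>, and let \<open>e\<^sub>i\<close> be an orthonormal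
  basis of harmonics on the sphere, with \<open>- \<Delta> e\<^sub>i = l\<^sub>i e\<^sub>i\<close>, where \<open>l\<^sub>i = n (n + 1)\<close> in degree \<open>n\<close>. Since \<open>u\<^sub>j\<close> is
  a limit of test functions, its extension by 0 can be expanded on the sphere: with the weights
  \<open>w\<^sub>i\<^sub>j = \<langle>\<nabla>u\<^sub>j, \<nabla>e\<^sub>i\<rangle>\<^sup>2 / l\<^sub>i\<close> for \<open>l\<^sub>i > 0\<close> one has \<open>\<Sum>\<^sub>i w\<^sub>i\<^sub>j = 1\<close> and \<open>\<Sum>\<^sub>i l\<^sub>i w\<^sub>i\<^sub>j = \<sigma>\<^sub>j\<close>, so that \<open>z - \<sigma>\<^sub>j\<close> is at most
  \<open>\<Sum>\<^sub>i (z - l\<^sub>i)\<^sub>+ w\<^sub>i\<^sub>j\<close> (\<open>spectral_inequality_H20\<close>). The sum over \<open>j\<close> of \<open>w\<^sub>i\<^sub>j\<close> is at most the integral of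
  \<open>\<bar>\<nabla>e\<^sub>i\<bar>\<^sup>2 / l\<^sub>i\<close> over \<open>\<Omega>\<close> by Bessel's inequality (\<open>bessel_gradients\<close>), and the sum of \<open>\<bar>\<nabla>e\<^sub>i\<bar>\<^sup>2\<close> over the
  harmonics of degree \<open>n\<close> is a constant, at most \<open>n (n + 1) (2 n + 1) / (4 \<pi>)\<close>
  (\<open>block_sum_gradients\<close>). Hence the Riesz mean is at most \<open>\<bar>\<Omega>\<bar> / (4 \<pi>)\<close> times the sum of
  \<open>(2 n + 1) (z - n (n + 1))\<^sub>+\<close> over \<open>n \<ge> 1\<close>, and that sum is \<open>(z - 1/2)\<^sup>2 / 2\<close> minus a square
  (\<open>sphere_sum_eq\<close>). This gives the first bound; for \<open>z \<ge> 1/4\<close> it implies the second one, and for smaller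
  \<open>z\<close> the sum is 0.

  The harmonics are obtained by orthonormalising the monomials in the order of their degrees. The
  Laplacian is symmetric and acts on degree \<open>n\<close> as \<open>- n (n + 1)\<close> up to lower degrees, which makes the
  basis consist of eigenfunctions (\<open>laplace_harmonic\<close>). The rotation fields act antisymmetrically on
  the harmonics of one degree, which makes the sum of their squares constant (\<open>block_sum_squares\<close>);
  completeness is the Stone--Weierstrass theorem (\<open>parseval\<close>). All integrations by parts come from the
  invariance of the surface measure under rotations (\<open>integral_rot_deriv\<close>).

  Two points concern the weak formulation. The chosen representatives of weak derivatives are
  unique almost everywhere by the fundamental lemma of the calculus of variations
  (\<open>fundamental_lemma\<close>). And the form
  \<open>\<langle>\<nabla>u, \<nabla>v\<rangle>\<close> is definite on each eigenspace because a function with vanishing gradient would be an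
  eigenfunction for a negative number as well (\<open>eigenfunction_zero_gradient\<close>).
\<close>

section \<open>Functions of class Ck on open sets\<close>

lemma partial_deriv_has_derivative:
  "(f has_derivative f') (at x) \<Longrightarrow> partial_deriv i f x = f' (axis i 1)"
  unfolding partial_deriv_def by (metis frechet_derivative_at)

lemma has_derivative_partial_deriv:
  fixes f :: "real^3 \<Rightarrow> real"
  assumes "f differentiable (at x)"
  shows "(f has_derivative (\<lambda>h. \<Sum>i\<in>UNIV. h $ i * partial_deriv i f x)) (at x)"
proof -
  let ?f' = "frechet_derivative f (at x)"
  have d: "(f has_derivative ?f') (at x)"
    using assms frechet_derivative_works by blast
  then have lin: "linear ?f'"
    by (rule has_derivative_linear)
  have "?f' = (\<lambda>h. \<Sum>i\<in>UNIV. h $ i * partial_deriv i f x)"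
  proof
    fix h :: "real^3"
    have "?f' h = ?f' (\<Sum>i\<in>UNIV. h $ i *\<^sub>R axis i 1)"
      using basis_expansion[of h] by (simp add: scalar_mult_eq_scaleR)
    also have "\<dots> = (\<Sum>i\<in>UNIV. h $ i * ?f' (axis i 1))"
      using lin by (simp add: linear_sum linear_scale)
    finally show "?f' h = (\<Sum>i\<in>UNIV. h $ i * partial_deriv i f x)"
      by (simp add: partial_deriv_def)
  qed
  then show ?thesis using d by simp
qed

lemma partial_deriv_cong:
  assumes "open U" "x \<in> U" "\<And>y. y \<in> U \<Longrightarrow> f y = g y"
  shows "partial_deriv i f x = partial_deriv i g x"
proof -
  have "(f has_derivative D) (at x) \<longleftrightarrow> (g has_derivative D) (at x)" for D
    using has_derivative_transform_within_open[of f D x UNIV U g]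
      has_derivative_transform_within_open[of g D x UNIV U f] assms by auto
  then show ?thesis
    unfolding partial_deriv_def frechet_derivative_def by simp
qed

lemma Ck_on_cong:
  assumes "open U" "\<And>x. x \<in> U \<Longrightarrow> f x = g x"
  shows "Ck_on k U f \<longleftrightarrow> Ck_on k U g"
  using assms(2)
proof (induction k arbitrary: f g)
  case 0
  then show ?case by (auto intro: continuous_on_cong)
next
  case (Suc k)
  have "f differentiable_on U \<longleftrightarrow> g differentiable_on U"
    using Suc.prems by (metis differentiable_on_def differentiable_transform_within zero_less_one)
  moreover have "Ck_on k U (partial_deriv i f) \<longleftrightarrow> Ck_on k U (partial_deriv i g)" for i
    using partial_deriv_cong[OF assms(1) _ Suc.prems] by (intro Suc.IH) auto
  ultimately show ?case by simp
qed

lemma Ck_on_Suc_imp: "Ck_on (Suc k) U f \<Longrightarrow> Ck_on k U f"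
  by (induction k arbitrary: f) (auto simp: differentiable_imp_continuous_on)

lemma smooth_unfold:
  "(\<forall>k. Ck_on k U f) \<longleftrightarrow> f differentiable_on U \<and> (\<forall>i k. Ck_on k U (partial_deriv i f))"
  (is "?L \<longleftrightarrow> ?R")
proof
  assume L: ?L
  then have "\<And>k. Ck_on (Suc k) U f" by blast
  then show ?R by simp
next
  assume R: ?R
  show ?L
  proof
    fix k show "Ck_on k U f"
      using R by (cases k) (auto simp: differentiable_imp_continuous_on)
  qed
qed

lemma Ck_on_differentiable:
  assumes "open U" "Ck_on (Suc k) U f" "x \<in> U"
  shows "f differentiable (at x)"
  using assms by (auto simp: differentiable_on_eq_differentiable_at)

lemma partial_deriv_add:
  assumes "f differentiable (at x)" "g differentiable (at x)"
  shows "partial_deriv i (\<lambda>x. f x + g x) x = partial_deriv i f x + partial_deriv i g x"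
  using partial_deriv_has_derivative[OF has_derivative_add[OF has_derivative_partial_deriv[OF assms(1)] has_derivative_partial_deriv[OF assms(2)]], of i]
  by (simp add: axis_def if_distrib[of "\<lambda>x. x * _"] sum.delta cong: if_cong)

lemma partial_deriv_mult:
  assumes "f differentiable (at x)" "g differentiable (at x)"
  shows "partial_deriv i (\<lambda>x. f x * g x) x = partial_deriv i f x * g x + f x * partial_deriv i g x"
  using partial_deriv_has_derivative[OF has_derivative_mult[OF has_derivative_partial_deriv[OF assms(1)] has_derivative_partial_deriv[OF assms(2)]], of i]
  by (simp add: axis_def if_distrib[of "\<lambda>x. x * _"] sum.delta cong: if_cong)

lemma partial_deriv_compose:
  assumes "g differentiable (at x)" "(h has_real_derivative d) (at (g x))"
  shows "partial_deriv i (\<lambda>x. h (g x)) x = d * partial_deriv i g x"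
  using partial_deriv_has_derivative[OF has_derivative_compose[OF has_derivative_partial_deriv[OF assms(1)] has_field_derivative_imp_has_derivative[OF assms(2)]], of i]
  by (simp add: axis_def if_distrib[of "\<lambda>x. x * _"] sum.delta cong: if_cong)

lemma partial_deriv_const: "partial_deriv i (\<lambda>x. c) x = 0"
  by (rule partial_deriv_has_derivative) (rule has_derivative_const)

lemma partial_deriv_component: "partial_deriv i (\<lambda>x. x $ j) x = (if i = j then 1 else 0)"
  by (subst partial_deriv_has_derivative[where f' = "\<lambda>h. h $ j"])
     (auto simp: axis_def intro!: bounded_linear_imp_has_derivative bounded_linear_vec_nth)

lemma Ck_on_const: "Ck_on k U (\<lambda>x. c)"
proof (induction k arbitrary: c)
  case (Suc k)
  have "partial_deriv i (\<lambda>x. c) = (\<lambda>x. 0)" for i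
    by (auto simp: partial_deriv_const)
  then show ?case using Suc by auto
qed auto

lemma Ck_on_component: "Ck_on k U (\<lambda>x. x $ j)"
proof (cases k)
  case 0
  then show ?thesis by (auto intro: continuous_intros)
next
  case (Suc k')
  have "partial_deriv i (\<lambda>x. x $ j) = (\<lambda>x. if i = j then 1 else 0)" for i
    by (auto simp: partial_deriv_component)
  moreover have "(\<lambda>x::real^3. x $ j) differentiable_on U"
    by (auto simp: differentiable_on_def intro!: bounded_linear_imp_differentiable bounded_linear_vec_nth)
  ultimately show ?thesis using Suc by (auto simp: Ck_on_const)
qed

lemma Ck_on_add:
  assumes "open U" "Ck_on k U f" "Ck_on k U g"
  shows "Ck_on k U (\<lambda>x. f x + g x)"
  using assms(2,3)
proof (induction k arbitrary: f g)
  case 0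
  then show ?case by (auto intro: continuous_intros)
next
  case (Suc k)
  have "Ck_on k U (partial_deriv i (\<lambda>x. f x + g x))" for i
  proof -
    have "Ck_on k U (\<lambda>x. partial_deriv i f x + partial_deriv i g x)"
      using Suc by auto
    then show ?thesis
      using Suc.prems Ck_on_differentiable[OF assms(1)]
      by (subst Ck_on_cong[OF assms(1)]) (auto simp: partial_deriv_add)
  qed
  with Suc.prems show ?case by (auto intro: derivative_intros)
qed

lemma Ck_on_mult:
  assumes "open U" "Ck_on k U f" "Ck_on k U g"
  shows "Ck_on k U (\<lambda>x. f x * g x)"
  using assms(2,3)
proof (induction k arbitrary: f g)
  case 0
  then show ?case by (auto intro: continuous_intros)
next
  case (Suc k)
  have "Ck_on k U (partial_deriv i (\<lambda>x. f x * g x))" for i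
  proof -
    have "Ck_on k U (\<lambda>x. partial_deriv i f x * g x + f x * partial_deriv i g x)"
      using Suc Ck_on_Suc_imp[OF Suc.prems(1)] Ck_on_Suc_imp[OF Suc.prems(2)]
      by (intro Ck_on_add[OF assms(1)] Suc.IH) auto
    then show ?thesis
      using Suc.prems Ck_on_differentiable[OF assms(1)]
      by (subst Ck_on_cong[OF assms(1)]) (auto simp: partial_deriv_mult)
  qed
  with Suc.prems show ?case by (auto intro: derivative_intros)
qed

text \<open>
  The outer functions form a whole family closed under differentiation, because the chain rule
  replaces \<open>h\<close> by its derivative at every induction step. Powers and the functions
  \<open>p (1 / t) exp (- 1 / t)\<close> are the two families used below.
\<close>
lemma Ck_on_compose:
  fixes H :: "(real \<Rightarrow> real) set"
  assumes "open U" and H: "\<And>h. h \<in> H \<Longrightarrow> \<exists>h'\<in>H. \<forall>t\<in>T. (h has_real_derivative h' t) (at t)"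
    and "Ck_on k U g" "g ` U \<subseteq> T" "h \<in> H"
  shows "Ck_on k U (\<lambda>x. h (g x))"
  using assms(3-5)
proof (induction k arbitrary: h)
  case 0
  obtain h' where h': "\<forall>t\<in>T. (h has_real_derivative h' t) (at t)"
    using H 0 by blast
  then have "continuous_on T h"
    by (intro continuous_at_imp_continuous_on) (auto intro: DERIV_isCont)
  with 0 show ?case by (auto intro!: continuous_on_compose2[of T h])
next
  case (Suc k)
  obtain h' where h': "h' \<in> H" "\<forall>t\<in>T. (h has_real_derivative h' t) (at t)"
    using H Suc by blast
  have diff: "g differentiable (at x)" if "x \<in> U" for x
    using Suc.prems(1) that Ck_on_differentiable[OF assms(1)] by blast
  have "(\<lambda>x. h (g x)) differentiable (at x)" if "x \<in> U" for x
  proof -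
    have "g x \<in> T" using that Suc.prems by auto
    then have "h differentiable (at (g x))"
      using h'(2) unfolding real_differentiable_def by blast
    then show ?thesis using differentiable_chain_at[OF diff[OF that]] by (simp add: o_def)
  qed
  moreover have "Ck_on k U (partial_deriv i (\<lambda>x. h (g x)))" for i
  proof -
    have "Ck_on k U (\<lambda>x. h' (g x) * partial_deriv i g x)"
    proof (rule Ck_on_mult[OF assms(1)])
      show "Ck_on k U (\<lambda>x. h' (g x))"
        by (rule Suc.IH[OF Ck_on_Suc_imp[OF Suc.prems(1)] Suc.prems(2) h'(1)])
      show "Ck_on k U (partial_deriv i g)"
        using Suc.prems(1) by simp
    qed
    moreover have "partial_deriv i (\<lambda>x. h (g x)) x = h' (g x) * partial_deriv i g x" if "x \<in> U" for x
    proof (rule partial_deriv_compose[OF diff[OF that]])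
      show "(h has_real_derivative h' (g x)) (at (g x))"
        using h'(2) that Suc.prems(2) by auto
    qed
    ultimately show ?thesis
      using Ck_on_cong[OF assms(1), of "partial_deriv i (\<lambda>x. h (g x))"
          "\<lambda>x. h' (g x) * partial_deriv i g x" k] by simp
  qed
  ultimately show ?case
    using assms(1) by (auto simp: differentiable_on_eq_differentiable_at)
qed

lemma Ck_on_sum:
  assumes "open U" "\<And>i. i \<in> I \<Longrightarrow> Ck_on k U (f i)"
  shows "Ck_on k U (\<lambda>x. \<Sum>i\<in>I. f i x)"
  using assms(2)
  by (induction I rule: infinite_finite_induct) (auto simp: Ck_on_const intro!: Ck_on_add[OF assms(1)])

lemma Ck_on_norm_powr: "Ck_on k (- {0}) (\<lambda>x. (norm x) powr p)"
proof -
  define H where "H = {h. \<exists>c p. h = (\<lambda>t::real. c * t powr p)}"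
  \<comment> \<open>powers of the norm are powers of the polynomial \<open>x \<bullet> x\<close>, which is positive off the origin\<close>
  have "Ck_on k (- {0}) (\<lambda>x. (\<lambda>t. 1 * t powr (p/2)) ((\<lambda>x. \<Sum>i\<in>UNIV. x $ i * x $ i) x))"
  proof (rule Ck_on_compose[where T = "{0<..}" and H = H
        and h = "\<lambda>t. 1 * t powr (p/2)" and g = "\<lambda>x. \<Sum>i\<in>UNIV. x $ i * x $ i"])
    fix h assume "h \<in> H"
    then obtain c p where h: "h = (\<lambda>t. c * t powr p)" by (auto simp: H_def)
    have "\<forall>t\<in>{0<..}. (h has_real_derivative ((c * p) * t powr (p - 1))) (at t)"
      unfolding h by (auto intro!: derivative_eq_intros)
    then show "\<exists>h'\<in>H. \<forall>t\<in>{0<..}. (h has_real_derivative h' t) (at t)"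
      by (intro bexI[of _ "\<lambda>t. (c * p) * t powr (p - 1)"]) (auto simp: H_def)
  next
    show "(\<lambda>x::real^3. \<Sum>i\<in>UNIV. x $ i * x $ i) ` (- {0}) \<subseteq> {0<..}"
    proof (rule image_subsetI)
      fix x :: "real^3" assume "x \<in> - {0}"
      then have "0 < x \<bullet> x" by simp
      then show "(\<Sum>i\<in>UNIV. x $ i * x $ i) \<in> {0<..}"
        unfolding inner_vec_def inner_real_def by simp
    qed
    show "(\<lambda>t. 1 * t powr (p/2)) \<in> H" unfolding H_def by blast
  qed (auto intro!: Ck_on_sum Ck_on_mult Ck_on_component simp: H_def)
  moreover have "(\<Sum>i\<in>UNIV. x $ i * x $ i) powr (p/2) = norm x powr p" for x :: "real^3"
  proof -
    have "(\<Sum>i\<in>UNIV. x $ i * x $ i) = norm x powr 2"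
      using power2_norm_eq_inner[of x] by (simp add: inner_vec_def)
    then show ?thesis by (simp only: powr_powr) simp
  qed
  ultimately show ?thesis by simp
qed

section \<open>Smooth functions on the sphere\<close>

definition smooth_S2 :: "(real^3 \<Rightarrow> real) \<Rightarrow> bool" where
  "smooth_S2 f \<longleftrightarrow> (\<forall>k. Ck_on k (- {0}) (radial_ext f))"

lemma sgn_S2 [simp]: "x \<in> S2 \<Longrightarrow> sgn x = x"
  by (simp add: sgn_div_norm)

lemma sgn_in_S2: "x \<noteq> 0 \<Longrightarrow> sgn x \<in> S2" for x :: "real^3"
  by (simp add: norm_sgn)

lemma S2_nonzero: "x \<in> S2 \<Longrightarrow> x \<noteq> 0"
  by auto

lemma radial_ext_S2 [simp]: "x \<in> S2 \<Longrightarrow> radial_ext f x = f x"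
  by (simp add: radial_ext_def sgn_S2)

lemma radial_ext_eq: "radial_ext f = (\<lambda>x. f (sgn x))"
  by (auto simp: radial_ext_def)

lemma open_punctured: "open (- {0::real^3})"
  by auto

lemma radial_ext_cong:
  "(\<And>x. x \<in> S2 \<Longrightarrow> f x = g x) \<Longrightarrow> x \<noteq> 0 \<Longrightarrow> radial_ext f x = radial_ext g x"
  unfolding radial_ext_def by (metis sgn_in_S2)

lemma smooth_S2_cong:
  "(\<And>x. x \<in> S2 \<Longrightarrow> f x = g x) \<Longrightarrow> smooth_S2 f \<longleftrightarrow> smooth_S2 g"
  unfolding smooth_S2_def using Ck_on_cong[OF open_punctured, of "radial_ext f" "radial_ext g"] radial_ext_cong[of f g]
  by simp

lemma tang_deriv_cong:
  assumes "\<And>x. x \<in> S2 \<Longrightarrow> f x = g x" "x \<noteq> 0"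
  shows "tang_deriv i f x = tang_deriv i g x"
  unfolding tang_deriv_def
  by (rule partial_deriv_cong[OF open_punctured]) (use assms radial_ext_cong[of f g] in auto)

lemma smooth_S2_differentiable:
  assumes "smooth_S2 f" "x \<noteq> 0"
  shows "radial_ext f differentiable (at x)"
  using assms Ck_on_differentiable[OF open_punctured, of 0 "radial_ext f" x]
  unfolding smooth_S2_def by blast

lemma smooth_S2_continuous_radial: "smooth_S2 f \<Longrightarrow> continuous_on (- {0}) (radial_ext f)"
  unfolding smooth_S2_def by (metis Ck_on.simps(1))

lemma smooth_S2_continuous: "smooth_S2 f \<Longrightarrow> continuous_on S2 f"
  using continuous_on_subset[OF smooth_S2_continuous_radial, of f S2]
    continuous_on_cong[of S2 S2 "radial_ext f" f] by (force simp: subset_iff)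

lemma smooth_S2_const [simp]: "smooth_S2 (\<lambda>x. c)"
  unfolding smooth_S2_def radial_ext_def by (simp add: Ck_on_const)

lemma smooth_S2_add: "smooth_S2 f \<Longrightarrow> smooth_S2 g \<Longrightarrow> smooth_S2 (\<lambda>x. f x + g x)"
  unfolding smooth_S2_def radial_ext_def using Ck_on_add[OF open_punctured] by simp

lemma smooth_S2_mult: "smooth_S2 f \<Longrightarrow> smooth_S2 g \<Longrightarrow> smooth_S2 (\<lambda>x. f x * g x)"
  unfolding smooth_S2_def radial_ext_def using Ck_on_mult[OF open_punctured] by simp

lemma smooth_S2_cmult: "smooth_S2 f \<Longrightarrow> smooth_S2 (\<lambda>x. c * f x)"
  by (rule smooth_S2_mult) auto

lemma smooth_S2_diff: "smooth_S2 f \<Longrightarrow> smooth_S2 g \<Longrightarrow> smooth_S2 (\<lambda>x. f x - g x)"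
  using smooth_S2_add[OF _ smooth_S2_cmult[of g "-1"]] by simp

lemma smooth_S2_sum: "(\<And>i. i \<in> I \<Longrightarrow> smooth_S2 (f i)) \<Longrightarrow> smooth_S2 (\<lambda>x. \<Sum>i\<in>I. f i x)"
  by (induction I rule: infinite_finite_induct) (auto intro: smooth_S2_add)

lemma radial_ext_component:
  "x \<noteq> 0 \<Longrightarrow> radial_ext (\<lambda>x. x $ j) x = x $ j * norm x powr (-1)"
  by (simp add: radial_ext_def sgn_div_norm powr_minus divide_inverse)

lemma smooth_S2_component: "smooth_S2 (\<lambda>x. x $ j)"
  unfolding smooth_S2_def
proof
  fix k
  have "Ck_on k (- {0}) (\<lambda>x. x $ j * norm x powr (-1))"
    by (rule Ck_on_mult[OF open_punctured Ck_on_component Ck_on_norm_powr])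
  then show "Ck_on k (- {0}) (radial_ext (\<lambda>x. x $ j))"
    using Ck_on_cong[OF open_punctured, of "radial_ext (\<lambda>x. x $ j)" "\<lambda>x. x $ j * norm x powr (-1)" k]
      radial_ext_component by simp
qed

text \<open>
  The extension that is constant along rays is homogeneous of degree 0, so its derivatives are
  homogeneous of degree -1; extending them from the sphere along rays multiplies them by the norm.
  This is what makes tangential derivatives smooth again.
\<close>
lemma radial_ext_tang_deriv:
  assumes "smooth_S2 f" "x \<noteq> 0"
  shows "radial_ext (tang_deriv i f) x = tang_deriv i f x * norm x powr 1"
proof -
  define c where "c = inverse (norm x)"
  have c: "c > 0" using assms by (simp add: c_def)
  have s: "c *\<^sub>R x = sgn x" by (simp add: c_def sgn_div_norm)
  let ?F = "radial_ext f"
  have "?F differentiable (at (c *\<^sub>R x))"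
    using assms c by (intro smooth_S2_differentiable) auto
  then have "((\<lambda>y. ?F (c *\<^sub>R y)) has_derivative
      (\<lambda>h. \<Sum>i\<in>UNIV. (c *\<^sub>R h) $ i * partial_deriv i ?F (c *\<^sub>R x))) (at x)"
    by (intro has_derivative_compose[of "\<lambda>y. c *\<^sub>R y" "\<lambda>h. c *\<^sub>R h" x UNIV ?F])
       (auto intro: has_derivative_partial_deriv derivative_eq_intros)
  moreover have "(\<lambda>y. ?F (c *\<^sub>R y)) = ?F"
    using c by (auto simp: radial_ext_def sgn_scaleR)
  ultimately have "(?F has_derivative
      (\<lambda>h. \<Sum>i\<in>UNIV. (c *\<^sub>R h) $ i * partial_deriv i ?F (c *\<^sub>R x))) (at x)"
    by simp
  then have "partial_deriv i ?F x = c * partial_deriv i ?F (sgn x)"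
    using partial_deriv_has_derivative[of ?F _ x i]
    by (simp add: s axis_def if_distrib[of "\<lambda>x. _ * x"] if_distrib[of "\<lambda>x. x * _"] sum.delta cong: if_cong)
  then show ?thesis
    using assms(2) by (simp add: radial_ext_eq[of "partial_deriv i (radial_ext f)"] tang_deriv_def c_def)
qed

lemma smooth_S2_tang_deriv:
  assumes "smooth_S2 f"
  shows "smooth_S2 (tang_deriv i f)"
  unfolding smooth_S2_def
proof
  fix k
  have "Ck_on k (- {0}) (tang_deriv i f)"
    using assms smooth_unfold[of "- {0}" "radial_ext f"] unfolding smooth_S2_def tang_deriv_def by blast
  then have "Ck_on k (- {0}) (\<lambda>x. tang_deriv i f x * norm x powr 1)"
    by (rule Ck_on_mult[OF open_punctured _ Ck_on_norm_powr])
  then show "Ck_on k (- {0}) (radial_ext (tang_deriv i f))"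
    using Ck_on_cong[OF open_punctured, of "radial_ext (tang_deriv i f)" "\<lambda>x. tang_deriv i f x * norm x powr 1" k]
      radial_ext_tang_deriv[OF assms] by simp
qed

lemma tang_deriv_const [simp]: "tang_deriv i (\<lambda>x. c) x = 0"
  by (simp add: tang_deriv_def radial_ext_eq partial_deriv_const)

lemma tang_deriv_add:
  "smooth_S2 f \<Longrightarrow> smooth_S2 g \<Longrightarrow> x \<noteq> 0 \<Longrightarrow>
   tang_deriv i (\<lambda>x. f x + g x) x = tang_deriv i f x + tang_deriv i g x"
  using partial_deriv_add[of "radial_ext f" x "radial_ext g" i] smooth_S2_differentiable[unfolded radial_ext_eq]
  by (simp add: tang_deriv_def radial_ext_eq)

lemma tang_deriv_mult:
  "smooth_S2 f \<Longrightarrow> smooth_S2 g \<Longrightarrow> x \<in> S2 \<Longrightarrow>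
   tang_deriv i (\<lambda>x. f x * g x) x = tang_deriv i f x * g x + f x * tang_deriv i g x"
  using partial_deriv_mult[of "radial_ext f" x "radial_ext g" i] smooth_S2_differentiable[OF _ S2_nonzero, unfolded radial_ext_eq]
  by (simp add: tang_deriv_def radial_ext_eq)

lemma tang_deriv_cmult:
  assumes "smooth_S2 f" "x \<noteq> 0"
  shows "tang_deriv i (\<lambda>x. c * f x) x = c * tang_deriv i f x"
  using partial_deriv_mult[of "\<lambda>x. c" x "radial_ext f" i] smooth_S2_differentiable[OF assms, unfolded radial_ext_eq]
  by (simp add: tang_deriv_def radial_ext_eq partial_deriv_const)

lemma tang_deriv_diff:
  "smooth_S2 f \<Longrightarrow> smooth_S2 g \<Longrightarrow> x \<noteq> 0 \<Longrightarrow>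
   tang_deriv i (\<lambda>x. f x - g x) x = tang_deriv i f x - tang_deriv i g x"
  using tang_deriv_add[of f "\<lambda>x. (-1) * g x" x i] tang_deriv_cmult[of g x i "-1"] smooth_S2_cmult[of g "-1"]
  by simp

lemma tang_deriv_sum:
  assumes "\<And>k. k \<in> I \<Longrightarrow> smooth_S2 (f k)" "x \<noteq> 0"
  shows "tang_deriv i (\<lambda>x. \<Sum>k\<in>I. f k x) x = (\<Sum>k\<in>I. tang_deriv i (f k) x)"
  using assms(1)
proof (induction I rule: infinite_finite_induct)
  case (insert k I)
  then have "tang_deriv i (\<lambda>x. f k x + (\<Sum>k\<in>I. f k x)) x = tang_deriv i (f k) x + tang_deriv i (\<lambda>x. \<Sum>k\<in>I. f k x) x"
    using assms(2) by (intro tang_deriv_add smooth_S2_sum) auto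
  with insert show ?case by simp
qed auto

lemma tang_deriv_component:
  assumes x: "x \<in> S2"
  shows "tang_deriv i (\<lambda>x. x $ j) x = (if i = j then 1 else 0) - x $ i * x $ j"
proof -
  have nz: "x \<noteq> 0" and n1: "norm x = 1" using x by auto
  have "((\<lambda>x. x $ j * inverse (norm x)) has_derivative
      (\<lambda>h. h $ j * inverse (norm x) + x $ j * (- (inverse (norm x) * (sgn x \<bullet> h) * inverse (norm x))))) (at x)"
    using has_derivative_mult[OF bounded_linear_imp_has_derivative[OF bounded_linear_vec_nth[of j]]
        Deriv.has_derivative_inverse[OF _ has_derivative_norm[of x]]] nz
    by (simp add: add.commute inner_commute)
  then have "((\<lambda>x. x $ j * inverse (norm x)) has_derivative (\<lambda>h. h $ j - x $ j * (x \<bullet> h))) (at x)"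
    using x by (simp add: n1)
  moreover have "radial_ext (\<lambda>x. x $ j) = (\<lambda>x. x $ j * inverse (norm x))"
    by (auto simp: radial_ext_def sgn_div_norm)
  ultimately have "tang_deriv i (\<lambda>x. x $ j) x = axis i 1 $ j - x $ j * (x \<bullet> axis i 1)"
    unfolding tang_deriv_def by (simp add: partial_deriv_has_derivative)
  moreover have "x \<bullet> axis i 1 = x $ i" "(axis i 1 :: real^3) $ j = (if i = j then 1 else 0)"
    by (simp_all add: inner_axis, simp add: axis_def)
  ultimately show ?thesis by simp
qed

text \<open>
  The derivative along a ray of a function that is constant on it vanishes.
\<close>
lemma tang_deriv_radial:
  assumes "smooth_S2 f" "x \<noteq> 0"
  shows "(\<Sum>i\<in>UNIV. x $ i * tang_deriv i f x) = 0"
proof -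
  let ?F = "radial_ext f"
  have "?F differentiable (at (1 *\<^sub>R x))"
    using assms by (simp add: smooth_S2_differentiable)
  then have 1: "((\<lambda>t. ?F (t *\<^sub>R x)) has_derivative
      (\<lambda>h. \<Sum>i\<in>UNIV. (h *\<^sub>R x) $ i * partial_deriv i ?F (1 *\<^sub>R x))) (at 1)"
    by (intro has_derivative_compose[of "\<lambda>t. t *\<^sub>R x" "\<lambda>h. h *\<^sub>R x" 1 UNIV ?F])
       (auto intro!: has_derivative_partial_deriv derivative_eq_intros)
  have "((\<lambda>t::real. ?F x) has_derivative (\<lambda>h. 0)) (at 1)"
    by simp
  then have 2: "((\<lambda>t. ?F (t *\<^sub>R x)) has_derivative (\<lambda>h. 0)) (at (1::real))"
    by (rule has_derivative_transform_within_open[where s = "{0<..}"])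
       (auto simp: radial_ext_def sgn_scaleR)
  from has_derivative_unique[OF 1 2] have "(\<Sum>i\<in>UNIV. (1 *\<^sub>R x) $ i * partial_deriv i ?F (1 *\<^sub>R x)) = 0"
    by meson
  then show ?thesis by (simp add: tang_deriv_def)
qed

section \<open>The surface measure\<close>

lemma sets_surf [simp, measurable_cong]: "sets surf = sets borel"
  by (simp add: surf_def)

lemma space_surf [simp]: "space surf = UNIV"
  by (simp add: surf_def)

lemma measurable_sgn_vec: "(sgn :: real^3 \<Rightarrow> real^3) \<in> borel_measurable borel"
proof -
  have "(\<lambda>x::real^3. x /\<^sub>R norm x) \<in> borel_measurable borel"
    by measurable
  then show ?thesis by (simp add: sgn_div_norm[abs_def])
qed

lemma emeasure_surf:
  assumes [measurable]: "A \<in> sets borel"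
  shows "emeasure surf A = 3 * emeasure lborel {x \<in> ball 0 1. sgn x \<in> A}"
proof -
  note measurable_sgn_vec[measurable]
  have [measurable]: "sgn -` A \<in> sets (borel :: (real^3) measure)"
    using measurable_sets[OF measurable_sgn_vec assms] by simp
  have "emeasure surf A = emeasure (density lborel (\<lambda>x. 3 * indicator (ball 0 1) x)) (sgn -` A)"
    unfolding surf_def by (subst emeasure_distr) (auto simp: measurable_sgn_vec)
  also have "\<dots> = (\<integral>\<^sup>+x. 3 * indicator (ball 0 1 \<inter> sgn -` A) x \<partial>lborel)"
    by (subst emeasure_density) (measurable, auto intro!: nn_integral_cong simp: indicator_inter_arith mult.assoc)
  also have "\<dots> = 3 * emeasure lborel (ball 0 1 \<inter> sgn -` A)"
    by (subst nn_integral_cmult_indicator) auto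
  also have "ball 0 1 \<inter> sgn -` A = {x \<in> ball 0 1. sgn x \<in> A}" by auto
  finally show ?thesis .
qed

lemma emeasure_surf_UNIV: "emeasure surf UNIV = ennreal (4 * pi)"
proof -
  have "emeasure surf UNIV = 3 * emeasure lborel (ball (0::real^3) 1)"
    by (subst emeasure_surf) (auto simp: ball_def)
  also have "\<dots> = ennreal 3 * ennreal (4 / 3 * pi)"
    by (subst emeasure_ball) (auto simp: unit_ball_vol_3)
  also have "\<dots> = ennreal (4 * pi)"
    by (subst ennreal_mult[symmetric]) auto
  finally show ?thesis .
qed

interpretation surf: finite_measure surf
  by standard (simp add: emeasure_surf_UNIV)

lemma AE_surf_S2: "AE x in surf. x \<in> S2"
proof (rule AE_I)
  have "{x \<in> ball 0 1. sgn x \<in> - S2} \<subseteq> {0 :: real^3}"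
    using sgn_in_S2 by auto
  then have "emeasure lborel {x \<in> ball 0 1. sgn x \<in> - S2} \<le> emeasure lborel {0 :: real^3}"
    by (rule emeasure_mono) auto
  then show "emeasure surf (- S2) = 0"
    by (subst emeasure_surf) auto
qed auto

lemma measure_surf_S2: "measure surf S2 = 4 * pi"
proof -
  have "measure surf S2 = measure surf UNIV"
    using AE_surf_S2 by (intro measure_eq_AE) auto
  then show ?thesis by (simp add: measure_def emeasure_surf_UNIV)
qed

text \<open>
  Integrals over \<open>\<Omega>\<close> are written with respect to the restricted measure, since the functions of the
  Sobolev spaces are constrained on \<open>\<Omega>\<close> only and need not be measurable elsewhere.
\<close>
definition surf_on :: "(real^3) set \<Rightarrow> (real^3) measure" where
  "surf_on \<Omega> = restrict_space surf \<Omega>"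

lemma space_surf_on [simp]: "space (surf_on \<Omega>) = \<Omega>"
  by (simp add: surf_on_def space_restrict_space)

lemma finite_measure_surf_on:
  "\<Omega> \<in> sets borel \<Longrightarrow> finite_measure (surf_on \<Omega>)"
  unfolding surf_on_def by (rule finite_measure_restrict_space) (auto intro: surf.finite_measure_axioms)

lemma set_lebesgue_integral_surf_on:
  fixes f :: "real^3 \<Rightarrow> real"
  assumes "\<Omega> \<in> sets borel"
  shows "(LINT x:\<Omega>|surf. f x) = integral\<^sup>L (surf_on \<Omega>) f"
  unfolding set_lebesgue_integral_def surf_on_def using assms by (subst integral_restrict_space) auto

lemma set_integrable_surf_on:
  fixes f :: "real^3 \<Rightarrow> real"
  assumes "\<Omega> \<in> sets borel"
  shows "set_integrable surf \<Omega> f \<longleftrightarrow> integrable (surf_on \<Omega>) f"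
  unfolding set_integrable_def surf_on_def using assms by (subst integrable_restrict_space) auto

lemma set_borel_measurable_surf_on:
  fixes f :: "real^3 \<Rightarrow> real"
  assumes "\<Omega> \<in> sets borel"
  shows "set_borel_measurable surf \<Omega> f \<longleftrightarrow> f \<in> borel_measurable (surf_on \<Omega>)"
  unfolding set_borel_measurable_def surf_on_def using assms
  by (subst borel_measurable_restrict_space_iff) auto

lemma AE_surf_on:
  "\<Omega> \<in> sets borel \<Longrightarrow> (AE x in surf_on \<Omega>. P x) \<longleftrightarrow> (AE x in surf. x \<in> \<Omega> \<longrightarrow> P x)"
  unfolding surf_on_def by (subst AE_restrict_space_iff) auto

lemma continuous_measurable_surf_on:
  fixes f :: "real^3 \<Rightarrow> real"
  assumes "continuous_on \<Omega> f" "\<Omega> \<in> sets borel"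
  shows "f \<in> borel_measurable (surf_on \<Omega>)"
proof -
  have "f \<in> borel_measurable (restrict_space borel \<Omega>)"
    using assms(1) by (rule borel_measurable_continuous_on_restrict)
  moreover have "sets (surf_on \<Omega>) = sets (restrict_space borel \<Omega>)"
    unfolding surf_on_def by (intro sets_restrict_space_cong) simp
  ultimately show ?thesis using measurable_cong_sets by blast
qed

lemma continuous_S2_bounded:
  fixes f :: "real^3 \<Rightarrow> real"
  assumes "continuous_on S2 f"
  obtains B where "\<And>x. x \<in> S2 \<Longrightarrow> \<bar>f x\<bar> \<le> B"
proof -
  have "bounded (f ` S2)"
    using assms by (intro compact_imp_bounded compact_continuous_image) auto
  then obtain B where "\<forall>y\<in>f ` S2. norm y \<le> B" unfolding bounded_iff by blast
  then show ?thesis by (intro that[of B]) auto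
qed

lemma integrable_surf_on_bounded:
  fixes f :: "real^3 \<Rightarrow> real"
  assumes "f \<in> borel_measurable (surf_on \<Omega>)" "\<Omega> \<in> sets borel" "\<And>x. x \<in> \<Omega> \<Longrightarrow> \<bar>f x\<bar> \<le> B"
  shows "integrable (surf_on \<Omega>) f"
  using assms by (intro finite_measure.integrable_const_bound[OF finite_measure_surf_on, of _ _ B] AE_I2) auto

lemma integrable_surf_on_continuous:
  fixes f :: "real^3 \<Rightarrow> real"
  assumes "continuous_on S2 f" "\<Omega> \<in> sets borel" "\<Omega> \<subseteq> S2"
  shows "integrable (surf_on \<Omega>) f"
proof -
  obtain B where "\<And>x. x \<in> S2 \<Longrightarrow> \<bar>f x\<bar> \<le> B"
    using continuous_S2_bounded[OF assms(1)] by blast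
  with assms show ?thesis
    by (intro integrable_surf_on_bounded[of _ _ B] continuous_measurable_surf_on)
       (auto intro: continuous_on_subset)
qed

lemma integral_surf_on_support:
  fixes f :: "real^3 \<Rightarrow> real"
  assumes "\<Omega> \<in> sets borel" "\<Omega> \<subseteq> S2" "\<And>x. x \<in> S2 \<Longrightarrow> x \<notin> \<Omega> \<Longrightarrow> f x = 0"
  shows "integral\<^sup>L (surf_on \<Omega>) f = integral\<^sup>L (surf_on S2) f"
proof -
  have "(\<lambda>x. indicator \<Omega> x *\<^sub>R f x) = (\<lambda>x. indicator S2 x *\<^sub>R f x)"
    using assms by (auto simp: indicator_def fun_eq_iff)
  with assms(1) show ?thesis
    unfolding surf_on_def by (subst (1 2) integral_restrict_space) auto
qed

text \<open>
  A nonempty relatively open subset of the sphere has positive measure: the cone over it contains a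
  nonempty open subset of the unit ball.
\<close>
lemma continuous_AE_zero:
  fixes f :: "real^3 \<Rightarrow> real"
  assumes cont: "continuous_on S2 f" and ae: "AE x in surf_on S2. f x = 0" and x: "x \<in> S2"
  shows "f x = 0"
proof (rule ccontr)
  assume nz: "f x \<noteq> 0"
  have "openin (top_of_set S2) (S2 \<inter> f -` (- {0}))"
    using cont by (intro continuous_openin_preimage_gen) auto
  then obtain V where V: "open V" "S2 \<inter> f -` (- {0}) = S2 \<inter> V"
    unfolding openin_open by blast
  define U where "U = (ball 0 1 - {0}) \<inter> (sgn :: real^3 \<Rightarrow> real^3) -` V"
  have "continuous_on (ball 0 1 - {0}) (sgn :: real^3 \<Rightarrow> real^3)"
    unfolding sgn_div_norm[abs_def] by (intro continuous_intros) auto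
  then have opU: "open U"
    unfolding U_def by (intro continuous_open_preimage V) auto
  have "x \<in> S2 \<inter> f -` (- {0})" using nz x by simp
  then have "x \<in> V" unfolding V(2) by blast
  then have "(1/2) *\<^sub>R x \<in> U"
    using x by (auto simp: U_def sgn_scaleR)
  then have "\<not> negligible U" using open_not_negligible[OF opU] by blast
  moreover have "U \<in> null_sets lborel"
  proof -
    let ?C = "{x \<in> ball 0 1. sgn x \<in> S2 \<inter> V}"
    have "AE x in surf. x \<notin> S2 \<inter> V"
    proof -
      have "AE x in surf. x \<in> S2 \<longrightarrow> f x = 0"
        using ae by (subst (asm) AE_surf_on) simp_all
      then show ?thesis unfolding V(2)[symmetric] by eventually_elim simp
    qed
    then have "emeasure surf (S2 \<inter> V) = 0"
      using V(1) by (subst (asm) AE_iff_measurable[of "S2 \<inter> V"]) auto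
    then have E: "emeasure lborel ?C = 0"
      using emeasure_surf[of "S2 \<inter> V"] V(1) by simp
    have "sgn -` (S2 \<inter> V) \<in> sets (borel :: (real^3) measure)"
      using measurable_sets[OF measurable_sgn_vec, of "S2 \<inter> V"] V(1) by auto
    moreover have "?C = ball 0 1 \<inter> sgn -` (S2 \<inter> V)" by auto
    ultimately have C: "?C \<in> sets lborel" by simp
    have "U \<subseteq> ?C"
      unfolding U_def using sgn_in_S2 by blast
    from emeasure_mono[OF this C] E have "emeasure lborel U = 0" by simp
    then show ?thesis using opU by (auto simp: null_sets_def)
  qed
  ultimately show False
    using null_sets_completionI[of U lborel] by (simp add: negligible_iff_null_sets)
qed

lemma orthogonal_transformation_borel:
  fixes T :: "real^3 \<Rightarrow> real^3"
  assumes "orthogonal_transformation T"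
  shows "T \<in> borel_measurable borel"
proof -
  have "bounded_linear T"
    using orthogonal_transformation_linear[OF assms] linear_conv_bounded_linear by blast
  then show ?thesis by (intro borel_measurable_continuous_onI linear_continuous_on)
qed

lemma lborel_orthogonal_vimage:
  fixes T :: "real^3 \<Rightarrow> real^3"
  assumes T: "orthogonal_transformation T" and B: "B \<in> sets borel" "bounded B"
  shows "emeasure lborel (T -` B) = emeasure lborel B"
proof -
  have bij: "bij T" using T by (rule orthogonal_transformation_bij)
  let ?S = "inv T"
  have S: "orthogonal_transformation ?S" using T by (rule orthogonal_transformation_inv)
  have eq: "T -` B = ?S ` B" using bij by (simp add: bij_vimage_eq_inv_image)
  have BL: "B \<in> lmeasurable" using B by (simp add: bounded_set_imp_lmeasurable)
  have SL: "?S ` B \<in> lmeasurable" using S BL by (simp add: measurable_orthogonal_image)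
  have "T \<in> borel_measurable borel"
    using T by (rule orthogonal_transformation_borel)
  then have "T -` B \<in> sets borel" using measurable_sets[of T borel borel B] B by simp
  then have "emeasure lborel (T -` B) = emeasure lebesgue (?S ` B)"
    by (simp add: eq)
  also have "\<dots> = emeasure lebesgue B"
    using measure_orthogonal_image[OF S BL] BL SL by (simp add: emeasure_eq_measure2)
  also have "\<dots> = emeasure lborel B" using B by simp
  finally show ?thesis .
qed

text \<open>
  An orthogonal transformation commutes with the radial projection and preserves both the unit ball
  and Lebesgue measure.
\<close>
lemma surf_orthogonal_invariant:
  fixes T :: "real^3 \<Rightarrow> real^3"
  assumes T: "orthogonal_transformation T"
  shows "distr surf borel T = surf"
proof (rule measure_eqI)
  have Tm: "T \<in> borel_measurable borel"
    using T by (rule orthogonal_transformation_borel)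
  fix A assume "A \<in> sets (distr surf borel T)"
  then have A: "A \<in> sets borel" by simp
  have vA: "T -` A \<in> sets borel" using measurable_sets[OF Tm A] by simp
  let ?B = "{x \<in> ball 0 1. sgn x \<in> A}"
  have "emeasure (distr surf borel T) A = emeasure surf (T -` A)"
    using Tm A by (subst emeasure_distr) auto
  also have "\<dots> = 3 * emeasure lborel {x \<in> ball 0 1. sgn x \<in> T -` A}"
    using vA by (rule emeasure_surf)
  also have "{x \<in> ball 0 1. sgn x \<in> T -` A} = T -` ?B"
    using orthogonal_transformation_norm[OF T] orthogonal_transformation_scaleR[OF T]
    by (auto simp: sgn_div_norm)
  also have "emeasure lborel (T -` ?B) = emeasure lborel ?B"
  proof (rule lborel_orthogonal_vimage[OF T])
    have "sgn -` A \<in> sets (borel :: (real^3) measure)"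
      using measurable_sets[OF measurable_sgn_vec A] by simp
    moreover have "?B = ball 0 1 \<inter> sgn -` A" by auto
    ultimately show "?B \<in> sets borel" by simp
    show "bounded ?B" by (rule bounded_subset[of "ball 0 1"]) auto
  qed
  also have "3 * emeasure lborel ?B = emeasure surf A"
    using A by (rule emeasure_surf[symmetric])
  finally show "emeasure (distr surf borel T) A = emeasure surf A" .
qed simp

lemma integral_S2_rotate:
  fixes f :: "real^3 \<Rightarrow> real"
  assumes T: "orthogonal_transformation T" and f: "continuous_on S2 f"
  shows "(\<integral>x. f (T x) \<partial>surf_on S2) = integral\<^sup>L (surf_on S2) f"
proof -
  have Tm: "T \<in> borel_measurable borel"
    using T by (rule orthogonal_transformation_borel)
  have "set_borel_measurable surf S2 f"
    using continuous_measurable_surf_on[OF f] by (subst set_borel_measurable_surf_on) auto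
  then have m: "(\<lambda>x. indicator S2 x *\<^sub>R f x) \<in> borel_measurable borel"
    unfolding set_borel_measurable_def by (simp cong: measurable_cong_sets)
  have "integral\<^sup>L (surf_on S2) f = (\<integral>x. indicator S2 x *\<^sub>R f x \<partial>distr surf borel T)"
    unfolding surf_orthogonal_invariant[OF T] surf_on_def by (subst integral_restrict_space) auto
  also have "\<dots> = (\<integral>x. indicator S2 (T x) *\<^sub>R f (T x) \<partial>surf)"
    using Tm m by (intro integral_distr) auto
  also have "\<dots> = (\<integral>x. f (T x) \<partial>surf_on S2)"
    unfolding surf_on_def using orthogonal_transformation_norm[OF T]
    by (subst integral_restrict_space) (auto simp: indicator_def)
  finally show ?thesis by simp
qed

section \<open>Integration by parts on the sphere\<close>

text \<open>
  The derivative along the rotations in the plane of the coordinates \<open>a\<close> and \<open>b\<close> (the angular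
  momentum operator).
\<close>
definition rot_deriv :: "3 \<Rightarrow> 3 \<Rightarrow> (real^3 \<Rightarrow> real) \<Rightarrow> real^3 \<Rightarrow> real" where
  "rot_deriv a b f x = x $ a * tang_deriv b f x - x $ b * tang_deriv a f x"

definition rotation :: "3 \<Rightarrow> 3 \<Rightarrow> real \<Rightarrow> real^3 \<Rightarrow> real^3" where
  "rotation a b t x = x + (cos t - 1) *\<^sub>R (x $ a *\<^sub>R axis a 1 + x $ b *\<^sub>R axis b 1)
                        + sin t *\<^sub>R (x $ a *\<^sub>R axis b 1 - x $ b *\<^sub>R axis a 1)"

lemma rotation_nth:
  assumes "a \<noteq> b"
  shows "rotation a b t x $ a = cos t * x $ a - sin t * x $ b"
    and "rotation a b t x $ b = sin t * x $ a + cos t * x $ b"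
    and "i \<noteq> a \<Longrightarrow> i \<noteq> b \<Longrightarrow> rotation a b t x $ i = x $ i"
  using assms by (auto simp: rotation_def axis_def algebra_simps)

lemma norm_rotation:
  assumes "a \<noteq> b"
  shows "norm (rotation a b t x) = norm x"
proof -
  let ?y = "rotation a b t x"
  have split: "(\<Sum>i\<in>UNIV. (z $ i)\<^sup>2) = (z $ a)\<^sup>2 + (z $ b)\<^sup>2 + (\<Sum>i\<in>UNIV - {a, b}. (z $ i)\<^sup>2)" for z :: "real^3"
    using assms by (subst sum.subset_diff[of "{a, b}"]) auto
  have "(?y $ a)\<^sup>2 + (?y $ b)\<^sup>2 = ((sin t)\<^sup>2 + (cos t)\<^sup>2) * ((x $ a)\<^sup>2 + (x $ b)\<^sup>2)"
    unfolding rotation_nth[OF assms] by algebra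
  also have "\<dots> = (x $ a)\<^sup>2 + (x $ b)\<^sup>2" by simp
  finally have "(\<Sum>i\<in>UNIV. (?y $ i)\<^sup>2) = (\<Sum>i\<in>UNIV. (x $ i)\<^sup>2)"
    unfolding split by (simp add: rotation_nth(3)[OF assms])
  then show ?thesis by (simp add: norm_vec_def L2_set_def)
qed

lemma orthogonal_transformation_rotation:
  assumes "a \<noteq> b"
  shows "orthogonal_transformation (rotation a b t)"
  unfolding orthogonal_transformation
proof
  show "linear (rotation a b t)"
    by (rule linearI) (simp_all add: rotation_def vec_eq_iff algebra_simps)
  show "\<forall>v. norm (rotation a b t v) = norm v"
    using norm_rotation[OF assms] by simp
qed

lemma radial_ext_rotation_DERIV:
  assumes "a \<noteq> b" "smooth_S2 f" "x \<in> S2"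
  shows "((\<lambda>t. radial_ext f (rotation a b t x)) has_real_derivative rot_deriv a b f (rotation a b t x)) (at t)"
proof -
  let ?y = "rotation a b t x"
  let ?v = "?y $ a *\<^sub>R axis b 1 - ?y $ b *\<^sub>R axis a 1 :: real^3"
  have v: "?v = (- sin t) *\<^sub>R (x $ a *\<^sub>R axis a 1 + x $ b *\<^sub>R axis b 1)
                + cos t *\<^sub>R (x $ a *\<^sub>R axis b 1 - x $ b *\<^sub>R axis a 1)"
    unfolding rotation_nth[OF assms(1)] by (simp add: algebra_simps)
  have nz: "?y \<noteq> 0"
    using norm_rotation[OF assms(1), of t x] assms(3) by auto
  have "((\<lambda>t. rotation a b t x) has_derivative
      (\<lambda>h. h *\<^sub>R ((- sin t) *\<^sub>R (x $ a *\<^sub>R axis a 1 + x $ b *\<^sub>R axis b 1)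
                + cos t *\<^sub>R (x $ a *\<^sub>R axis b 1 - x $ b *\<^sub>R axis a 1)))) (at t)"
    unfolding rotation_def
    by (auto intro!: derivative_eq_intros simp: algebra_simps)
  then have "((\<lambda>t. rotation a b t x) has_derivative (\<lambda>h. h *\<^sub>R ?v)) (at t)"
    unfolding v .
  then have "((\<lambda>t. radial_ext f (rotation a b t x)) has_derivative
      (\<lambda>h. \<Sum>i\<in>UNIV. (h *\<^sub>R ?v) $ i * tang_deriv i f ?y)) (at t)"
    using has_derivative_partial_deriv[OF smooth_S2_differentiable[OF assms(2) nz]]
    unfolding tang_deriv_def by (rule has_derivative_compose)
  moreover have "(\<Sum>i\<in>UNIV. (h *\<^sub>R ?v) $ i * tang_deriv i f ?y) = rot_deriv a b f ?y * h" for h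
  proof -
    have "(\<Sum>i\<in>UNIV. (h *\<^sub>R ?v) $ i * tang_deriv i f ?y)
        = (\<Sum>i\<in>UNIV. (h * ?y $ a * tang_deriv i f ?y) * axis b 1 $ i
             - (h * ?y $ b * tang_deriv i f ?y) * axis a 1 $ i)"
      by (intro sum.cong) (simp_all add: algebra_simps)
    also have "\<dots> = h * ?y $ a * tang_deriv b f ?y - h * ?y $ b * tang_deriv a f ?y"
      by (simp add: sum_subtractf axis_def if_distrib[of "\<lambda>x. _ * x"] sum.delta cong: if_cong)
    finally show ?thesis by (simp add: rot_deriv_def algebra_simps)
  qed
  ultimately show ?thesis
    unfolding has_field_derivative_def by (simp only:)
qed

lemma smooth_S2_rot_deriv: "smooth_S2 f \<Longrightarrow> smooth_S2 (rot_deriv a b f)"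
  unfolding rot_deriv_def[abs_def]
  by (intro smooth_S2_diff smooth_S2_mult smooth_S2_component smooth_S2_tang_deriv)

lemma smooth_S2_integrable:
  "smooth_S2 f \<Longrightarrow> \<Omega> \<in> sets borel \<Longrightarrow> \<Omega> \<subseteq> S2 \<Longrightarrow> integrable (surf_on \<Omega>) f"
  by (intro integrable_surf_on_continuous smooth_S2_continuous)

text \<open>
  The surface measure is invariant under rotations; differentiating the integral of the rotated
  function at angle 0 gives the integral of its derivative along the rotation field.
\<close>
lemma integral_rot_deriv:
  assumes "smooth_S2 f"
  shows "integral\<^sup>L (surf_on S2) (rot_deriv a b f) = 0"
proof (cases "a = b")
  case True
  then show ?thesis by (simp add: rot_deriv_def[abs_def])
next
  case False
  define s where "s n = 1 / real (Suc n)" for n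
  let ?R = "\<lambda>n x. rotation a b (s n) x"
  let ?q = "\<lambda>n x. (f (?R n x) - f x) / s n"
  have S2R: "rotation a b t x \<in> S2" if "x \<in> S2" for t x
    using that norm_rotation[OF False] by simp
  have cont: "continuous_on S2 f" using assms by (rule smooth_S2_continuous)
  have contR: "continuous_on S2 (\<lambda>x. f (?R n x))" for n
  proof (rule continuous_on_compose2[OF cont])
    have "linear (?R n)"
      using orthogonal_transformation_rotation[OF False] orthogonal_transformation_linear by blast
    then show "continuous_on S2 (?R n)"
      by (intro linear_continuous_on) (simp add: linear_conv_bounded_linear)
  qed (use S2R in auto)
  obtain B where B: "\<And>x. x \<in> S2 \<Longrightarrow> \<bar>rot_deriv a b f x\<bar> \<le> B"
    using continuous_S2_bounded[OF smooth_S2_continuous[OF smooth_S2_rot_deriv[OF assms]]] by blast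
  have s: "s n > 0" for n by (simp add: s_def)
  have deriv: "((\<lambda>t. f (rotation a b t x)) has_real_derivative rot_deriv a b f (rotation a b t x)) (at t)"
    if "x \<in> S2" for x t
    using radial_ext_rotation_DERIV[OF False assms that] S2R[OF that] by simp
  have rot0: "rotation a b 0 x = x" for x by (simp add: rotation_def)
  have "(\<lambda>n. integral\<^sup>L (surf_on S2) (?q n)) \<longlonglongrightarrow> integral\<^sup>L (surf_on S2) (rot_deriv a b f)"
  proof (rule integral_dominated_convergence[where w = "\<lambda>x. B"])
    show "rot_deriv a b f \<in> borel_measurable (surf_on S2)"
      using assms by (intro continuous_measurable_surf_on smooth_S2_continuous smooth_S2_rot_deriv) auto
    show "?q n \<in> borel_measurable (surf_on S2)" for n
      using cont contR s[of n] by (intro continuous_measurable_surf_on continuous_intros) auto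
    show "integrable (surf_on S2) (\<lambda>x. B)"
      by (intro integrable_surf_on_continuous) auto
    show "AE x in surf_on S2. (\<lambda>n. ?q n x) \<longlonglongrightarrow> rot_deriv a b f x"
    proof (rule AE_I2)
      fix x assume "x \<in> space (surf_on S2)"
      then have x: "x \<in> S2" by simp
      have "((\<lambda>t. (f (rotation a b t x) - f x) / t) \<longlongrightarrow> rot_deriv a b f x) (at 0)"
        using deriv[OF x, of 0] unfolding has_field_derivative_def has_derivative_at
        using deriv[OF x, of 0] by (simp add: has_field_derivative_iff rot0)
      moreover have "s \<longlonglongrightarrow> 0"
        using LIMSEQ_inverse_real_of_nat by (simp add: s_def[abs_def] inverse_eq_divide)
      then have "filterlim s (at 0) sequentially"
        unfolding filterlim_at using s by (auto intro!: always_eventually less_imp_neq[symmetric])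
      ultimately show "(\<lambda>n. ?q n x) \<longlonglongrightarrow> rot_deriv a b f x"
        by (rule filterlim_compose)
    qed
    show "AE x in surf_on S2. norm (?q n x) \<le> B" for n
    proof (rule AE_I2)
      fix x assume "x \<in> space (surf_on S2)"
      then have x: "x \<in> S2" by simp
      obtain t where "f (?R n x) - f x = (s n - 0) * rot_deriv a b f (rotation a b t x)"
        using MVT2[OF s[of n], of "\<lambda>t. f (rotation a b t x)" "\<lambda>t. rot_deriv a b f (rotation a b t x)"] deriv[OF x]
        by (auto simp: rot0)
      then show "norm (?q n x) \<le> B"
        using s[of n] B[OF S2R[OF x, of t]] by simp
    qed
  qed
  moreover have "integral\<^sup>L (surf_on S2) (?q n) = 0" for n
    using integral_S2_rotate[OF orthogonal_transformation_rotation[OF False] cont, of "s n"]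
      integrable_surf_on_continuous[OF cont] integrable_surf_on_continuous[OF contR] by simp
  ultimately have "(\<lambda>n::nat. 0) \<longlonglongrightarrow> integral\<^sup>L (surf_on S2) (rot_deriv a b f)"
    by (simp only:)
  then show ?thesis by (simp add: LIMSEQ_const_iff)
qed

lemma rot_deriv_mult:
  "smooth_S2 f \<Longrightarrow> smooth_S2 g \<Longrightarrow> x \<in> S2 \<Longrightarrow>
   rot_deriv a b (\<lambda>x. f x * g x) x = rot_deriv a b f x * g x + f x * rot_deriv a b g x"
  by (simp add: rot_deriv_def tang_deriv_mult algebra_simps)

lemma rot_deriv_component:
  "x \<in> S2 \<Longrightarrow> rot_deriv a b (\<lambda>x. x $ j) x = x $ a * (if b = j then 1 else 0) - x $ b * (if a = j then 1 else 0)"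
  by (simp add: rot_deriv_def tang_deriv_component algebra_simps)

lemma S2_sum_squares: "x \<in> S2 \<Longrightarrow> (\<Sum>i\<in>UNIV. x $ i * x $ i) = 1"
  using power2_norm_eq_inner[of x] by (simp add: inner_vec_def)

text \<open>
  The rotation fields span the tangent spaces: in the sum of \<open>x\<^sub>j (x\<^sub>j D\<^sub>i - x\<^sub>i D\<^sub>j)\<close> the first part
  adds up to \<open>D\<^sub>i\<close> as \<open>x\<close> is a unit vector, and the second part vanishes as gradients are tangential.
\<close>
lemma tang_deriv_from_rot_deriv:
  assumes "smooth_S2 f" "x \<in> S2"
  shows "tang_deriv i f x = (\<Sum>j\<in>UNIV. x $ j * rot_deriv j i f x)"
proof -
  have "(\<Sum>j\<in>UNIV. x $ j * rot_deriv j i f x)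
      = (\<Sum>j\<in>UNIV. x $ j * x $ j) * tang_deriv i f x - x $ i * (\<Sum>j\<in>UNIV. x $ j * tang_deriv j f x)"
    unfolding rot_deriv_def sum_distrib_right sum_distrib_left sum_subtractf[symmetric]
    by (intro sum.cong) (auto simp: algebra_simps)
  then show ?thesis
    using S2_sum_squares[OF assms(2)] tang_deriv_radial[OF assms(1) S2_nonzero[OF assms(2)]] by simp
qed

text \<open>
  Writing \<open>D\<^sub>i f\<close> through the rotation fields and moving the coefficients \<open>x\<^sub>j\<close> under them leaves, besides
  the curvature term \<open>2 f x\<^sub>i\<close>, derivatives along rotations only, whose integrals vanish.
\<close>
lemma divergence_S2:
  assumes "smooth_S2 f"
  shows "integral\<^sup>L (surf_on S2) (tang_deriv i f) = (\<integral>x. 2 * f x * x $ i \<partial>surf_on S2)"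
proof -
  note smooth = assms smooth_S2_component smooth_S2_rot_deriv smooth_S2_mult smooth_S2_sum smooth_S2_cmult
  have "tang_deriv i f x = (\<Sum>j\<in>UNIV. rot_deriv j i (\<lambda>x. x $ j * f x) x) + 2 * f x * x $ i" if x: "x \<in> S2" for x
  proof -
    have "(\<Sum>j\<in>UNIV. rot_deriv j i (\<lambda>x. x $ j * f x) x)
        = (\<Sum>j\<in>UNIV. rot_deriv j i (\<lambda>x. x $ j) x) * f x + tang_deriv i f x"
      unfolding tang_deriv_from_rot_deriv[OF assms x] sum_distrib_right sum.distrib[symmetric]
      by (intro sum.cong refl rot_deriv_mult smooth x)
    also have "(\<Sum>j\<in>UNIV. rot_deriv j i (\<lambda>x. x $ j) x) = - 2 * x $ i"
      unfolding rot_deriv_component[OF x]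
      by (simp add: sum_subtractf if_distrib[of "\<lambda>x. _ * x"] sum.delta cong: if_cong)
    finally show ?thesis by simp
  qed
  then have "integral\<^sup>L (surf_on S2) (tang_deriv i f)
      = (\<integral>x. (\<Sum>j\<in>UNIV. rot_deriv j i (\<lambda>x. x $ j * f x) x) + 2 * f x * x $ i \<partial>surf_on S2)"
    by (intro Bochner_Integration.integral_cong) auto
  also have "\<dots> = (\<integral>x. (\<Sum>j\<in>UNIV. rot_deriv j i (\<lambda>x. x $ j * f x) x) \<partial>surf_on S2)
      + (\<integral>x. 2 * f x * x $ i \<partial>surf_on S2)"
    by (intro Bochner_Integration.integral_add smooth_S2_integrable smooth) auto
  also have "(\<integral>x. (\<Sum>j\<in>UNIV. rot_deriv j i (\<lambda>x. x $ j * f x) x) \<partial>surf_on S2)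
      = (\<Sum>j\<in>UNIV. integral\<^sup>L (surf_on S2) (rot_deriv j i (\<lambda>x. x $ j * f x)))"
    by (intro Bochner_Integration.integral_sum smooth_S2_integrable smooth) auto
  also have "\<dots> = 0"
    by (intro sum.neutral ballI integral_rot_deriv smooth)
  finally show ?thesis by simp
qed

definition laplace_S2 :: "(real^3 \<Rightarrow> real) \<Rightarrow> real^3 \<Rightarrow> real" where
  "laplace_S2 f x = (\<Sum>i\<in>UNIV. tang_deriv i (tang_deriv i f) x)"

lemma smooth_S2_laplace: "smooth_S2 f \<Longrightarrow> smooth_S2 (laplace_S2 f)"
  unfolding laplace_S2_def[abs_def] by (intro smooth_S2_sum smooth_S2_tang_deriv)

text \<open>
  In the divergence theorem for \<open>f \<nabla>g\<close> the curvature term is absent because \<open>\<nabla>g\<close> is tangential.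
\<close>
lemma Green_S2:
  assumes "smooth_S2 f" "smooth_S2 g"
  shows "(\<integral>x. (\<Sum>i\<in>UNIV. tang_deriv i f x * tang_deriv i g x) \<partial>surf_on S2)
       = - (\<integral>x. f x * laplace_S2 g x \<partial>surf_on S2)"
proof -
  note smooth = assms smooth_S2_component smooth_S2_tang_deriv smooth_S2_mult smooth_S2_sum
    smooth_S2_cmult smooth_S2_laplace
  let ?I = "integral\<^sup>L (surf_on S2)"
  have "?I (\<lambda>x. \<Sum>i\<in>UNIV. tang_deriv i (\<lambda>x. f x * tang_deriv i g x) x)
      = (\<Sum>i\<in>UNIV. ?I (\<lambda>x. 2 * (f x * tang_deriv i g x) * x $ i))"
    by (subst Bochner_Integration.integral_sum) (auto intro!: smooth_S2_integrable smooth sum.cong divergence_S2)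
  also have "\<dots> = ?I (\<lambda>x. \<Sum>i\<in>UNIV. 2 * (f x * tang_deriv i g x) * x $ i)"
    by (subst Bochner_Integration.integral_sum) (auto intro!: smooth_S2_integrable smooth)
  also have "\<dots> = ?I (\<lambda>x. 0)"
  proof (intro Bochner_Integration.integral_cong refl)
    fix x assume "x \<in> space (surf_on S2)"
    then have x: "x \<in> S2" by simp
    have "(\<Sum>i\<in>UNIV. 2 * (f x * tang_deriv i g x) * x $ i) = 2 * f x * (\<Sum>i\<in>UNIV. x $ i * tang_deriv i g x)"
      unfolding sum_distrib_left by (intro sum.cong) auto
    then show "(\<Sum>i\<in>UNIV. 2 * (f x * tang_deriv i g x) * x $ i) = 0"
      using tang_deriv_radial[OF assms(2) S2_nonzero[OF x]] by simp
  qed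
  finally have 0: "?I (\<lambda>x. \<Sum>i\<in>UNIV. tang_deriv i (\<lambda>x. f x * tang_deriv i g x) x) = 0" by simp
  have "?I (\<lambda>x. \<Sum>i\<in>UNIV. tang_deriv i (\<lambda>x. f x * tang_deriv i g x) x)
      = ?I (\<lambda>x. (\<Sum>i\<in>UNIV. tang_deriv i f x * tang_deriv i g x) + f x * laplace_S2 g x)"
    by (intro Bochner_Integration.integral_cong)
       (auto simp: tang_deriv_mult smooth laplace_S2_def sum_distrib_left sum.distrib)
  also have "\<dots> = ?I (\<lambda>x. \<Sum>i\<in>UNIV. tang_deriv i f x * tang_deriv i g x) + ?I (\<lambda>x. f x * laplace_S2 g x)"
    by (intro Bochner_Integration.integral_add smooth_S2_integrable smooth) auto
  finally show ?thesis using 0 by simp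
qed

lemma laplace_S2_symmetric:
  assumes "smooth_S2 f" "smooth_S2 g"
  shows "(\<integral>x. f x * laplace_S2 g x \<partial>surf_on S2) = (\<integral>x. laplace_S2 f x * g x \<partial>surf_on S2)"
  using Green_S2[OF assms] Green_S2[OF assms(2,1)] by (simp add: mult.commute)

lemma laplace_S2_add:
  assumes "smooth_S2 f" "smooth_S2 g" "x \<noteq> 0"
  shows "laplace_S2 (\<lambda>x. f x + g x) x = laplace_S2 f x + laplace_S2 g x"
proof -
  have "tang_deriv i (tang_deriv i (\<lambda>x. f x + g x)) x = tang_deriv i (\<lambda>x. tang_deriv i f x + tang_deriv i g x) x" for i
    using assms S2_nonzero by (intro tang_deriv_cong tang_deriv_add) auto
  then show ?thesis
    using assms by (simp add: laplace_S2_def tang_deriv_add smooth_S2_tang_deriv sum.distrib)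
qed

lemma laplace_S2_cmult:
  assumes "smooth_S2 f" "x \<noteq> 0"
  shows "laplace_S2 (\<lambda>x. c * f x) x = c * laplace_S2 f x"
proof -
  have "tang_deriv i (tang_deriv i (\<lambda>x. c * f x)) x = tang_deriv i (\<lambda>x. c * tang_deriv i f x) x" for i
    using assms S2_nonzero by (intro tang_deriv_cong tang_deriv_cmult) auto
  then show ?thesis
    using assms by (simp add: laplace_S2_def tang_deriv_cmult smooth_S2_tang_deriv sum_distrib_left)
qed

lemma laplace_S2_cong:
  assumes "\<And>x. x \<in> S2 \<Longrightarrow> f x = g x" "x \<noteq> 0"
  shows "laplace_S2 f x = laplace_S2 g x"
  unfolding laplace_S2_def using assms S2_nonzero by (intro sum.cong refl tang_deriv_cong) auto

lemma laplace_S2_mult: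
  assumes "smooth_S2 f" "smooth_S2 g" "x \<in> S2"
  shows "laplace_S2 (\<lambda>x. f x * g x) x
    = laplace_S2 f x * g x + 2 * (\<Sum>i\<in>UNIV. tang_deriv i f x * tang_deriv i g x) + f x * laplace_S2 g x"
proof -
  note smooth = assms smooth_S2_tang_deriv smooth_S2_mult
  have "tang_deriv i (tang_deriv i (\<lambda>x. f x * g x)) x
      = tang_deriv i (\<lambda>x. tang_deriv i f x * g x + f x * tang_deriv i g x) x" for i
    using assms S2_nonzero by (intro tang_deriv_cong tang_deriv_mult) auto
  also have "\<dots> i = tang_deriv i (tang_deriv i f) x * g x + 2 * (tang_deriv i f x * tang_deriv i g x)
      + f x * tang_deriv i (tang_deriv i g) x" for i
    using S2_nonzero[OF assms(3)] smooth
      tang_deriv_mult[OF smooth_S2_tang_deriv[OF assms(1)] assms(2,3), of i i]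
      tang_deriv_mult[OF assms(1) smooth_S2_tang_deriv[OF assms(2)] assms(3), of i i]
    by (simp add: tang_deriv_add)
  finally show ?thesis
    by (simp add: laplace_S2_def sum.distrib sum_distrib_left sum_distrib_right)
qed

section \<open>Semidefinite inner products on spaces of functions\<close>

text \<open>
  One theory serves smooth functions on the sphere, square integrable functions and vector fields on
  \<open>\<Omega>\<close>, and an eigenspace with the inner product of gradients. None of these spaces is a type, and the
  forms vanish on nonzero functions that are null; hence a form that is semidefinite on a set of
  functions.
\<close>
locale semi_inner =
  fixes V :: "('a \<Rightarrow> real) set" and B :: "('a \<Rightarrow> real) \<Rightarrow> ('a \<Rightarrow> real) \<Rightarrow> real"
  assumes add_closed: "f \<in> V \<Longrightarrow> g \<in> V \<Longrightarrow> (\<lambda>x. f x + g x) \<in> V"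
    and cmult_closed: "f \<in> V \<Longrightarrow> (\<lambda>x. c * f x) \<in> V"
    and zero_closed: "(\<lambda>x. 0) \<in> V"
    and B_add: "f \<in> V \<Longrightarrow> g \<in> V \<Longrightarrow> h \<in> V \<Longrightarrow> B (\<lambda>x. f x + g x) h = B f h + B g h"
    and B_cmult: "f \<in> V \<Longrightarrow> h \<in> V \<Longrightarrow> B (\<lambda>x. c * f x) h = c * B f h"
    and B_commute: "f \<in> V \<Longrightarrow> g \<in> V \<Longrightarrow> B f g = B g f"
    and B_nonneg: "f \<in> V \<Longrightarrow> 0 \<le> B f f"
begin

lemma B_zero: "h \<in> V \<Longrightarrow> B (\<lambda>x. 0) h = 0"
  using B_cmult[of "\<lambda>x. 0" h 0] zero_closed by simp

lemma sum_closed: "(\<And>i. i \<in> I \<Longrightarrow> f i \<in> V) \<Longrightarrow> (\<lambda>x. \<Sum>i\<in>I. c i * f i x) \<in> V"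
proof (induction I rule: infinite_finite_induct)
  case (insert k I)
  then show ?case
    using add_closed[OF cmult_closed[of "f k" "c k"], of "\<lambda>x. \<Sum>i\<in>I. c i * f i x"] by simp
qed (simp_all add: zero_closed)

lemma B_sum:
  assumes "\<And>i. i \<in> I \<Longrightarrow> f i \<in> V" "h \<in> V"
  shows "B (\<lambda>x. \<Sum>i\<in>I. c i * f i x) h = (\<Sum>i\<in>I. c i * B (f i) h)"
  using assms(1)
proof (induction I rule: infinite_finite_induct)
  case (insert k I)
  then have "B (\<lambda>x. c k * f k x + (\<Sum>i\<in>I. c i * f i x)) h = c k * B (f k) h + B (\<lambda>x. \<Sum>i\<in>I. c i * f i x) h"
    using assms(2) by (subst B_add) (auto intro: sum_closed cmult_closed simp: B_cmult)
  with insert show ?case by simp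
qed (auto simp: B_zero assms)

lemma diff_closed: "f \<in> V \<Longrightarrow> g \<in> V \<Longrightarrow> (\<lambda>x. f x - g x) \<in> V"
  using add_closed[of f "\<lambda>x. (-1) * g x"] cmult_closed[of g "-1"] by simp

lemma B_diff: "f \<in> V \<Longrightarrow> g \<in> V \<Longrightarrow> h \<in> V \<Longrightarrow> B (\<lambda>x. f x - g x) h = B f h - B g h"
  using B_add[of f "\<lambda>x. (-1) * g x" h] cmult_closed[of g "-1"] B_cmult[of g h "-1"] by simp

lemma B_square_add:
  assumes "f \<in> V" "g \<in> V"
  shows "B (\<lambda>x. f x + g x) (\<lambda>x. f x + g x) = B f f + 2 * B f g + B g g"
  using assms B_commute[of f "\<lambda>x. f x + g x"] B_commute[of g "\<lambda>x. f x + g x"]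
  by (simp add: B_add add_closed B_commute[of g f])

text \<open>
  Otherwise \<open>B (t f + g) (t f + g)\<close> would be a nonconstant affine function of \<open>t\<close>, hence somewhere
  negative.
\<close>
lemma B_null:
  assumes "f \<in> V" "g \<in> V" "B f f = 0"
  shows "B f g = 0"
proof (rule ccontr)
  assume nz: "B f g \<noteq> 0"
  define t where "t = - (B g g + 1) / (2 * B f g)"
  have "0 \<le> B (\<lambda>x. t * f x + g x) (\<lambda>x. t * f x + g x)"
    using assms by (intro B_nonneg add_closed cmult_closed)
  also have "\<dots> = t * (t * B f f) + 2 * (t * B f g) + B g g"
    using assms B_commute[of f "\<lambda>x. t * f x"] by (simp add: B_square_add cmult_closed B_cmult)
  also have "t * B f g = - (B g g + 1) / 2" using nz by (simp add: t_def)
  also have "t * (t * B f f) + 2 * (- (B g g + 1) / 2) + B g g = - 1"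
    using assms(3) by (simp add: field_simps)
  finally show False by simp
qed

lemma B_cmult_square:
  assumes "f \<in> V"
  shows "B (\<lambda>x. c * f x) (\<lambda>x. c * f x) = c\<^sup>2 * B f f"
  using B_cmult[OF assms cmult_closed[OF assms], of c c] B_commute[OF assms cmult_closed[OF assms, of c]]
    B_cmult[OF assms assms, of c] by (simp add: power2_eq_square)

lemma cauchy_schwarz:
  assumes "f \<in> V" "g \<in> V"
  shows "\<bar>B f g\<bar> \<le> sqrt (B f f) * sqrt (B g g)"
proof (cases "B f f = 0")
  case True
  then show ?thesis using B_null[OF assms True] by simp
next
  case False
  then have ff: "B f f > 0" using B_nonneg[OF assms(1)] by simp
  define t where "t = - B f g / B f f"
  have "0 \<le> B (\<lambda>x. t * f x + g x) (\<lambda>x. t * f x + g x)"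
    using assms by (intro B_nonneg add_closed cmult_closed)
  also have "\<dots> = t\<^sup>2 * B f f + 2 * (t * B f g) + B g g"
    by (simp only: B_square_add[OF cmult_closed[OF assms(1)] assms(2)] B_cmult_square[OF assms(1)] B_cmult[OF assms])
  also have "\<dots> = B g g - (B f g)\<^sup>2 / B f f"
    using ff by (simp add: t_def power2_eq_square)
  finally have "(B f g)\<^sup>2 \<le> B f f * B g g" using ff by (simp add: field_simps)
  then have "sqrt ((B f g)\<^sup>2) \<le> sqrt (B f f * B g g)" by (rule real_sqrt_le_mono)
  then show ?thesis by (simp add: real_sqrt_mult)
qed

lemma tendsto_B:
  assumes V: "\<And>k::nat. f k \<in> V" "\<And>k. g k \<in> V" "f' \<in> V" "g' \<in> V"
    and f: "(\<lambda>k. B (\<lambda>x. f' x - f k x) (\<lambda>x. f' x - f k x)) \<longlonglongrightarrow> 0"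
    and g: "(\<lambda>k. B (\<lambda>x. g' x - g k x) (\<lambda>x. g' x - g k x)) \<longlonglongrightarrow> 0"
  shows "(\<lambda>k. B (f k) (g k)) \<longlonglongrightarrow> B f' g'"
proof -
  let ?F = "\<lambda>k. (\<lambda>x. f' x - f k x)" and ?G = "\<lambda>k. (\<lambda>x. g' x - g k x)"
  have FV: "?F k \<in> V" and GV: "?G k \<in> V" for k using V by (auto intro: diff_closed)
  have split: "B f' g' - B (f k) (g k) = B f' (?G k) + B (?F k) g' - B (?F k) (?G k)" for k
  proof -
    have "B h (?G k) = B h g' - B h (g k)" if "h \<in> V" for h
      using B_diff[OF V(4) V(2)[of k] that] B_commute[OF that] V(2,4) GV that by metis
    then show ?thesis
      using V FV[of k] by (simp add: B_diff)
  qed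
  have eq: "\<bar>B f' g' - B (f k) (g k)\<bar> \<le> sqrt (B f' f') * sqrt (B (?G k) (?G k))
      + sqrt (B (?F k) (?F k)) * sqrt (B g' g') + sqrt (B (?F k) (?F k)) * sqrt (B (?G k) (?G k))" for k
    using cauchy_schwarz[OF V(3) GV[of k]] cauchy_schwarz[OF FV[of k] V(4)] cauchy_schwarz[OF FV[of k] GV[of k]]
    unfolding split[of k] by linarith
  have "(\<lambda>k. sqrt (B f' f') * sqrt (B (?G k) (?G k))
      + sqrt (B (?F k) (?F k)) * sqrt (B g' g') + sqrt (B (?F k) (?F k)) * sqrt (B (?G k) (?G k))) \<longlonglongrightarrow>
      sqrt (B f' f') * sqrt 0 + sqrt 0 * sqrt (B g' g') + sqrt 0 * sqrt 0"
    by (intro tendsto_intros f g)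
  then have lim: "(\<lambda>k. sqrt (B f' f') * sqrt (B (?G k) (?G k))
      + sqrt (B (?F k) (?F k)) * sqrt (B g' g') + sqrt (B (?F k) (?F k)) * sqrt (B (?G k) (?G k))) \<longlonglongrightarrow> 0"
    by simp
  have "(\<lambda>k. B f' g' - B (f k) (g k)) \<longlonglongrightarrow> 0"
    by (rule Lim_null_comparison[OF always_eventually lim]) (unfold real_norm_def, intro allI eq)
  then have "(\<lambda>k. B f' g' - (B f' g' - B (f k) (g k))) \<longlonglongrightarrow> B f' g' - 0" by (intro tendsto_intros)
  then show ?thesis by simp
qed

definition proj :: "'i set \<Rightarrow> ('i \<Rightarrow> 'a \<Rightarrow> real) \<Rightarrow> ('a \<Rightarrow> real) \<Rightarrow> 'a \<Rightarrow> real" where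
  "proj I e g = (\<lambda>x. \<Sum>i\<in>I. B g (e i) * e i x)"

text \<open>
  An orthonormal family in which zero vectors are admitted, so that it can be produced from
  a linearly dependent family without renumbering.
\<close>
definition orthonormal0 :: "'i set \<Rightarrow> ('i \<Rightarrow> 'a \<Rightarrow> real) \<Rightarrow> bool" where
  "orthonormal0 I e \<longleftrightarrow> (\<forall>i\<in>I. e i \<in> V \<and> (B (e i) (e i) = 1 \<or> e i = (\<lambda>x. 0))) \<and>
     (\<forall>i\<in>I. \<forall>j\<in>I. i \<noteq> j \<longrightarrow> B (e i) (e j) = 0)"

lemma orthonormal0_mono: "orthonormal0 J e \<Longrightarrow> I \<subseteq> J \<Longrightarrow> orthonormal0 I e"
  unfolding orthonormal0_def by (simp add: subset_iff)

lemma orthonormal0_closed: "orthonormal0 I e \<Longrightarrow> i \<in> I \<Longrightarrow> e i \<in> V"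
  unfolding orthonormal0_def by simp

lemma proj_closed: "orthonormal0 I e \<Longrightarrow> proj I e g \<in> V"
  unfolding proj_def by (intro sum_closed) (rule orthonormal0_closed)

lemma B_combination:
  assumes "finite I" "orthonormal0 I e" "j \<in> I"
  shows "B (\<lambda>x. \<Sum>i\<in>I. c i * e i x) (e j) = c j * B (e j) (e j)"
proof -
  have "B (\<lambda>x. \<Sum>i\<in>I. c i * e i x) (e j) = (\<Sum>i\<in>I. c i * B (e i) (e j))"
    using assms by (intro B_sum orthonormal0_closed)
  also have "\<dots> = (\<Sum>i\<in>I. if i = j then c j * B (e j) (e j) else 0)"
  proof (intro sum.cong refl)
    fix i assume "i \<in> I"
    then have "i \<noteq> j \<Longrightarrow> B (e i) (e j) = 0"
      using assms(2,3) unfolding orthonormal0_def by simp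
    then show "c i * B (e i) (e j) = (if i = j then c j * B (e j) (e j) else 0)" by simp
  qed
  finally show ?thesis using assms(1,3) by simp
qed

lemma coefficient_norm:
  assumes "orthonormal0 I e" "j \<in> I" "g \<in> V"
  shows "B g (e j) * B (e j) (e j) = B g (e j)"
  using assms B_commute[of g "\<lambda>x. 0"] zero_closed unfolding orthonormal0_def by (auto simp: B_zero)

lemma residual_orthogonal:
  assumes "finite I" "orthonormal0 I e" "j \<in> I" "g \<in> V"
  shows "B (\<lambda>x. g x - proj I e g x) (e j) = 0"
proof -
  have "e j \<in> V" using orthonormal0_closed[OF assms(2,3)] .
  then have "B (\<lambda>x. g x - proj I e g x) (e j) = B g (e j) - B (proj I e g) (e j)"
    using assms by (intro B_diff proj_closed)
  also have "B (proj I e g) (e j) = B g (e j)"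
    unfolding proj_def B_combination[OF assms(1-3)] by (rule coefficient_norm[OF assms(2-4)])
  finally show ?thesis by simp
qed

lemma residual_orthogonal_combination:
  assumes "finite I" "orthonormal0 I e" "g \<in> V"
  shows "B (\<lambda>x. g x - proj I e g x) (\<lambda>x. \<Sum>i\<in>I. c i * e i x) = 0"
proof -
  have e: "\<And>i. i \<in> I \<Longrightarrow> e i \<in> V" using orthonormal0_closed[OF assms(2)] .
  have r: "(\<lambda>x. g x - proj I e g x) \<in> V" using assms by (intro diff_closed proj_closed)
  have "B (\<lambda>x. \<Sum>i\<in>I. c i * e i x) (\<lambda>x. g x - proj I e g x)
      = (\<Sum>i\<in>I. c i * B (e i) (\<lambda>x. g x - proj I e g x))"
    by (intro B_sum e r)
  also have "\<dots> = 0"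
    using residual_orthogonal[OF assms(1,2) _ assms(3)] B_commute[OF e r] by (intro sum.neutral) simp
  finally show ?thesis using B_commute[OF sum_closed[of I e c, OF e] r] by simp
qed

lemma B_proj:
  assumes "finite I" "orthonormal0 I e" "g \<in> V" "h \<in> V"
  shows "B (proj I e g) h = (\<Sum>i\<in>I. B g (e i) * B h (e i))"
proof -
  have e: "\<And>i. i \<in> I \<Longrightarrow> e i \<in> V" using orthonormal0_closed[OF assms(2)] .
  show ?thesis unfolding proj_def using e assms B_commute[OF e assms(4)]
    by (subst B_sum) auto
qed

lemma pythagoras:
  assumes "finite I" "orthonormal0 I e" "g \<in> V"
  shows "B g g = (\<Sum>i\<in>I. (B g (e i))\<^sup>2) + B (\<lambda>x. g x - proj I e g x) (\<lambda>x. g x - proj I e g x)"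
proof -
  let ?p = "proj I e g" and ?r = "\<lambda>x. g x - proj I e g x"
  have pV: "?p \<in> V" and rV: "?r \<in> V" using assms by (auto intro: diff_closed proj_closed)
  have "B g g = B (\<lambda>x. ?r x + ?p x) (\<lambda>x. ?r x + ?p x)" by simp
  also have "\<dots> = B ?r ?r + 2 * B ?r ?p + B ?p ?p"
    by (rule B_square_add[OF rV pV])
  also have "B ?r ?p = 0"
    using residual_orthogonal_combination[OF assms] unfolding proj_def .
  also have "B ?p ?p = B g ?p - B ?r ?p"
    using B_diff[OF assms(3) pV pV] by simp
  also have "B ?r ?p = 0"
    using residual_orthogonal_combination[OF assms] unfolding proj_def .
  also have "B g ?p = (\<Sum>i\<in>I. (B g (e i))\<^sup>2)"
    using B_proj[OF assms assms(3)] B_commute[OF assms(3) pV] by (simp add: power2_eq_square)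
  finally show ?thesis by simp
qed

lemma bessel:
  assumes "finite I" "orthonormal0 I e" "g \<in> V"
  shows "(\<Sum>i\<in>I. (B g (e i))\<^sup>2) \<le> B g g"
  using pythagoras[OF assms] B_nonneg[OF diff_closed[OF assms(3) proj_closed[OF assms(2)]], of g] by simp

lemma best_approximation:
  assumes "finite I" "orthonormal0 I e" "g \<in> V"
  shows "B (\<lambda>x. g x - proj I e g x) (\<lambda>x. g x - proj I e g x)
    \<le> B (\<lambda>x. g x - (\<Sum>i\<in>I. a i * e i x)) (\<lambda>x. g x - (\<Sum>i\<in>I. a i * e i x))"
proof -
  let ?r = "\<lambda>x. g x - proj I e g x" and ?k = "\<lambda>x. \<Sum>i\<in>I. (B g (e i) - a i) * e i x"
  have e: "\<And>i. i \<in> I \<Longrightarrow> e i \<in> V" using orthonormal0_closed[OF assms(2)] .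
  have rV: "?r \<in> V" and kV: "?k \<in> V" using assms e by (auto intro: diff_closed proj_closed sum_closed)
  have eq: "(\<lambda>x. g x - (\<Sum>i\<in>I. a i * e i x)) = (\<lambda>x. ?r x + ?k x)"
    by (auto simp: proj_def left_diff_distrib sum_subtractf)
  show ?thesis
    unfolding eq B_square_add[OF rV kV] residual_orthogonal_combination[OF assms]
    using B_nonneg[OF kV] by simp
qed

text \<open>Gram--Schmidt; a vector that depends on its predecessors is sent to \<open>0\<close> as \<open>x / 0 = 0\<close>.\<close>
function gram_schmidt :: "(nat \<Rightarrow> 'a \<Rightarrow> real) \<Rightarrow> nat \<Rightarrow> 'a \<Rightarrow> real" where
  "gram_schmidt m i = (let v = (\<lambda>x. m i x - (\<Sum>k<i. B (m i) (gram_schmidt m k) * gram_schmidt m k x))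
     in (\<lambda>x. (1 / sqrt (B v v)) * v x))"
  by pat_completeness auto
termination by (relation "Wellfounded.measure snd") auto

declare gram_schmidt.simps [simp del]

definition gs_residual :: "(nat \<Rightarrow> 'a \<Rightarrow> real) \<Rightarrow> nat \<Rightarrow> 'a \<Rightarrow> real" where
  "gs_residual m i = (\<lambda>x. m i x - proj {..<i} (gram_schmidt m) (m i) x)"

lemma gram_schmidt_eq:
  "gram_schmidt m i = (\<lambda>x. (1 / sqrt (B (gs_residual m i) (gs_residual m i))) * gs_residual m i x)"
  by (subst gram_schmidt.simps) (simp add: gs_residual_def proj_def Let_def)

lemma orthonormal0_gram_schmidt_lessThan:
  assumes m: "\<And>i. i < n \<Longrightarrow> m i \<in> V"
  shows "orthonormal0 {..<n} (gram_schmidt m)"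
  using m
proof (induction n)
  case 0
  then show ?case by (simp add: orthonormal0_def)
next
  case (Suc n)
  let ?e = "gram_schmidt m" and ?v = "gs_residual m n"
  have IH: "orthonormal0 {..<n} ?e" using Suc by auto
  have mn: "m n \<in> V" using Suc.prems by auto
  have v: "?v \<in> V" unfolding gs_residual_def by (intro diff_closed mn proj_closed IH)
  have e: "?e n \<in> V" unfolding gram_schmidt_eq[of m n] by (intro cmult_closed v)
  have eV: "?e i \<in> V" if "i < n" for i using orthonormal0_closed[OF IH] that by simp
  have norm: "B (?e n) (?e n) = 1 \<or> ?e n = (\<lambda>x. 0)"
  proof (cases "B ?v ?v = 0")
    case True
    then show ?thesis unfolding gram_schmidt_eq[of m n] by simp
  next
    case False
    let ?c = "1 / sqrt (B ?v ?v)"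
    have "B (?e n) (?e n) = ?c * (?c * B ?v ?v)"
      unfolding gram_schmidt_eq[of m n] using v cmult_closed[OF v, of ?c] B_commute[OF v cmult_closed[OF v, of ?c]]
      by (simp only: B_cmult)
    also have "\<dots> = 1" using False B_nonneg[OF v] by (simp add: real_div_sqrt)
    finally show ?thesis by simp
  qed
  have orth: "B (?e n) (?e i) = 0" if "i < n" for i
  proof -
    have "B ?v (?e i) = 0"
      unfolding gs_residual_def using that by (intro residual_orthogonal IH mn) auto
    then show ?thesis
      unfolding gram_schmidt_eq[of m n] B_cmult[OF v eV[OF that]] by simp
  qed
  have orth': "B (?e i) (?e n) = 0" if "i < n" for i
    using orth[OF that] B_commute[OF e eV[OF that]] by simp
  have "{..<Suc n} = insert n {..<n}" by auto
  then show ?case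
    using IH e norm orth orth' unfolding orthonormal0_def by auto
qed

lemma orthonormal0_gram_schmidt:
  assumes "\<And>i. m i \<in> V"
  shows "orthonormal0 UNIV (gram_schmidt m)"
proof -
  have *: "orthonormal0 {..<n} (gram_schmidt m)" for n
    using assms by (intro orthonormal0_gram_schmidt_lessThan)
  show ?thesis
    unfolding orthonormal0_def
  proof (intro conjI ballI impI)
    fix i j :: nat
    show "gram_schmidt m i \<in> V" "B (gram_schmidt m i) (gram_schmidt m i) = 1 \<or> gram_schmidt m i = (\<lambda>x. 0)"
      using *[of "Suc i"] by (auto simp: orthonormal0_def)
    show "B (gram_schmidt m i) (gram_schmidt m j) = 0" if "i \<noteq> j"
      using *[of "Suc (max i j)"] that by (auto simp: orthonormal0_def less_Suc_eq_le)
  qed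
qed

text \<open>
  Triangularity carries the grading by degree from monomials to harmonics, and it turns linear
  independence of a basis into nonvanishing of the residuals.
\<close>
lemma gram_schmidt_triangular:
  "\<exists>d. \<forall>x. gram_schmidt m i x = (\<Sum>k<Suc i. d k * m k x)"
  "\<exists>d. \<forall>x. gs_residual m i x = m i x + (\<Sum>k<i. d k * m k x)"
proof (induction i rule: less_induct)
  case (less i)
  have "\<forall>k. \<exists>d. k < i \<longrightarrow> (\<forall>x. gram_schmidt m k x = (\<Sum>l<Suc k. d l * m l x))"
    using less by blast
  then obtain D where D: "\<And>k x. k < i \<Longrightarrow> gram_schmidt m k x = (\<Sum>l<Suc k. D k l * m l x)"
    by metis
  have D': "gram_schmidt m k x = (\<Sum>l<i. (if l \<le> k then D k l else 0) * m l x)" if "k < i" for k x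
    unfolding D[OF that] using that
    by (intro sum.mono_neutral_cong_left) auto
  define d where "d l = - (\<Sum>k<i. B (m i) (gram_schmidt m k) * (if l \<le> k then D k l else 0))" for l
  have "(\<Sum>k<i. B (m i) (gram_schmidt m k) * gram_schmidt m k x) = - (\<Sum>l<i. d l * m l x)" for x
  proof -
    have "(\<Sum>k<i. B (m i) (gram_schmidt m k) * gram_schmidt m k x)
        = (\<Sum>k<i. \<Sum>l<i. B (m i) (gram_schmidt m k) * (if l \<le> k then D k l else 0) * m l x)"
      by (intro sum.cong refl) (simp only: D' sum_distrib_left mult.assoc lessThan_iff)
    also have "\<dots> = (\<Sum>l<i. \<Sum>k<i. B (m i) (gram_schmidt m k) * (if l \<le> k then D k l else 0) * m l x)"
      by (rule sum.swap)
    also have "\<dots> = - (\<Sum>l<i. d l * m l x)"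
      by (simp add: d_def sum_negf sum_distrib_right)
    finally show ?thesis .
  qed
  then have res: "gs_residual m i x = m i x + (\<Sum>k<i. d k * m k x)" for x
    unfolding gs_residual_def proj_def by simp
  then show "\<exists>d. \<forall>x. gs_residual m i x = m i x + (\<Sum>k<i. d k * m k x)" by blast
  let ?c = "1 / sqrt (B (gs_residual m i) (gs_residual m i))"
  have "gram_schmidt m i x = (\<Sum>k<Suc i. (?c * (if k = i then 1 else d k)) * m k x)" for x
  proof -
    have "gram_schmidt m i x = ?c * (m i x + (\<Sum>k<i. d k * m k x))"
      unfolding gram_schmidt_eq[of m i] res[abs_def] ..
    also have "\<dots> = ?c * m i x + (\<Sum>k<i. (?c * (if k = i then 1 else d k)) * m k x)"
      by (simp add: distrib_left sum_distrib_left mult.assoc)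
    finally show ?thesis by simp
  qed
  then show "\<exists>d. \<forall>x. gram_schmidt m i x = (\<Sum>k<Suc i. d k * m k x)" by (intro exI allI)
qed

lemma gram_schmidt_span:
  "B (gs_residual m i) (gs_residual m i) \<noteq> 0 \<or> gs_residual m i x = 0 \<Longrightarrow>
    m i x = proj {..<i} (gram_schmidt m) (m i) x
      + sqrt (B (gs_residual m i) (gs_residual m i)) * gram_schmidt m i x"
  unfolding gram_schmidt_eq[of m i] by (auto simp: gs_residual_def)

end

section \<open>Polynomials on the sphere\<close>

lemma smooth_S2_definite:
  assumes f: "smooth_S2 f" and z: "(\<integral>x. f x * f x \<partial>surf_on S2) = 0" and x: "x \<in> S2"
  shows "f x = 0"
proof -
  have "integrable (surf_on S2) (\<lambda>x. f x * f x)"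
    by (intro smooth_S2_integrable smooth_S2_mult f) auto
  then have "AE x in surf_on S2. f x * f x = 0"
    using z by (subst (asm) integral_nonneg_eq_0_iff_AE) auto
  then have "AE x in surf_on S2. f x = 0" by eventually_elim simp
  then show ?thesis by (rule continuous_AE_zero[OF smooth_S2_continuous[OF f] _ x])
qed

abbreviation ip :: "(real^3 \<Rightarrow> real) \<Rightarrow> (real^3 \<Rightarrow> real) \<Rightarrow> real" where
  "ip f g \<equiv> (\<integral>x. f x * g x \<partial>surf_on S2)"

lemma smooth_S2_integrable_mult: "smooth_S2 f \<Longrightarrow> smooth_S2 g \<Longrightarrow> integrable (surf_on S2) (\<lambda>x. f x * g x)"
  by (intro smooth_S2_integrable smooth_S2_mult) auto

interpretation sph: semi_inner "{f. smooth_S2 f}" ip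
proof
  show "ip (\<lambda>x. f x + g x) h = ip f h + ip g h"
    if "f \<in> {f. smooth_S2 f}" "g \<in> {f. smooth_S2 f}" "h \<in> {f. smooth_S2 f}" for f g h
    using that by (simp add: distrib_right smooth_S2_integrable_mult)
  show "ip (\<lambda>x. c * f x) h = c * ip f h" for f h c
    by (simp add: mult.assoc)
  show "ip f g = ip g f" for f g
    by (simp add: mult.commute)
  show "0 \<le> ip f f" for f
    by (rule Bochner_Integration.integral_nonneg) simp
qed (auto intro: smooth_S2_add smooth_S2_cmult)

lemma ip_cong:
  "(\<And>x. x \<in> S2 \<Longrightarrow> f x = f' x) \<Longrightarrow> (\<And>x. x \<in> S2 \<Longrightarrow> g x = g' x) \<Longrightarrow> ip f g = ip f' g'"
  by (intro Bochner_Integration.integral_cong) auto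

lemma smooth_S2_combination: "(\<And>i. i \<in> I \<Longrightarrow> smooth_S2 (f i)) \<Longrightarrow> smooth_S2 (\<lambda>x. \<Sum>i\<in>I. c i * f i x)"
  by (intro smooth_S2_sum smooth_S2_cmult)

lemma rot_deriv_combination:
  assumes "\<And>i. i \<in> I \<Longrightarrow> smooth_S2 (f i)" "x \<in> S2"
  shows "rot_deriv a b (\<lambda>x. \<Sum>i\<in>I. c i * f i x) x = (\<Sum>i\<in>I. c i * rot_deriv a b (f i) x)"
proof -
  have nz: "x \<noteq> 0" using assms(2) by (rule S2_nonzero)
  have "tang_deriv j (\<lambda>x. \<Sum>i\<in>I. c i * f i x) x = (\<Sum>i\<in>I. c i * tang_deriv j (f i) x)" for j
    using assms(1) nz by (subst tang_deriv_sum) (auto intro!: sum.cong tang_deriv_cmult smooth_S2_cmult)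
  then show ?thesis
    by (simp add: rot_deriv_def sum_distrib_left sum_subtractf right_diff_distrib mult.left_commute)
qed

lemma laplace_S2_combination:
  assumes "\<And>i. i \<in> I \<Longrightarrow> smooth_S2 (f i)" "x \<in> S2"
  shows "laplace_S2 (\<lambda>x. \<Sum>i\<in>I. c i * f i x) x = (\<Sum>i\<in>I. c i * laplace_S2 (f i) x)"
  using assms(1)
proof (induction I rule: infinite_finite_induct)
  case (insert k I)
  have nz: "x \<noteq> 0" using assms(2) by (rule S2_nonzero)
  have "laplace_S2 (\<lambda>x. c k * f k x + (\<Sum>i\<in>I. c i * f i x)) x
      = c k * laplace_S2 (f k) x + laplace_S2 (\<lambda>x. \<Sum>i\<in>I. c i * f i x) x"
    using insert nz by (subst laplace_S2_add) (auto intro!: smooth_S2_combination smooth_S2_cmult simp: laplace_S2_cmult)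
  with insert show ?case by simp
qed (use laplace_S2_cmult[of "\<lambda>x. 0" x 0] S2_nonzero[OF assms(2)] in auto)

lemma rot_deriv_cong:
  "(\<And>x. x \<in> S2 \<Longrightarrow> f x = g x) \<Longrightarrow> x \<in> S2 \<Longrightarrow> rot_deriv a b f x = rot_deriv a b g x"
  unfolding rot_deriv_def using tang_deriv_cong[of f g x] S2_nonzero by metis

text \<open>
  The derivative of the product integrates to 0.
\<close>
lemma rot_deriv_antisymmetric:
  assumes "smooth_S2 f" "smooth_S2 g"
  shows "ip (rot_deriv a b f) g = - ip f (rot_deriv a b g)"
proof -
  have "0 = integral\<^sup>L (surf_on S2) (rot_deriv a b (\<lambda>x. f x * g x))"
    using integral_rot_deriv[OF smooth_S2_mult[OF assms]] by simp
  also have "\<dots> = (\<integral>x. rot_deriv a b f x * g x + f x * rot_deriv a b g x \<partial>surf_on S2)"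
    by (intro Bochner_Integration.integral_cong) (auto simp: rot_deriv_mult assms)
  also have "\<dots> = ip (rot_deriv a b f) g + ip f (rot_deriv a b g)"
    by (intro Bochner_Integration.integral_add smooth_S2_integrable_mult smooth_S2_rot_deriv assms)
  finally show ?thesis by simp
qed

text \<open>
  The homogeneous monomials, as a predicate suited to induction with the Leibniz rule.
\<close>
inductive coord_product :: "nat \<Rightarrow> (real^3 \<Rightarrow> real) \<Rightarrow> bool" where
  one: "coord_product 0 (\<lambda>x. 1)"
| times: "coord_product n f \<Longrightarrow> coord_product (Suc n) (\<lambda>x. x $ j * f x)"

lemma coord_product_power: "coord_product n f \<Longrightarrow> coord_product (k + n) (\<lambda>x. (x $ j) ^ k * f x)"
  by (induction k) (auto dest: coord_product.times[of _ _ j] simp: mult.assoc)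

text \<open>
  On the sphere the square of the third coordinate can be eliminated, which leaves \<open>2 n + 1\<close>
  monomials of degree \<open>n\<close>; they are numbered so that degree \<open>n\<close> occupies
  the positions from \<open>n\<^sup>2\<close> to \<open>(n + 1)\<^sup>2 - 1\<close>.
\<close>
definition monomial2 :: "nat \<Rightarrow> nat \<Rightarrow> real^3 \<Rightarrow> real" where
  "monomial2 n k x = (if k \<le> n then (x $ 1) ^ k * (x $ 2) ^ (n - k)
     else x $ 3 * ((x $ 1) ^ (k - Suc n) * (x $ 2) ^ (2 * n - k)))"

definition sph_monomial :: "nat \<Rightarrow> real^3 \<Rightarrow> real" where
  "sph_monomial i = monomial2 (floor_sqrt i) (i - (floor_sqrt i)\<^sup>2)"

lemma coord_product_monomial2:
  assumes "k \<le> 2 * n"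
  shows "coord_product n (monomial2 n k)"
proof -
  have *: "coord_product (a + b) (\<lambda>x. (x $ 1) ^ a * (x $ 2) ^ b)" for a b
    using coord_product_power[OF coord_product_power[OF coord_product.one, of b 2], of a 1] by simp
  show ?thesis
  proof (cases "k \<le> n")
    case True
    then show ?thesis using *[of k "n - k"] by (simp add: monomial2_def[abs_def])
  next
    case False
    then have "coord_product (Suc ((k - Suc n) + (2 * n - k))) (\<lambda>x. x $ 3 * ((x $ 1) ^ (k - Suc n) * (x $ 2) ^ (2 * n - k)))"
      by (intro coord_product.times *)
    moreover have "Suc ((k - Suc n) + (2 * n - k)) = n" using False assms by simp
    ultimately show ?thesis using False by (simp add: monomial2_def[abs_def])
  qed
qed

lemma index_split:
  fixes i :: nat
  obtains d k where "i = d\<^sup>2 + k" "k \<le> 2 * d" "floor_sqrt i = d" "i < (Suc d)\<^sup>2"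
proof -
  let ?d = "floor_sqrt i"
  have 1: "?d\<^sup>2 \<le> i" by simp
  have 2: "i < (Suc ?d)\<^sup>2" by (rule Suc_floor_sqrt_power2_gt)
  show ?thesis
  proof (rule that[of ?d "i - ?d\<^sup>2"])
    show "i - ?d\<^sup>2 \<le> 2 * ?d" using 1 2 by (simp add: power2_eq_square)
  qed (use 1 2 in auto)
qed

lemma sph_monomial_eq: "k \<le> 2 * n \<Longrightarrow> sph_monomial (n\<^sup>2 + k) = monomial2 n k"
  using floor_sqrt_unique[of n "n\<^sup>2 + k"] by (simp add: sph_monomial_def power2_eq_square)

lemma floor_sqrt_less_iff: "floor_sqrt i < n \<longleftrightarrow> i < n\<^sup>2"
  by (metis le_floor_sqrt_iff not_less)

lemma coord_product_sph_monomial: "coord_product (floor_sqrt i) (sph_monomial i)"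
  by (rule index_split[of i]) (metis coord_product_monomial2 sph_monomial_eq)

text \<open>
  The degree of a function on the sphere is only bounded, not determined, by a polynomial
  that represents it; hence a filtration rather than a grading.
\<close>
definition poly_less :: "nat \<Rightarrow> (real^3 \<Rightarrow> real) \<Rightarrow> bool" where
  "poly_less n f \<longleftrightarrow> (\<exists>c. \<forall>x\<in>S2. f x = (\<Sum>i<n\<^sup>2. c i * sph_monomial i x))"

lemma poly_less_eqI: "poly_less n g \<Longrightarrow> (\<And>x. x \<in> S2 \<Longrightarrow> f x = g x) \<Longrightarrow> poly_less n f"
  unfolding poly_less_def by simp

lemma poly_less_zero: "poly_less n (\<lambda>x. 0)"
  unfolding poly_less_def by (intro exI[of _ "\<lambda>i. 0"]) simp

lemma poly_less_add: "poly_less n f \<Longrightarrow> poly_less n g \<Longrightarrow> poly_less n (\<lambda>x. f x + g x)"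
proof -
  assume "poly_less n f" "poly_less n g"
  then obtain c d where "\<And>x. x \<in> S2 \<Longrightarrow> f x = (\<Sum>i<n\<^sup>2. c i * sph_monomial i x)"
    "\<And>x. x \<in> S2 \<Longrightarrow> g x = (\<Sum>i<n\<^sup>2. d i * sph_monomial i x)"
    unfolding poly_less_def by blast
  then show ?thesis unfolding poly_less_def
    by (intro exI[of _ "\<lambda>i. c i + d i"]) (simp add: distrib_right sum.distrib)
qed

lemma poly_less_cmult: "poly_less n f \<Longrightarrow> poly_less n (\<lambda>x. a * f x)"
proof -
  assume "poly_less n f"
  then obtain c where "\<And>x. x \<in> S2 \<Longrightarrow> f x = (\<Sum>i<n\<^sup>2. c i * sph_monomial i x)"
    unfolding poly_less_def by blast
  then show ?thesis unfolding poly_less_def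
    by (intro exI[of _ "\<lambda>i. a * c i"]) (simp add: sum_distrib_left mult.assoc)
qed

lemma poly_less_diff: "poly_less n f \<Longrightarrow> poly_less n g \<Longrightarrow> poly_less n (\<lambda>x. f x - g x)"
  using poly_less_add[of n f "\<lambda>x. (-1) * g x"] poly_less_cmult[of n g "-1"] by simp

lemma poly_less_combination: "(\<And>i. i \<in> I \<Longrightarrow> poly_less n (f i)) \<Longrightarrow> poly_less n (\<lambda>x. \<Sum>i\<in>I. c i * f i x)"
proof (induction I rule: infinite_finite_induct)
  case (insert k I)
  then show ?case
    using poly_less_add[OF poly_less_cmult[of n "f k" "c k"], of "\<lambda>x. \<Sum>i\<in>I. c i * f i x"] by simp
qed (simp_all add: poly_less_zero)

lemma poly_less_sph_monomial: "i < n\<^sup>2 \<Longrightarrow> poly_less n (sph_monomial i)"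
  unfolding poly_less_def
  by (intro exI[of _ "\<lambda>j. if j = i then 1 else 0"]) (simp add: if_distrib[of "\<lambda>x. x * _"] cong: if_cong)

lemma poly_less_monomial2:
  assumes "k \<le> 2 * d" "d < n"
  shows "poly_less n (monomial2 d k)"
proof -
  have "d\<^sup>2 + k < (Suc d)\<^sup>2" using assms by (simp add: power2_eq_square)
  also have "\<dots> \<le> n\<^sup>2" using assms by (intro power_mono) auto
  finally show ?thesis using poly_less_sph_monomial sph_monomial_eq[OF assms(1)] by metis
qed

lemma poly_less_mono:
  assumes "poly_less n f" "n \<le> n'"
  shows "poly_less n' f"
proof -
  obtain c where c: "\<And>x. x \<in> S2 \<Longrightarrow> f x = (\<Sum>i<n\<^sup>2. c i * sph_monomial i x)"
    using assms unfolding poly_less_def by blast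
  have "n\<^sup>2 \<le> n'\<^sup>2" using assms(2) by (intro power_mono) auto
  then have "poly_less n' (\<lambda>x. \<Sum>i<n\<^sup>2. c i * sph_monomial i x)"
    by (intro poly_less_combination poly_less_sph_monomial) (simp add: order_less_le_trans)
  then show ?thesis using c by (rule poly_less_eqI)
qed

lemma poly_less_coord_monomial2:
  assumes k: "k \<le> 2 * d" and d: "d < n"
  shows "poly_less (Suc n) (\<lambda>x. x $ j * monomial2 d k x)"
proof -
  consider "j = 1" | "j = 2" | "j = 3" using exhaust_3[of j] by blast
  then show ?thesis
  proof cases
    case 1
    show ?thesis
    proof (cases "k \<le> d")
      case True
      then have "(\<lambda>x. x $ j * monomial2 d k x) = monomial2 (Suc d) (Suc k)"
        by (auto simp: monomial2_def 1)
      then show ?thesis using poly_less_monomial2[of "Suc k" "Suc d" "Suc n"] k d by simp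
    next
      case False
      then obtain a where a: "k = Suc d + a" by (metis add_Suc le_iff_add not_less_eq_eq)
      have "(\<lambda>x. x $ j * monomial2 d k x) = monomial2 (Suc d) (Suc (Suc k))"
        by (auto simp: monomial2_def 1 a)
      then show ?thesis using poly_less_monomial2[of "Suc (Suc k)" "Suc d" "Suc n"] k d by simp
    qed
  next
    case 2
    show ?thesis
    proof (cases "k \<le> d")
      case True
      then have "(\<lambda>x. x $ j * monomial2 d k x) = monomial2 (Suc d) k"
        by (auto simp: monomial2_def 2 Suc_diff_le)
      then show ?thesis using poly_less_monomial2[of k "Suc d" "Suc n"] k d by simp
    next
      case False
      then have "(\<lambda>x. x $ j * monomial2 d k x) = monomial2 (Suc d) (Suc k)"
        using k by (auto simp: monomial2_def 2 Suc_diff_le)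
      then show ?thesis using poly_less_monomial2[of "Suc k" "Suc d" "Suc n"] k d by simp
    qed
  next
    case 3
    show ?thesis
    proof (cases "k \<le> d")
      case True
      then have "(\<lambda>x. x $ j * monomial2 d k x) = monomial2 (Suc d) (Suc (Suc (k + d)))"
        by (auto simp: monomial2_def 3)
      then show ?thesis using poly_less_monomial2[of "Suc (Suc (k + d))" "Suc d" "Suc n"] True d by simp
    next
      case False
      then obtain a where a: "k = Suc d + a" by (metis add_Suc le_iff_add not_less_eq_eq)
      define b where "b = d - Suc a"
      have b: "d = Suc (a + b)" using k by (simp add: a b_def)
      \<comment> \<open>the one case in which the square of the third coordinate appears and is eliminated\<close>
      have "x $ j * monomial2 d k x = monomial2 (a + b) a x + ((-1) * monomial2 (Suc d) (Suc (Suc a)) x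
          + (-1) * monomial2 (Suc d) a x)" if x: "x \<in> S2" for x
      proof -
        have "x $ 3 * x $ 3 = 1 - x $ 1 * x $ 1 - x $ 2 * x $ 2"
          using S2_sum_squares[OF x] by (simp add: sum_3)
        then have "x $ 3 * (x $ 3 * (x $ 1 ^ a * x $ 2 ^ b)) = (1 - x $ 1 * x $ 1 - x $ 2 * x $ 2) * (x $ 1 ^ a * x $ 2 ^ b)"
          by (simp add: mult.assoc[symmetric])
        then show ?thesis by (simp add: monomial2_def 3 a b algebra_simps)
      qed
      then show ?thesis
      proof (rule poly_less_eqI[rotated])
        show "poly_less (Suc n) (\<lambda>x. monomial2 (a + b) a x + ((-1) * monomial2 (Suc d) (Suc (Suc a)) x
          + (-1) * monomial2 (Suc d) a x))"
        using d b by (intro poly_less_add poly_less_cmult poly_less_monomial2) auto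
      qed
    qed
  qed
qed

lemma poly_less_coord:
  assumes "poly_less n f"
  shows "poly_less (Suc n) (\<lambda>x. x $ j * f x)"
proof -
  obtain c where c: "\<And>x. x \<in> S2 \<Longrightarrow> f x = (\<Sum>i<n\<^sup>2. c i * sph_monomial i x)"
    using assms unfolding poly_less_def by blast
  have "poly_less (Suc n) (\<lambda>x. x $ j * sph_monomial i x)" if i: "i < n\<^sup>2" for i
  proof -
    obtain d k where dk: "i = d\<^sup>2 + k" "k \<le> 2 * d" "floor_sqrt i = d" using index_split[of i] by metis
    then have "d < n" using i floor_sqrt_less_iff[of i n] by simp
    then show ?thesis using poly_less_coord_monomial2[OF dk(2), of n j]
      unfolding dk(1) sph_monomial_eq[OF dk(2)] by simp
  qed
  then have "poly_less (Suc n) (\<lambda>x. \<Sum>i<n\<^sup>2. c i * (x $ j * sph_monomial i x))"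
    by (intro poly_less_combination) auto
  then show ?thesis
  proof (rule poly_less_eqI)
    show "x $ j * f x = (\<Sum>i<n\<^sup>2. c i * (x $ j * sph_monomial i x))" if "x \<in> S2" for x
      by (simp add: c[OF that] sum_distrib_left mult.left_commute)
  qed
qed

lemma poly_less_coord_product: "coord_product n f \<Longrightarrow> poly_less (Suc n) f"
proof (induction rule: coord_product.induct)
  case one
  have "(\<lambda>x. 1) = monomial2 0 0" by (auto simp: monomial2_def)
  then show ?case using poly_less_monomial2[of 0 0 1] by simp
next
  case (times n f j)
  then show ?case using poly_less_coord by blast
qed

lemma smooth_coord_product: "coord_product n f \<Longrightarrow> smooth_S2 f"
  by (induction rule: coord_product.induct) (auto intro: smooth_S2_mult smooth_S2_component)

lemma smooth_sph_monomial: "smooth_S2 (sph_monomial i)"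
  by (rule smooth_coord_product[OF coord_product_sph_monomial])

lemma poly_less_smooth:
  assumes "poly_less n f"
  shows "smooth_S2 f"
proof -
  obtain c where c: "\<And>x. x \<in> S2 \<Longrightarrow> f x = (\<Sum>i<n\<^sup>2. c i * sph_monomial i x)"
    using assms unfolding poly_less_def by blast
  show ?thesis
    by (rule iffD2[OF smooth_S2_cong[OF c]], assumption)
       (intro smooth_S2_combination smooth_sph_monomial)
qed

section \<open>Spherical harmonics\<close>

text \<open>
  For a homogeneous polynomial of degree \<open>n\<close> the radial part of the Euclidean gradient at \<open>x\<close> is
  \<open>n f x\<close>; adding it to the tangential part restores the Euclidean gradient, which has lower degree.
\<close>
lemma coord_product_tang_deriv:
  "coord_product n f \<Longrightarrow> poly_less n (\<lambda>x. tang_deriv j f x + real n * (x $ j * f x))"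
proof (induction rule: coord_product.induct)
  case one
  show ?case by (simp add: poly_less_zero)
next
  case (times n f k)
  have f: "smooth_S2 f" using times(1) by (rule smooth_coord_product)
  have "poly_less (Suc n) (\<lambda>x. (if j = k then 1 else 0) * f x + x $ k * (tang_deriv j f x + real n * (x $ j * f x)))"
    by (intro poly_less_add poly_less_cmult poly_less_coord times.IH poly_less_coord_product times(1))
  then show ?case
  proof (rule poly_less_eqI)
    fix x assume x: "x \<in> S2"
    show "tang_deriv j (\<lambda>x. x $ k * f x) x + real (Suc n) * (x $ j * (x $ k * f x))
      = (if j = k then 1 else 0) * f x + x $ k * (tang_deriv j f x + real n * (x $ j * f x))"
      unfolding tang_deriv_mult[OF smooth_S2_component f x] tang_deriv_component[OF x] by (simp add: algebra_simps)
  qed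
qed

lemma laplace_S2_component:
  assumes x: "x \<in> S2"
  shows "laplace_S2 (\<lambda>x. x $ j) x = - 2 * x $ j"
proof -
  have nz: "x \<noteq> 0" using x by (rule S2_nonzero)
  have "tang_deriv i (tang_deriv i (\<lambda>x. x $ j)) x
      = - (1 - x $ i * x $ i) * x $ j - x $ i * ((if i = j then 1 else 0) - x $ i * x $ j)" for i
  proof -
    have "tang_deriv i (tang_deriv i (\<lambda>x. x $ j)) x
        = tang_deriv i (\<lambda>x. (if i = j then 1 else 0) - x $ i * x $ j) x"
      using nz by (intro tang_deriv_cong tang_deriv_component)
    also have "\<dots> = - tang_deriv i (\<lambda>x. x $ i * x $ j) x"
      using nz by (subst tang_deriv_diff) (auto intro: smooth_S2_mult smooth_S2_component)
    also have "tang_deriv i (\<lambda>x. x $ i * x $ j) x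
        = (1 - x $ i * x $ i) * x $ j + x $ i * ((if i = j then 1 else 0) - x $ i * x $ j)"
      by (simp add: tang_deriv_mult[OF smooth_S2_component smooth_S2_component x] tang_deriv_component[OF x])
    finally show ?thesis by (simp add: algebra_simps)
  qed
  then have "laplace_S2 (\<lambda>x. x $ j) x
      = (\<Sum>i\<in>UNIV. - (1 - x $ i * x $ i) * x $ j - x $ i * ((if i = j then 1 else 0) - x $ i * x $ j))"
    by (simp add: laplace_S2_def)
  also have "\<dots> = (\<Sum>i\<in>UNIV. 2 * x $ j * (x $ i * x $ i) - x $ j - x $ i * (if i = j then 1 else 0))"
    by (intro sum.cong) (auto simp: algebra_simps)
  also have "\<dots> = 2 * x $ j * (\<Sum>i\<in>UNIV. x $ i * x $ i) - 3 * x $ j - x $ j"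
    by (simp add: sum_subtractf sum_distrib_left if_distrib[of "\<lambda>y. _ * y"] sum.delta cong: if_cong)
  also have "\<dots> = - 2 * x $ j" using S2_sum_squares[OF x] by simp
  finally show ?thesis .
qed

text \<open>
  In polar coordinates the Euclidean Laplacian of a homogeneous polynomial of degree \<open>n\<close> is, on the
  sphere, the spherical Laplacian plus \<open>n (n + 1)\<close> times the polynomial, and it has lower degree.
\<close>
lemma coord_product_laplace:
  "coord_product n f \<Longrightarrow> poly_less n (\<lambda>x. laplace_S2 f x + real n * (real n + 1) * f x)"
proof (induction rule: coord_product.induct)
  case one
  have "poly_less 0 (\<lambda>x. 0)" by (rule poly_less_zero)
  then show ?case by (simp add: laplace_S2_def tang_deriv_const[abs_def])
next
  case (times n f j)
  have f: "smooth_S2 f" using times(1) by (rule smooth_coord_product)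
  have "poly_less (Suc n) (\<lambda>x. x $ j * (laplace_S2 f x + real n * (real n + 1) * f x)
      + 2 * (tang_deriv j f x + real n * (x $ j * f x)))"
    by (intro poly_less_add poly_less_cmult poly_less_coord times.IH
        poly_less_mono[OF coord_product_tang_deriv[OF times(1)]]) simp
  then show ?case
  proof (rule poly_less_eqI)
    fix x assume x: "x \<in> S2"
    have "(\<Sum>i\<in>UNIV. tang_deriv i (\<lambda>x. x $ j) x * tang_deriv i f x)
        = (\<Sum>i\<in>UNIV. (if i = j then 1 else 0) * tang_deriv i f x - x $ j * (x $ i * tang_deriv i f x))"
      by (intro sum.cong) (auto simp: tang_deriv_component[OF x] algebra_simps)
    also have "\<dots> = tang_deriv j f x - x $ j * (\<Sum>i\<in>UNIV. x $ i * tang_deriv i f x)"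
      by (simp add: sum_subtractf sum_distrib_left if_distrib[of "\<lambda>y. y * _"] sum.delta cong: if_cong)
    also have "\<dots> = tang_deriv j f x"
      using tang_deriv_radial[OF f S2_nonzero[OF x]] by simp
    finally have "laplace_S2 (\<lambda>x. x $ j * f x) x = - 2 * x $ j * f x + 2 * tang_deriv j f x + x $ j * laplace_S2 f x"
      unfolding laplace_S2_mult[OF smooth_S2_component f x] laplace_S2_component[OF x] by simp
    then show "laplace_S2 (\<lambda>x. x $ j * f x) x + real (Suc n) * (real (Suc n) + 1) * (x $ j * f x)
      = x $ j * (laplace_S2 f x + real n * (real n + 1) * f x) + 2 * (tang_deriv j f x + real n * (x $ j * f x))"
      by (simp add: algebra_simps)
  qed
qed

lemma poly_less_rot_deriv_monomial:
  assumes "i < n\<^sup>2"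
  shows "poly_less n (rot_deriv a b (sph_monomial i))"
proof -
  let ?m = "sph_monomial i" and ?d = "floor_sqrt i"
  have d: "Suc ?d \<le> n" using assms floor_sqrt_less_iff[of i n] by simp
  have "poly_less (Suc ?d) (\<lambda>x. x $ a * (tang_deriv b ?m x + real ?d * (x $ b * ?m x))
      - x $ b * (tang_deriv a ?m x + real ?d * (x $ a * ?m x)))"
    by (intro poly_less_diff poly_less_coord coord_product_tang_deriv coord_product_sph_monomial)
  then have "poly_less (Suc ?d) (rot_deriv a b ?m)"
    by (rule poly_less_eqI) (simp add: rot_deriv_def algebra_simps)
  then show ?thesis using d by (rule poly_less_mono)
qed

lemma poly_less_laplace_monomial:
  assumes "i < n\<^sup>2"
  shows "poly_less n (laplace_S2 (sph_monomial i))"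
proof -
  let ?m = "sph_monomial i" and ?d = "floor_sqrt i"
  have d: "?d \<le> n" using assms floor_sqrt_less_iff[of i n] by simp
  have "poly_less n (\<lambda>x. (laplace_S2 ?m x + real ?d * (real ?d + 1) * ?m x) - (real ?d * (real ?d + 1)) * ?m x)"
    by (intro poly_less_diff poly_less_cmult poly_less_sph_monomial assms
        poly_less_mono[OF coord_product_laplace[OF coord_product_sph_monomial] d])
  then show ?thesis by simp
qed

lemma poly_less_rot_deriv:
  assumes "poly_less n f"
  shows "poly_less n (rot_deriv a b f)"
proof -
  obtain c where c: "\<And>x. x \<in> S2 \<Longrightarrow> f x = (\<Sum>i<n\<^sup>2. c i * sph_monomial i x)"
    using assms unfolding poly_less_def by blast
  have "poly_less n (\<lambda>x. \<Sum>i<n\<^sup>2. c i * rot_deriv a b (sph_monomial i) x)"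
    by (intro poly_less_combination poly_less_rot_deriv_monomial) simp
  then show ?thesis
  proof (rule poly_less_eqI)
    fix x assume x: "x \<in> S2"
    show "rot_deriv a b f x = (\<Sum>i<n\<^sup>2. c i * rot_deriv a b (sph_monomial i) x)"
      using rot_deriv_cong[OF c x, where a = a and b = b] rot_deriv_combination[OF smooth_sph_monomial x] by simp
  qed
qed

lemma poly_less_laplace:
  assumes "poly_less n f"
  shows "poly_less n (laplace_S2 f)"
proof -
  obtain c where c: "\<And>x. x \<in> S2 \<Longrightarrow> f x = (\<Sum>i<n\<^sup>2. c i * sph_monomial i x)"
    using assms unfolding poly_less_def by blast
  have "poly_less n (\<lambda>x. \<Sum>i<n\<^sup>2. c i * laplace_S2 (sph_monomial i) x)"
    by (intro poly_less_combination poly_less_laplace_monomial) simp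
  then show ?thesis
  proof (rule poly_less_eqI)
    fix x assume x: "x \<in> S2"
    show "laplace_S2 f x = (\<Sum>i<n\<^sup>2. c i * laplace_S2 (sph_monomial i) x)"
      using laplace_S2_cong[OF c S2_nonzero[OF x]] laplace_S2_combination[OF smooth_sph_monomial x] by simp
  qed
qed

text \<open>
  Orthonormalising the monomials in the order of their degrees makes each basis vector orthogonal to
  all polynomials of lower degree, which already characterises spherical harmonics.
\<close>
definition harmonic :: "nat \<Rightarrow> real^3 \<Rightarrow> real" where
  "harmonic = sph.gram_schmidt sph_monomial"

lemma orthonormal0_harmonic: "sph.orthonormal0 I harmonic"
proof (rule sph.orthonormal0_mono)
  show "sph.orthonormal0 UNIV harmonic"
    unfolding harmonic_def by (intro sph.orthonormal0_gram_schmidt) (simp add: smooth_sph_monomial)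
qed simp

lemma smooth_harmonic: "smooth_S2 (harmonic i)"
  using sph.orthonormal0_closed[OF orthonormal0_harmonic[of UNIV]] by simp

lemma ip_harmonic_neq: "i \<noteq> j \<Longrightarrow> ip (harmonic i) (harmonic j) = 0"
  using orthonormal0_harmonic[of UNIV] unfolding sph.orthonormal0_def by simp

lemma ip_harmonic_self: "ip (harmonic i) (harmonic i) = 1 \<or> harmonic i = (\<lambda>x. 0)"
  using orthonormal0_harmonic[of UNIV] unfolding sph.orthonormal0_def by simp

lemma harmonic_triangular: "\<exists>d. \<forall>x. harmonic i x = (\<Sum>k<Suc i. d k * sph_monomial k x)"
  unfolding harmonic_def by (rule sph.gram_schmidt_triangular)

lemma poly_less_harmonic:
  assumes "i < n\<^sup>2"
  shows "poly_less n (harmonic i)"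
proof -
  obtain d where d: "\<And>x. harmonic i x = (\<Sum>k<Suc i. d k * sph_monomial k x)"
    using harmonic_triangular by blast
  have "poly_less n (\<lambda>x. \<Sum>k<Suc i. d k * sph_monomial k x)"
    by (intro poly_less_combination poly_less_sph_monomial) (use assms in auto)
  then show ?thesis using d by (rule poly_less_eqI)
qed

lemma sph_monomial_harmonic:
  "\<exists>c. \<forall>x\<in>S2. sph_monomial i x = (\<Sum>k<Suc i. c k * harmonic k x)"
proof -
  let ?v = "sph.gs_residual sph_monomial i"
  have o: "sph.orthonormal0 {..<i} (sph.gram_schmidt sph_monomial)"
    using orthonormal0_harmonic unfolding harmonic_def .
  have v: "smooth_S2 ?v"
    using sph.diff_closed[OF _ sph.proj_closed[OF o]] smooth_sph_monomial
    unfolding sph.gs_residual_def by simp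
  let ?c = "\<lambda>k. if k = i then sqrt (ip ?v ?v) else ip (sph_monomial i) (harmonic k)"
  have "sph_monomial i x = (\<Sum>k<Suc i. ?c k * harmonic k x)" if x: "x \<in> S2" for x
  proof -
    have "ip ?v ?v \<noteq> 0 \<or> ?v x = 0"
      using smooth_S2_definite[OF v _ x] by blast
    then have "sph_monomial i x = sph.proj {..<i} harmonic (sph_monomial i) x + sqrt (ip ?v ?v) * harmonic i x"
      unfolding harmonic_def by (rule sph.gram_schmidt_span)
    then show ?thesis by (simp add: sph.proj_def)
  qed
  then show ?thesis by (intro exI ballI)
qed

lemma poly_less_expansion:
  assumes f: "poly_less n f" and x: "x \<in> S2"
  shows "f x = (\<Sum>k<n\<^sup>2. ip f (harmonic k) * harmonic k x)"
proof -
  obtain c where c: "\<And>x. x \<in> S2 \<Longrightarrow> f x = (\<Sum>i<n\<^sup>2. c i * sph_monomial i x)"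
    using f unfolding poly_less_def by blast
  have "\<forall>i. \<exists>d. \<forall>x\<in>S2. sph_monomial i x = (\<Sum>k<Suc i. d k * harmonic k x)"
    using sph_monomial_harmonic by blast
  then obtain D where D: "\<And>i x. x \<in> S2 \<Longrightarrow> sph_monomial i x = (\<Sum>k<Suc i. D i k * harmonic k x)"
    by metis
  have D': "sph_monomial i x = (\<Sum>k<n\<^sup>2. (if k \<le> i then D i k else 0) * harmonic k x)" if "i < n\<^sup>2" "x \<in> S2" for i x
    unfolding D[OF that(2)] using that(1) by (intro sum.mono_neutral_cong_left) auto
  define a where "a k = (\<Sum>i<n\<^sup>2. c i * (if k \<le> i then D i k else 0))" for k
  have a: "f x = (\<Sum>k<n\<^sup>2. a k * harmonic k x)" if x: "x \<in> S2" for x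
  proof -
    have "f x = (\<Sum>i<n\<^sup>2. \<Sum>k<n\<^sup>2. c i * (if k \<le> i then D i k else 0) * harmonic k x)"
      unfolding c[OF x] by (intro sum.cong refl) (simp only: D'[OF _ x] sum_distrib_left mult.assoc lessThan_iff)
    also have "\<dots> = (\<Sum>k<n\<^sup>2. a k * harmonic k x)"
      unfolding a_def sum_distrib_right by (rule sum.swap)
    finally show ?thesis .
  qed
  have *: "a k * harmonic k x = ip f (harmonic k) * harmonic k x" if k: "k < n\<^sup>2" for k
  proof -
    have "ip f (harmonic k) = ip (\<lambda>x. \<Sum>k<n\<^sup>2. a k * harmonic k x) (harmonic k)"
      by (rule ip_cong) (simp_all add: a)
    also have "\<dots> = a k * ip (harmonic k) (harmonic k)"
      using k by (intro sph.B_combination orthonormal0_harmonic) auto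
    finally show ?thesis using ip_harmonic_self[of k] by auto
  qed
  show ?thesis unfolding a[OF x] by (intro sum.cong refl *) simp
qed

lemma poly_less_orthogonal:
  assumes f: "poly_less n f" and i: "n\<^sup>2 \<le> i"
  shows "ip f (harmonic i) = 0"
proof -
  have "ip f (harmonic i) = ip (\<lambda>x. \<Sum>k<n\<^sup>2. ip f (harmonic k) * harmonic k x) (harmonic i)"
    by (rule ip_cong) (simp_all add: poly_less_expansion[OF f])
  also have "\<dots> = (\<Sum>k<n\<^sup>2. ip f (harmonic k) * ip (harmonic k) (harmonic i))"
    by (rule sph.B_sum) (simp_all add: smooth_harmonic)
  also have "\<dots> = 0"
    using i by (intro sum.neutral) (auto simp: ip_harmonic_neq)
  finally show ?thesis .
qed

definition harmonic_eigenvalue :: "nat \<Rightarrow> real" where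
  "harmonic_eigenvalue n = real n * (real n + 1)"

text \<open>
  The Laplacian is symmetric and maps polynomials of degree less than \<open>n\<close> to such polynomials,
  and on degree \<open>n\<close> it acts as \<open>- n (n + 1)\<close> up to lower degree. Hence its defect on the
  \<open>i\<close>-th harmonic is of lower degree and at the same time orthogonal to all lower degrees.
\<close>
lemma laplace_harmonic:
  assumes i: "n\<^sup>2 \<le> i" "i < (Suc n)\<^sup>2" and x: "x \<in> S2"
  shows "laplace_S2 (harmonic i) x = - harmonic_eigenvalue n * harmonic i x"
proof -
  let ?l = "harmonic_eigenvalue n"
  let ?T = "\<lambda>f x. laplace_S2 f x + ?l * f x"
  let ?w = "?T (harmonic i)"
  obtain d where d: "\<And>x. harmonic i x = (\<Sum>k<Suc i. d k * sph_monomial k x)"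
    using harmonic_triangular by blast
  have T: "poly_less n (?T (sph_monomial k))" if "k < Suc i" for k
  proof (cases "k < n\<^sup>2")
    case True
    then show ?thesis by (intro poly_less_add poly_less_cmult poly_less_laplace poly_less_sph_monomial)
  next
    case False
    then have "floor_sqrt k = n" using that i by (intro floor_sqrt_unique) auto
    then show ?thesis
      using coord_product_laplace[OF coord_product_sph_monomial, of k] by (simp add: harmonic_eigenvalue_def)
  qed
  have "poly_less n (\<lambda>x. \<Sum>k<Suc i. d k * ?T (sph_monomial k) x)"
    by (intro poly_less_combination T) simp
  then have w: "poly_less n ?w"
  proof (rule poly_less_eqI)
    fix x assume x: "x \<in> S2"
    have "laplace_S2 (harmonic i) x = (\<Sum>k<Suc i. d k * laplace_S2 (sph_monomial k) x)"
      unfolding d[abs_def] by (rule laplace_S2_combination[OF smooth_sph_monomial x])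
    then show "?w x = (\<Sum>k<Suc i. d k * ?T (sph_monomial k) x)"
      unfolding d by (simp only: distrib_left sum.distrib sum_distrib_left mult.left_commute)
  qed
  have sw: "smooth_S2 ?w" using w by (rule poly_less_smooth)
  have "ip ?w ?w = ip (laplace_S2 (harmonic i)) ?w + ?l * ip (harmonic i) ?w"
    using smooth_harmonic[of i] sw
    by (subst sph.B_add) (auto intro: smooth_S2_laplace smooth_S2_cmult simp: sph.B_cmult)
  also have "ip (laplace_S2 (harmonic i)) ?w = ip (harmonic i) (laplace_S2 ?w)"
    by (rule laplace_S2_symmetric[symmetric, OF smooth_harmonic sw])
  also have "\<dots> = 0"
    using poly_less_orthogonal[OF poly_less_laplace[OF w] i(1)] by (simp add: mult.commute)
  also have "ip (harmonic i) ?w = 0"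
    using poly_less_orthogonal[OF w i(1)] by (simp add: mult.commute)
  finally have "ip ?w ?w = 0" by simp
  then have "?w x = 0" by (rule smooth_S2_definite[OF sw _ x])
  then show ?thesis by simp
qed

abbreviation block :: "nat \<Rightarrow> nat set" where
  "block n \<equiv> {n\<^sup>2..<(Suc n)\<^sup>2}"

text \<open>
  The rotation fields do not raise degrees, and being antisymmetric they also preserve the orthogonal
  complement of the lower degrees.
\<close>
lemma rot_deriv_harmonic:
  assumes i: "i \<in> block n" and x: "x \<in> S2"
  shows "rot_deriv a b (harmonic i) x = (\<Sum>k\<in>block n. ip (rot_deriv a b (harmonic i)) (harmonic k) * harmonic k x)"
proof -
  let ?r = "rot_deriv a b (harmonic i)"
  have "poly_less (Suc n) ?r" using i by (intro poly_less_rot_deriv poly_less_harmonic) simp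
  then have "?r x = (\<Sum>k<(Suc n)\<^sup>2. ip ?r (harmonic k) * harmonic k x)"
    using x by (rule poly_less_expansion)
  also have "\<dots> = (\<Sum>k\<in>block n. ip ?r (harmonic k) * harmonic k x)"
  proof (rule sum.mono_neutral_right)
    show "\<forall>k\<in>{..<(Suc n)\<^sup>2} - block n. ip ?r (harmonic k) * harmonic k x = 0"
    proof
      fix k assume "k \<in> {..<(Suc n)\<^sup>2} - block n"
      then have k: "k < n\<^sup>2" by auto
      have "ip ?r (harmonic k) = - ip (harmonic i) (rot_deriv a b (harmonic k))"
        by (intro rot_deriv_antisymmetric smooth_harmonic)
      also have "ip (harmonic i) (rot_deriv a b (harmonic k)) = 0"
        using poly_less_orthogonal[OF poly_less_rot_deriv[OF poly_less_harmonic[OF k]], of i a b] i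
        by (simp add: mult.commute)
      finally show "ip ?r (harmonic k) * harmonic k x = 0" by simp
    qed
  qed auto
  finally show ?thesis .
qed

lemma tang_deriv_zero_imp_constant:
  assumes f: "smooth_S2 f" and z: "\<And>i x. x \<in> S2 \<Longrightarrow> tang_deriv i f x = 0"
  obtains c where "\<And>x. x \<in> S2 \<Longrightarrow> f x = c"
proof -
  have z': "tang_deriv i f x = 0" if "x \<noteq> 0" for i x
    using radial_ext_tang_deriv[OF f that, of i] z[OF sgn_in_S2[OF that], of i] that
    by (simp add: radial_ext_eq)
  have "(radial_ext f has_derivative (\<lambda>h. 0)) (at x)" if "x \<noteq> 0" for x
    using has_derivative_partial_deriv[OF smooth_S2_differentiable[OF f that]] z'[OF that]
    by (simp add: tang_deriv_def)
  moreover have "connected (- {0::real^3})" by (intro connected_punctured_universe) simp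
  moreover have "axis 1 1 \<in> - {0::real^3}" by (simp add: axis_eq_0_iff)
  ultimately have "radial_ext f x = radial_ext f (axis 1 1)" if "x \<noteq> 0" for x
    using has_derivative_zero_unique_connected[OF open_punctured, of "radial_ext f" x "axis 1 1"] that by simp
  then show ?thesis using that[of "radial_ext f (axis 1 1)"] radial_ext_S2 S2_nonzero by metis
qed

text \<open>
  The rotation fields act on the span of a block by antisymmetric matrices, hence annihilate the
  sum of the squares of its orthonormal basis, which must be constant; integration shows that the
  constant is the number of nonzero basis vectors divided by the area of the sphere.
\<close>
lemma block_sum_squares:
  "\<exists>C. 4 * pi * C \<le> 2 * real n + 1 \<and> (\<forall>x\<in>S2. (\<Sum>i\<in>block n. harmonic i x * harmonic i x) = C)"
proof -
  let ?S = "\<lambda>x. \<Sum>i\<in>block n. harmonic i x * harmonic i x"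
  have S: "smooth_S2 ?S" by (intro smooth_S2_sum smooth_S2_mult smooth_harmonic)
  let ?A = "\<lambda>a b i k. ip (rot_deriv a b (harmonic i)) (harmonic k)"
  have rot: "rot_deriv a b ?S x = 0" if x: "x \<in> S2" for a b x
  proof -
    have "rot_deriv a b (\<lambda>x. \<Sum>i\<in>block n. 1 * (harmonic i x * harmonic i x)) x
        = (\<Sum>i\<in>block n. 1 * rot_deriv a b (\<lambda>x. harmonic i x * harmonic i x) x)"
      by (intro rot_deriv_combination smooth_S2_mult smooth_harmonic x)
    then have "rot_deriv a b ?S x = (\<Sum>i\<in>block n. 2 * (rot_deriv a b (harmonic i) x * harmonic i x))"
      by (simp add: rot_deriv_mult[OF smooth_harmonic smooth_harmonic x] mult.commute)
    also have "\<dots> = 2 * (\<Sum>i\<in>block n. \<Sum>k\<in>block n. ?A a b i k * harmonic k x * harmonic i x)"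
      unfolding sum_distrib_left
      by (intro sum.cong refl) (simp only: rot_deriv_harmonic[OF _ x] sum_distrib_right sum_distrib_left)
    finally have 1: "rot_deriv a b ?S x = 2 * (\<Sum>i\<in>block n. \<Sum>k\<in>block n. ?A a b i k * harmonic k x * harmonic i x)" .
    have anti: "?A a b i k = - ?A a b k i" for i k
      using rot_deriv_antisymmetric[OF smooth_harmonic smooth_harmonic, of a b i k] by (simp add: mult.commute)
    have "(\<Sum>i\<in>block n. \<Sum>k\<in>block n. ?A a b i k * harmonic k x * harmonic i x)
        = (\<Sum>k\<in>block n. \<Sum>i\<in>block n. ?A a b i k * harmonic k x * harmonic i x)"
      by (rule sum.swap)
    also have "\<dots> = (\<Sum>k\<in>block n. \<Sum>i\<in>block n. - (?A a b k i * harmonic i x * harmonic k x))"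
    proof (intro sum.cong refl)
      fix i k
      show "?A a b i k * harmonic k x * harmonic i x = - (?A a b k i * harmonic i x * harmonic k x)"
        by (subst anti) simp
    qed
    also have "\<dots> = - (\<Sum>k\<in>block n. \<Sum>i\<in>block n. ?A a b k i * harmonic i x * harmonic k x)"
      by (simp only: sum_negf)
    finally show ?thesis using 1 by simp
  qed
  have "tang_deriv i ?S x = 0" if x: "x \<in> S2" for i x
    unfolding tang_deriv_from_rot_deriv[OF S x] by (simp only: rot[OF x] mult_zero_right sum.neutral_const)
  then obtain C where C: "\<And>x. x \<in> S2 \<Longrightarrow> ?S x = C"
    using tang_deriv_zero_imp_constant[OF S] by blast
  have "4 * pi * C = (\<integral>x. C \<partial>surf_on S2)"
    using measure_surf_S2 by (simp add: surf_on_def measure_restrict_space)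
  also have "\<dots> = (\<integral>x. ?S x \<partial>surf_on S2)"
    by (intro Bochner_Integration.integral_cong) (auto simp: C)
  also have "\<dots> = (\<Sum>i\<in>block n. ip (harmonic i) (harmonic i))"
    by (intro Bochner_Integration.integral_sum smooth_S2_integrable_mult smooth_harmonic)
  also have "\<dots> \<le> (\<Sum>i\<in>block n. 1)"
  proof (rule sum_mono)
    fix i show "ip (harmonic i) (harmonic i) \<le> 1" using ip_harmonic_self[of i] by auto
  qed
  also have "\<dots> = 2 * real n + 1" by (simp add: power2_eq_square algebra_simps)
  finally have "4 * pi * C \<le> 2 * real n + 1" .
  then show ?thesis using C by (intro exI[of _ C] conjI ballI)
qed

text \<open>
  The Laplacian of the constant sum of squares is 0, and by the Leibniz rule it is twice the sum of
  the squared gradients minus twice the eigenvalue times that constant.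
\<close>
lemma block_sum_gradients:
  assumes x: "x \<in> S2"
  shows "(\<Sum>i\<in>block n. \<Sum>j\<in>UNIV. (tang_deriv j (harmonic i) x)\<^sup>2) \<le> harmonic_eigenvalue n * (2 * real n + 1) / (4 * pi)"
proof -
  obtain C where C: "4 * pi * C \<le> 2 * real n + 1" "\<And>x. x \<in> S2 \<Longrightarrow> (\<Sum>i\<in>block n. harmonic i x * harmonic i x) = C"
    using block_sum_squares[of n] by (elim exE conjE) simp
  have nz: "x \<noteq> 0" using x by (rule S2_nonzero)
  have "laplace_S2 (\<lambda>x. \<Sum>i\<in>block n. harmonic i x * harmonic i x) x = laplace_S2 (\<lambda>x. C) x"
    using C(2) nz by (rule laplace_S2_cong)
  also have "\<dots> = 0"
    by (simp add: laplace_S2_def tang_deriv_const[abs_def])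
  finally have "0 = laplace_S2 (\<lambda>x. \<Sum>i\<in>block n. 1 * (harmonic i x * harmonic i x)) x"
    by simp
  also have "\<dots> = (\<Sum>i\<in>block n. 1 * laplace_S2 (\<lambda>x. harmonic i x * harmonic i x) x)"
    by (intro laplace_S2_combination smooth_S2_mult smooth_harmonic x)
  also have "\<dots> = (\<Sum>i\<in>block n. 2 * (\<Sum>j\<in>UNIV. (tang_deriv j (harmonic i) x)\<^sup>2)
      - 2 * harmonic_eigenvalue n * (harmonic i x * harmonic i x))"
    by (intro sum.cong refl) (simp add: laplace_S2_mult[OF smooth_harmonic smooth_harmonic x] power2_eq_square
        laplace_harmonic[OF _ _ x, of n])
  also have "\<dots> = 2 * (\<Sum>i\<in>block n. \<Sum>j\<in>UNIV. (tang_deriv j (harmonic i) x)\<^sup>2) - 2 * harmonic_eigenvalue n * C"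
    unfolding C(2)[OF x, symmetric] by (simp only: sum_subtractf sum_distrib_left)
  finally have "(\<Sum>i\<in>block n. \<Sum>j\<in>UNIV. (tang_deriv j (harmonic i) x)\<^sup>2) = harmonic_eigenvalue n * C" by simp
  also have "\<dots> \<le> harmonic_eigenvalue n * ((2 * real n + 1) / (4 * pi))"
    using C(1) by (intro mult_left_mono) (auto simp: harmonic_eigenvalue_def field_simps)
  finally show ?thesis by simp
qed

section \<open>The spectral inequality on the sphere\<close>

lemma poly_less_mult:
  assumes "poly_less m f" "poly_less n g"
  shows "poly_less (m + n) (\<lambda>x. f x * g x)"
proof -
  have cp: "poly_less (d + n) (\<lambda>x. p x * g x)" if "coord_product d p" for d p
    using that
  proof (induction rule: coord_product.induct)
    case one
    then show ?case using assms(2) by simp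
  next
    case (times d p j)
    from poly_less_coord[OF times.IH, of j] show ?case by (simp add: mult.assoc)
  qed
  obtain c where c: "\<And>x. x \<in> S2 \<Longrightarrow> f x = (\<Sum>i<m\<^sup>2. c i * sph_monomial i x)"
    using assms(1) unfolding poly_less_def by blast
  have "poly_less (m + n) (\<lambda>x. \<Sum>i<m\<^sup>2. c i * (sph_monomial i x * g x))"
  proof (intro poly_less_combination)
    fix i assume "i \<in> {..<m\<^sup>2}"
    then have "floor_sqrt i \<le> m" using floor_sqrt_less_iff[of i m] by simp
    then show "poly_less (m + n) (\<lambda>x. sph_monomial i x * g x)"
      by (intro poly_less_mono[OF cp[OF coord_product_sph_monomial]]) simp
  qed
  then show ?thesis
    by (rule poly_less_eqI) (simp add: c sum_distrib_right mult.assoc)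
qed

lemma real_polynomial_function_poly_less:
  fixes p :: "real^3 \<Rightarrow> real"
  assumes "real_polynomial_function p"
  shows "\<exists>n. poly_less n p"
  using assms
proof (induction rule: real_polynomial_function.induct)
  case (linear f)
  have "f x = (\<Sum>i\<in>UNIV. f (axis i 1) * (x $ i * 1))" for x
  proof -
    have "f x = f (\<Sum>i\<in>UNIV. x $ i *\<^sub>R axis i 1)"
      using basis_expansion[of x] by (simp add: scalar_mult_eq_scaleR)
    also have "\<dots> = (\<Sum>i\<in>UNIV. f (axis i 1) * (x $ i * 1))"
      using bounded_linear.linear[OF linear] by (simp add: linear_sum linear_scale mult.commute)
    finally show ?thesis .
  qed
  moreover have "poly_less 2 (\<lambda>x. \<Sum>i\<in>UNIV. f (axis i 1) * (x $ i * 1))"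
    using poly_less_coord[OF poly_less_coord_product[OF coord_product.one]]
    by (intro poly_less_combination) (simp add: numeral_2_eq_2)
  ultimately have "poly_less 2 f" by (intro poly_less_eqI[of 2 _ f])
  then show ?case by blast
next
  case (const c)
  have "poly_less 1 (\<lambda>x. c * 1)"
    using poly_less_coord_product[OF coord_product.one] by (intro poly_less_cmult) simp
  then show ?case by auto
next
  case (add f g)
  then obtain m n where "poly_less m f" "poly_less n g" by blast
  then have "poly_less (max m n) (\<lambda>x. f x + g x)"
    by (intro poly_less_add poly_less_mono[of m f "max m n"] poly_less_mono[of n g "max m n"]) simp_all
  then show ?case by blast
next
  case (mult f g)
  then show ?case using poly_less_mult by blast
qed

lemma poly_less_dense:
  assumes "continuous_on S2 f" "\<epsilon> > 0"
  obtains n p where "poly_less n p" "\<And>x. x \<in> S2 \<Longrightarrow> \<bar>f x - p x\<bar> < \<epsilon>"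
proof -
  obtain p where "real_polynomial_function p" "\<And>x. x \<in> S2 \<Longrightarrow> \<bar>f x - p x\<bar> < \<epsilon>"
    using Stone_Weierstrass_real_polynomial_function[OF compact_sphere assms] by blast
  then show ?thesis using that real_polynomial_function_poly_less by blast
qed

lemma integral_const_S2: "(\<integral>x. c \<partial>surf_on S2) = 4 * pi * c"
  using measure_surf_S2 by (simp add: surf_on_def measure_restrict_space)

text \<open>
  Polynomials are uniformly dense by Stone--Weierstrass, and the partial sums of the expansion are
  the best approximations by polynomials of bounded degree.
\<close>
lemma parseval:
  assumes f: "smooth_S2 f"
  shows "(\<lambda>N. \<Sum>i<N\<^sup>2. (ip f (harmonic i))\<^sup>2) \<longlonglongrightarrow> ip f f"
proof (rule LIMSEQ_I)
  fix r :: real assume r: "r > 0"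
  define \<epsilon> where "\<epsilon> = sqrt (r / (8 * pi))"
  have \<epsilon>: "\<epsilon> > 0" "4 * pi * \<epsilon>\<^sup>2 < r" using r by (simp_all add: \<epsilon>_def)
  obtain n p where p: "poly_less n p" "\<And>x. x \<in> S2 \<Longrightarrow> \<bar>f x - p x\<bar> < \<epsilon>"
    using poly_less_dense[OF smooth_S2_continuous[OF f] \<epsilon>(1)] by blast
  show "\<exists>no. \<forall>N\<ge>no. norm ((\<Sum>i<N\<^sup>2. (ip f (harmonic i))\<^sup>2) - ip f f) < r"
  proof (intro exI allI impI)
    fix N assume N: "N \<ge> n"
    have fin: "finite {..<N\<^sup>2}" and fV: "f \<in> {f. smooth_S2 f}" using f by auto
    let ?r = "\<lambda>x. f x - sph.proj {..<N\<^sup>2} harmonic f x"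
    let ?q = "\<lambda>x. f x - (\<Sum>k<N\<^sup>2. ip p (harmonic k) * harmonic k x)"
    have pN: "poly_less N p" using p(1) N by (rule poly_less_mono)
    have q: "smooth_S2 ?q" by (intro smooth_S2_diff f smooth_S2_combination smooth_harmonic)
    have "ip ?r ?r \<le> ip ?q ?q"
      by (rule sph.best_approximation[OF fin orthonormal0_harmonic fV])
    also have "\<dots> \<le> (\<integral>x. \<epsilon>\<^sup>2 \<partial>surf_on S2)"
    proof (rule Bochner_Integration.integral_mono)
      show "integrable (surf_on S2) (\<lambda>x. ?q x * ?q x)" by (rule smooth_S2_integrable_mult[OF q q])
      show "integrable (surf_on S2) (\<lambda>x. \<epsilon>\<^sup>2)" by (intro smooth_S2_integrable) auto
      fix x assume "x \<in> space (surf_on S2)"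
      then have x: "x \<in> S2" by simp
      have "\<bar>?q x\<bar> \<le> \<epsilon>" using p(2)[OF x] poly_less_expansion[OF pN x] by simp
      then have "\<bar>?q x\<bar>\<^sup>2 \<le> \<epsilon>\<^sup>2" by (rule power_mono) simp
      then show "?q x * ?q x \<le> \<epsilon>\<^sup>2" by (simp add: power2_eq_square)
    qed
    also have "\<dots> < r" using \<epsilon>(2) by (simp only: integral_const_S2)
    finally have "ip ?r ?r < r" .
    moreover have "0 \<le> ip ?r ?r" by (rule Bochner_Integration.integral_nonneg) simp
    ultimately show "norm ((\<Sum>i<N\<^sup>2. (ip f (harmonic i))\<^sup>2) - ip f f) < r"
      using sph.pythagoras[OF fin orthonormal0_harmonic fV] by simp
  qed
qed

lemma parseval_bilinear:
  assumes f: "smooth_S2 f" and g: "smooth_S2 g"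
  shows "(\<lambda>N. \<Sum>i<N\<^sup>2. ip f (harmonic i) * ip g (harmonic i)) \<longlonglongrightarrow> ip f g"
proof -
  let ?h = "\<lambda>x. f x + g x"
  have h: "ip ?h (harmonic i) = ip f (harmonic i) + ip g (harmonic i)" for i
    using f g smooth_harmonic by (intro sph.B_add) auto
  have "(\<lambda>N. ((\<Sum>i<N\<^sup>2. (ip ?h (harmonic i))\<^sup>2) - (\<Sum>i<N\<^sup>2. (ip f (harmonic i))\<^sup>2)
      - (\<Sum>i<N\<^sup>2. (ip g (harmonic i))\<^sup>2)) / 2) \<longlonglongrightarrow> (ip ?h ?h - ip f f - ip g g) / 2"
    by (intro tendsto_intros parseval f g smooth_S2_add) simp
  moreover have "ip ?h ?h = ip f f + 2 * ip f g + ip g g"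
    using f g by (intro sph.B_square_add) auto
  ultimately show ?thesis
    by (simp add: h power2_sum sum.distrib sum_distrib_left[symmetric] mult.assoc)
qed

text \<open>
  The degree of the \<open>i\<close>-th harmonic is the integer square root of \<open>i\<close>, by the numbering of the monomials.
\<close>
definition level :: "nat \<Rightarrow> real" where
  "level i = harmonic_eigenvalue (floor_sqrt i)"

lemma laplace_harmonic_level: "x \<in> S2 \<Longrightarrow> laplace_S2 (harmonic i) x = - level i * harmonic i x"
  unfolding level_def by (rule laplace_harmonic) (simp_all add: Suc_floor_sqrt_power2_gt del: power2_nat_le_eq_le)

definition grad_ip :: "(real^3 \<Rightarrow> real) \<Rightarrow> (real^3 \<Rightarrow> real) \<Rightarrow> real" where
  "grad_ip f g = (\<integral>x. (\<Sum>j\<in>UNIV. tang_deriv j f x * tang_deriv j g x) \<partial>surf_on S2)"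

lemma level_nonneg: "0 \<le> level i"
  by (simp add: level_def harmonic_eigenvalue_def)

text \<open>
  In the basis of harmonics the left side is the sum of \<open>(z - l\<^sub>i) / l\<^sub>i\<close> times the
  squares of the coefficients of the gradient; dropping the negative terms leaves a finite sum.
\<close>
lemma spectral_inequality_smooth:
  assumes \<phi>: "smooth_S2 \<phi>" and K: "\<And>n. n \<ge> K \<Longrightarrow> z \<le> harmonic_eigenvalue n"
  shows "z * grad_ip \<phi> \<phi> - ip (laplace_S2 \<phi>) (laplace_S2 \<phi>)
    \<le> (\<Sum>i<K\<^sup>2. max (z - level i) 0 / level i * (grad_ip \<phi> (harmonic i))\<^sup>2)"
proof -
  let ?f = "laplace_S2 \<phi>" and ?c = "\<lambda>i. ip \<phi> (harmonic i)"
  have f: "smooth_S2 ?f" using \<phi> by (rule smooth_S2_laplace)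
  have e: "ip \<phi> (laplace_S2 (harmonic i)) = - level i * ?c i" for i
  proof -
    have "ip \<phi> (laplace_S2 (harmonic i)) = (\<integral>x. - level i * (\<phi> x * harmonic i x) \<partial>surf_on S2)"
      by (intro Bochner_Integration.integral_cong) (auto simp: laplace_harmonic_level)
    then show ?thesis by simp
  qed
  have fi: "ip ?f (harmonic i) = - level i * ?c i" for i
    using laplace_S2_symmetric[OF \<phi> smooth_harmonic, of i] e by simp
  have gi: "grad_ip \<phi> (harmonic i) = level i * ?c i" for i
    unfolding grad_ip_def Green_S2[OF \<phi> smooth_harmonic] e by simp
  let ?t = "\<lambda>i. (z - level i) * level i * (?c i)\<^sup>2"
  let ?s = "\<lambda>i. max (z - level i) 0 / level i * (grad_ip \<phi> (harmonic i))\<^sup>2"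
  have ts: "?t i \<le> ?s i" for i
  proof (cases "level i = 0")
    case False
    then have "?s i = max (z - level i) 0 * (level i * (?c i)\<^sup>2)"
      unfolding gi by (simp add: power2_eq_square)
    moreover have "(z - level i) * (level i * (?c i)\<^sup>2) \<le> max (z - level i) 0 * (level i * (?c i)\<^sup>2)"
      using level_nonneg by (intro mult_right_mono) auto
    ultimately show ?thesis by (simp add: mult.assoc)
  qed simp
  have s0: "0 \<le> ?s i" for i using level_nonneg by simp
  have sz: "?s i = 0" if "K\<^sup>2 \<le> i" for i
    using K[of "floor_sqrt i"] that by (simp add: level_def le_floor_sqrt_iff)
  have "(\<lambda>N. - z * (\<Sum>i<N\<^sup>2. ?c i * ip ?f (harmonic i)) - (\<Sum>i<N\<^sup>2. (ip ?f (harmonic i))\<^sup>2))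
      \<longlonglongrightarrow> - z * ip \<phi> ?f - ip ?f ?f"
    by (intro tendsto_intros parseval parseval_bilinear \<phi> f)
  moreover have "- z * ip \<phi> ?f = z * grad_ip \<phi> \<phi>"
    unfolding grad_ip_def Green_S2[OF \<phi> \<phi>] by simp
  moreover have "- z * (\<Sum>i<N\<^sup>2. ?c i * ip ?f (harmonic i)) - (\<Sum>i<N\<^sup>2. (ip ?f (harmonic i))\<^sup>2) = (\<Sum>i<N\<^sup>2. ?t i)" for N
    unfolding sum_distrib_left sum_subtractf[symmetric] fi
    by (intro sum.cong refl) (simp add: power2_eq_square algebra_simps)
  ultimately have lim: "(\<lambda>N. \<Sum>i<N\<^sup>2. ?t i) \<longlonglongrightarrow> z * grad_ip \<phi> \<phi> - ip ?f ?f"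
    by (simp only:)
  have "(\<Sum>i<N\<^sup>2. ?t i) \<le> (\<Sum>i<K\<^sup>2. ?s i)" for N
  proof -
    have "(\<Sum>i<N\<^sup>2. ?t i) \<le> (\<Sum>i<N\<^sup>2. ?s i)" by (intro sum_mono ts)
    also have "\<dots> \<le> (\<Sum>i<max (N\<^sup>2) (K\<^sup>2). ?s i)" using s0 by (intro sum_mono2) auto
    also have "\<dots> = (\<Sum>i<K\<^sup>2. ?s i)" using sz by (intro sum.mono_neutral_right) auto
    finally show ?thesis .
  qed
  then show ?thesis by (intro LIMSEQ_le_const2[OF lim]) auto
qed

section \<open>The fundamental lemma of the calculus of variations\<close>

lemma poly_div_exp_tendsto_0: "((\<lambda>s. poly p s / exp s) \<longlongrightarrow> (0::real)) at_top"
proof -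
  have "((\<lambda>s. \<Sum>i\<le>degree p. coeff p i * (s ^ i / exp s)) \<longlongrightarrow> (\<Sum>i\<le>degree p. coeff p i * 0)) at_top"
    by (intro tendsto_intros tendsto_power_div_exp_0)
  moreover have "(\<Sum>i\<le>degree p. coeff p i * (s ^ i / exp s)) = poly p s / exp s" for s
    by (simp add: poly_altdef sum_divide_distrib)
  ultimately show ?thesis by simp
qed

text \<open>
  Derivatives of \<open>exp (- 1 / t)\<close>, extended by 0, are of the form \<open>p (1 / t) exp (- 1 / t)\<close>, so all
  polynomials \<open>p\<close> are treated at once.
\<close>
definition flat :: "real poly \<Rightarrow> real \<Rightarrow> real" where
  "flat p t = (if t > 0 then poly p (inverse t) * exp (- inverse t) else 0)"

lemma flat_DERIV:
  "(flat p has_real_derivative flat ([:0, 0, 1:] * (p - pderiv p)) t) (at t)"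
proof -
  let ?q = "[:0, 0, 1:] * (p - pderiv p)"
  consider "t > 0" | "t < 0" | "t = 0" by linarith
  then show ?thesis
  proof cases
    case 1
    have "((\<lambda>t. poly p (inverse t) * exp (- inverse t)) has_real_derivative flat ?q t) (at t)"
      using 1 by (auto intro!: derivative_eq_intros simp: flat_def field_simps power2_eq_square)
    then show ?thesis
      by (rule has_field_derivative_transform_within_open[of _ _ _ "{0<..}"]) (use 1 in \<open>auto simp: flat_def\<close>)
  next
    case 2
    have "((\<lambda>t. 0) has_real_derivative flat ?q t) (at t)"
      using 2 by (simp add: flat_def)
    then show ?thesis
      by (rule has_field_derivative_transform_within_open[of _ _ _ "{..<0}"]) (use 2 in \<open>auto simp: flat_def\<close>)
  next
    case 3
    have "((\<lambda>t. poly ([:0, 1:] * p) (inverse t) / exp (inverse t)) \<longlongrightarrow> 0) (at_right 0)"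
      by (rule filterlim_compose[OF poly_div_exp_tendsto_0 filterlim_inverse_at_top_right])
    then have "((\<lambda>t. flat p t / t) \<longlongrightarrow> 0) (at_right 0)"
      by (rule Lim_transform_eventually)
         (auto simp: eventually_at_right_less flat_def exp_minus field_simps intro!: eventually_at_rightI[of 0 1])
    moreover have "((\<lambda>t. flat p t / t) \<longlongrightarrow> 0) (at_left 0)"
      by (rule Lim_transform_eventually[OF tendsto_const])
         (auto simp: flat_def intro!: eventually_at_leftI[of "-1"])
    ultimately have "((\<lambda>t. flat p t / t) \<longlongrightarrow> 0) (at 0)"
      by (simp add: filterlim_split_at)
    then show ?thesis
      by (simp add: 3 has_field_derivative_iff flat_def)
  qed
qed

lemma test_functions_iff:
  "\<phi> \<in> test_functions \<Omega> \<longleftrightarrow> smooth_S2 \<phi> \<and> closure {x \<in> S2. \<phi> x \<noteq> 0} \<subseteq> \<Omega>"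
  by (simp add: test_functions_def smooth_S2_def)

text \<open>
  A function of the height \<open>x \<bullet> x0\<close> that is supported in a small cap around \<open>x0\<close>.
\<close>
lemma test_functions_bump:
  assumes \<Omega>: "openin (top_of_set S2) \<Omega>" and x0: "x0 \<in> \<Omega>"
  obtains \<psi> V where "\<psi> \<in> test_functions \<Omega>" "open V" "x0 \<in> V" "\<And>x. x \<in> S2 \<Longrightarrow> x \<in> V \<Longrightarrow> \<psi> x \<noteq> 0"
proof -
  have x0S: "x0 \<in> S2" using \<Omega> x0 openin_imp_subset by blast
  obtain \<delta> where \<delta>: "\<delta> > 0" "\<And>x. x \<in> S2 \<Longrightarrow> dist x x0 < \<delta> \<Longrightarrow> x \<in> \<Omega>"
    using \<Omega> x0 unfolding openin_euclidean_subtopology_iff by blast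
  \<comment> \<open>on the sphere, height at least \<open>c\<close> means distance at most \<open>\<delta> / 2\<close> from \<open>x0\<close>\<close>
  define c where "c = 1 - \<delta>\<^sup>2 / 8"
  define \<psi> where "\<psi> x = flat 1 (x \<bullet> x0 - c)" for x
  have "smooth_S2 (\<lambda>x. (\<Sum>i\<in>UNIV. x0 $ i * x $ i) - c)"
    by (intro smooth_S2_diff smooth_S2_sum smooth_S2_cmult smooth_S2_component smooth_S2_const)
  moreover have "(\<Sum>i\<in>UNIV. x0 $ i * x $ i) = x \<bullet> x0" for x
    by (simp add: inner_vec_def mult.commute)
  ultimately have lin: "Ck_on k (- {0}) (radial_ext (\<lambda>x. x \<bullet> x0 - c))" for k
    by (simp add: smooth_S2_def)
  have "Ck_on k (- {0}) (\<lambda>x. flat 1 (radial_ext (\<lambda>x. x \<bullet> x0 - c) x))" for k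
  proof (rule Ck_on_compose[OF open_punctured _ lin, where T = UNIV and H = "range flat" and h = "flat 1"])
    show "\<exists>h'\<in>range flat. \<forall>t\<in>UNIV. (h has_real_derivative h' t) (at t)" if "h \<in> range flat" for h
      using that flat_DERIV by blast
  qed auto
  then have smooth: "smooth_S2 \<psi>"
    unfolding smooth_S2_def by (simp add: radial_ext_eq \<psi>_def)
  have "closure {x \<in> S2. \<psi> x \<noteq> 0} \<subseteq> S2 \<inter> {x. x \<bullet> x0 \<ge> c}"
  proof (rule closure_minimal)
    show "closed (S2 \<inter> {x. x \<bullet> x0 \<ge> c})"
      by (intro closed_Int closed_Collect_le continuous_intros) auto
  qed (auto simp: \<psi>_def flat_def split: if_splits)
  also have "\<dots> \<subseteq> \<Omega>"
  proof
    fix x assume x: "x \<in> S2 \<inter> {x. x \<bullet> x0 \<ge> c}"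
    have "(dist x x0)\<^sup>2 = 2 - 2 * (x \<bullet> x0)"
      using x x0S by (simp add: dist_norm power2_norm_eq_inner inner_diff_left inner_diff_right inner_commute norm_eq_1)
    also have "\<dots> \<le> \<delta>\<^sup>2 / 4" using x by (simp add: c_def)
    also have "\<dots> < \<delta>\<^sup>2" using \<delta>(1) by simp
    finally have "dist x x0 < \<delta>" using \<delta>(1) by (intro power2_less_imp_less[of _ \<delta>]) auto
    then show "x \<in> \<Omega>" using \<delta>(2) x by blast
  qed
  finally have "\<psi> \<in> test_functions \<Omega>" using smooth by (simp add: test_functions_iff)
  moreover have "open {x. x \<bullet> x0 > c}"
    by (intro open_Collect_less continuous_intros)
  moreover have "x0 \<in> {x. x \<bullet> x0 > c}"
    using x0S \<delta>(1) by (simp add: c_def norm_eq_1)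
  moreover have "\<psi> x \<noteq> 0" if "x \<in> {x. x \<bullet> x0 > c}" for x
    using that by (simp add: \<psi>_def flat_def)
  ultimately show ?thesis using that by blast
qed

text \<open>
  The positive and the negative part are densities of two measures that agree on the closed sets, which
  form a generator of the Borel sets stable under intersection.
\<close>
lemma AE_zero_if_integral_closed_zero:
  fixes w :: "'a::topological_space \<Rightarrow> real"
  assumes sets: "sets M = sets borel" and w: "integrable M w"
    and z: "\<And>C. closed C \<Longrightarrow> (\<integral>x. indicator C x * w x \<partial>M) = 0"
  shows "AE x in M. w x = 0"
proof -
  let ?f = "\<lambda>x. ennreal (w x)" and ?g = "\<lambda>x. ennreal (- w x)"
  have [measurable]: "w \<in> borel_measurable M" using w by auto
  have spM: "space M = UNIV" using sets_eq_imp_space_eq[OF sets] by simp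
  have fin: "integral\<^sup>N M ?f \<noteq> \<infinity>" "integral\<^sup>N M ?g \<noteq> \<infinity>"
    using w by (auto simp: real_integrable_def)
  have eq: "emeasure (density M ?f) C = emeasure (density M ?g) C" if C: "closed C" for C
  proof -
    have CM [measurable]: "C \<in> sets M" using C sets by simp
    have int: "integrable M (\<lambda>x. indicator C x * w x)"
      using integrable_real_mult_indicator[OF CM w] by (simp add: mult.commute)
    let ?P = "\<integral>\<^sup>+x. ennreal (indicator C x * w x) \<partial>M"
    let ?N = "\<integral>\<^sup>+x. ennreal (- (indicator C x * w x)) \<partial>M"
    have "enn2real ?P = enn2real ?N"
      using z[OF C] real_lebesgue_integral_def[OF int] by simp
    moreover have "?P < top" "?N < top"
      using int by (auto simp: real_integrable_def less_top)
    ultimately have "?P = ?N" by (metis ennreal_enn2real)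
    moreover have "ennreal (indicator C x * w x) = ?f x * indicator C x" "ennreal (- (indicator C x * w x)) = ?g x * indicator C x" for x
      by (auto simp: indicator_def)
    ultimately show ?thesis by (simp add: emeasure_density)
  qed
  have "density M ?f = density M ?g"
  proof (rule measure_eqI_generator_eq[where E = "{C. closed C}" and \<Omega> = UNIV and A = "\<lambda>_. UNIV"])
    show "Int_stable {C. closed (C :: 'a set)}" by (auto simp: Int_stable_def)
    have "sets borel = sigma_sets UNIV {C. closed (C :: 'a set)}"
      by (subst borel_eq_closed) simp
    then show "sets (density M ?f) = sigma_sets UNIV {C. closed C}" "sets (density M ?g) = sigma_sets UNIV {C. closed C}"
      using sets by simp_all
    show "emeasure (density M ?f) UNIV \<noteq> \<infinity>" for i :: nat
      using fin(1) sets by (subst emeasure_density) (auto simp: spM[symmetric] cong: nn_integral_cong)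
  qed (use eq in auto)
  then have "AE x in M. ?f x = ?g x"
    using fin by (subst (asm) finite_density_unique) auto
  then show ?thesis
  proof eventually_elim
    fix x assume "ennreal (w x) = ennreal (- w x)"
    then show "w x = 0"
      using ennreal_neg[of "w x"] ennreal_neg[of "- w x"] ennreal_eq_0_iff[of "w x"] ennreal_eq_0_iff[of "- w x"]
      by (cases "w x \<ge> 0") auto
  qed
qed


lemma integrable_mult_continuous:
  fixes w g :: "real^3 \<Rightarrow> real"
  assumes w: "integrable (surf_on \<Omega>) w" and g: "continuous_on S2 g" and \<Omega>: "\<Omega> \<in> sets borel" "\<Omega> \<subseteq> S2"
  shows "integrable (surf_on \<Omega>) (\<lambda>x. w x * g x)"
proof -
  obtain B where B: "\<And>x. x \<in> S2 \<Longrightarrow> \<bar>g x\<bar> \<le> B" using continuous_S2_bounded[OF g] by blast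
  show ?thesis
  proof (rule Bochner_Integration.integrable_bound)
    show "integrable (surf_on \<Omega>) (\<lambda>x. B * w x)" using w by simp
    show "(\<lambda>x. w x * g x) \<in> borel_measurable (surf_on \<Omega>)"
      using w continuous_measurable_surf_on[OF continuous_on_subset[OF g \<Omega>(2)] \<Omega>(1)] by simp
    show "AE x in surf_on \<Omega>. norm (w x * g x) \<le> norm (B * w x)"
    proof (rule AE_I2)
      fix x assume "x \<in> space (surf_on \<Omega>)"
      then have "x \<in> S2" using \<Omega>(2) by auto
      from B[OF this] have "\<bar>g x\<bar> \<le> \<bar>B\<bar>" by simp
      then have "\<bar>g x\<bar> * \<bar>w x\<bar> \<le> \<bar>B\<bar> * \<bar>w x\<bar>" by (rule mult_right_mono) simp
      then show "norm (w x * g x) \<le> norm (B * w x)" by (simp add: abs_mult mult.commute)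
    qed
  qed
qed

text \<open>
  Uniform approximation passes from polynomials to continuous functions, and the functions
  \<open>max 0 (1 - n dist (x, C))\<close> from these to indicators of closed sets \<open>C\<close>.
\<close>
lemma AE_zero_if_orthogonal_to_polynomials:
  assumes w: "integrable (surf_on S2) w"
    and z: "\<And>n p. poly_less n p \<Longrightarrow> (\<integral>x. w x * p x \<partial>surf_on S2) = 0"
  shows "AE x in surf_on S2. w x = 0"
proof -
  have wm: "w \<in> borel_measurable (surf_on S2)" using w by auto
  have wb: "integrable (surf_on S2) (\<lambda>x. w x * g x)" if g: "continuous_on S2 g" for g
    using w g by (rule integrable_mult_continuous) auto
  have cont: "(\<integral>x. w x * g x \<partial>surf_on S2) = 0" if g: "continuous_on S2 g" for g
  proof -
    let ?W = "\<integral>x. \<bar>w x\<bar> \<partial>surf_on S2"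
    have W: "0 \<le> ?W" by (rule Bochner_Integration.integral_nonneg) simp
    have "\<bar>\<integral>x. w x * g x \<partial>surf_on S2\<bar> \<le> 0 + e" if e: "e > 0" for e
    proof -
      define \<epsilon> where "\<epsilon> = e / (?W + 1)"
      have W1: "?W + 1 > 0" using W by linarith
      then have \<epsilon>: "\<epsilon> > 0" unfolding \<epsilon>_def by (rule divide_pos_pos[OF e])
      have "\<epsilon> * ?W \<le> \<epsilon> * (?W + 1)" using \<epsilon> by (intro mult_left_mono) simp_all
      also have "\<dots> = e" unfolding \<epsilon>_def using W1 by simp
      finally have \<epsilon>W: "\<epsilon> * ?W \<le> e" .
      obtain n p where p: "poly_less n p" "\<And>x. x \<in> S2 \<Longrightarrow> \<bar>g x - p x\<bar> < \<epsilon>"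
        using poly_less_dense[OF g \<epsilon>] by blast
      have pc: "continuous_on S2 p" using p(1) by (intro smooth_S2_continuous poly_less_smooth)
      have i: "integrable (surf_on S2) (\<lambda>x. w x * (g x - p x))"
        using g pc by (intro wb continuous_intros)
      have "(\<integral>x. w x * g x \<partial>surf_on S2) = (\<integral>x. w x * (g x - p x) \<partial>surf_on S2)"
        using z[OF p(1)] wb[OF g] wb[OF pc] by (simp add: right_diff_distrib)
      also have "\<bar>\<dots>\<bar> \<le> (\<integral>x. \<bar>w x * (g x - p x)\<bar> \<partial>surf_on S2)"
        by (rule integral_abs_bound)
      also have "\<dots> \<le> (\<integral>x. \<epsilon> * \<bar>w x\<bar> \<partial>surf_on S2)"
      proof (rule Bochner_Integration.integral_mono)
        fix x assume "x \<in> space (surf_on S2)"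
        then have "\<bar>g x - p x\<bar> \<le> \<epsilon>" using p(2)[of x] by simp
        then have "\<bar>g x - p x\<bar> * \<bar>w x\<bar> \<le> \<epsilon> * \<bar>w x\<bar>" by (rule mult_right_mono) simp
        then show "\<bar>w x * (g x - p x)\<bar> \<le> \<epsilon> * \<bar>w x\<bar>" by (simp add: abs_mult mult.commute)
      qed (use i w in auto)
      also have "\<dots> \<le> e" using \<epsilon>W by simp
      finally show ?thesis by simp
    qed
    then have "\<bar>\<integral>x. w x * g x \<partial>surf_on S2\<bar> \<le> 0" by (rule field_le_epsilon)
    then show ?thesis by simp
  qed
  let ?w = "\<lambda>x. indicator S2 x * w x"
  have w': "integrable surf ?w"
    using w unfolding surf_on_def by (subst (asm) integrable_restrict_space) auto
  have "AE x in surf. ?w x = 0"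
  proof (rule AE_zero_if_integral_closed_zero[OF sets_surf w'])
    fix C :: "(real^3) set" assume C: "closed C"
    have eq: "(\<integral>x. indicator C x * ?w x \<partial>surf) = (\<integral>x. w x * indicator C x \<partial>surf_on S2)"
      unfolding surf_on_def by (subst integral_restrict_space) (auto simp: ac_simps)
    show "(\<integral>x. indicator C x * ?w x \<partial>surf) = 0"
    proof (cases "C = {}")
      case False
      define g where "g n x = max 0 (1 - real n * infdist x C)" for n and x :: "real^3"
      have gc: "continuous_on S2 (g n)" for n
        unfolding g_def by (intro continuous_intros)
      have "(\<lambda>n. \<integral>x. w x * g n x \<partial>surf_on S2) \<longlonglongrightarrow> (\<integral>x. w x * indicator C x \<partial>surf_on S2)"
      proof (rule integral_dominated_convergence[where w = "\<lambda>x. \<bar>w x\<bar>"])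
        have "C \<in> sets borel" using C by simp
        then have "S2 \<inter> C \<in> sets (surf_on S2)"
          unfolding surf_on_def sets_restrict_space by auto
        then have "(indicator (S2 \<inter> C) :: _ \<Rightarrow> real) \<in> borel_measurable (surf_on S2)" by simp
        then have "(\<lambda>x. w x * indicator (S2 \<inter> C) x) \<in> borel_measurable (surf_on S2)"
          using wm by simp
        then show "(\<lambda>x. w x * indicator C x) \<in> borel_measurable (surf_on S2)"
          by (rule measurable_cong[THEN iffD1, rotated]) (auto simp: indicator_def)
        show "(\<lambda>x. w x * g n x) \<in> borel_measurable (surf_on S2)" for n
          using wm continuous_measurable_surf_on[OF gc[of n]] by simp
        show "integrable (surf_on S2) (\<lambda>x. \<bar>w x\<bar>)" using w by simp
        show "AE x in surf_on S2. (\<lambda>n. w x * g n x) \<longlonglongrightarrow> w x * indicator C x"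
        proof (intro AE_I2 tendsto_mult tendsto_const)
          fix x :: "real^3"
          show "(\<lambda>n. g n x) \<longlonglongrightarrow> indicator C x"
          proof (cases "x \<in> C")
            case True
            then show ?thesis by (simp add: g_def)
          next
            case x: False
            then have d: "infdist x C > 0"
              using C False in_closed_iff_infdist_zero[of C x] infdist_nonneg[of x C] by force
            obtain N where N: "1 / infdist x C < real N" using reals_Archimedean2 by blast
            have "g n x = 0" if "n \<ge> N" for n
            proof -
              have "1 / infdist x C < real n" using N that by simp
              then have "1 < real n * infdist x C" using d by (simp add: field_simps)
              then show ?thesis by (simp add: g_def)
            qed
            then have "\<forall>\<^sub>F n in sequentially. g n x = 0" using eventually_sequentially by blast
            then show ?thesis using x by (simp add: tendsto_eventually)
          qed
        qed
        show "AE x in surf_on S2. norm (w x * g n x) \<le> \<bar>w x\<bar>" for n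
        proof (rule AE_I2)
          fix x :: "real^3"
          have "\<bar>g n x\<bar> \<le> 1" using infdist_nonneg[of x C] by (simp add: g_def)
          then show "norm (w x * g n x) \<le> \<bar>w x\<bar>"
            by (simp add: abs_mult mult_left_le)
        qed
      qed
      then show ?thesis unfolding eq by (simp add: cont[OF gc] LIMSEQ_const_iff)
    qed simp
  qed
  then show ?thesis by (subst AE_surf_on) (auto elim!: eventually_mono)
qed

locale sphere_domain =
  fixes \<Omega> :: "(real^3) set"
  assumes openin: "openin (top_of_set S2) \<Omega>"
begin

lemma subset_S2: "\<Omega> \<subseteq> S2"
  using openin by (rule openin_imp_subset)

lemma borel: "\<Omega> \<in> sets borel"
proof -
  obtain T where T: "open T" "\<Omega> = S2 \<inter> T" using openin unfolding openin_open by blast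
  then show ?thesis by auto
qed

definition zero_ext :: "(real^3 \<Rightarrow> real) \<Rightarrow> real^3 \<Rightarrow> real" where
  "zero_ext f x = indicator \<Omega> x * f x"

lemma integral_zero_ext: "integral\<^sup>L (surf_on S2) (zero_ext f) = integral\<^sup>L (surf_on \<Omega>) f"
  unfolding surf_on_def zero_ext_def using borel subset_S2
  by (subst (1 2) integral_restrict_space) (auto intro!: Bochner_Integration.integral_cong simp: indicator_def)

lemma integrable_zero_ext: "integrable (surf_on S2) (zero_ext f) \<longleftrightarrow> integrable (surf_on \<Omega>) f"
  unfolding surf_on_def zero_ext_def using borel subset_S2
  by (subst (1 2) integrable_restrict_space) (auto intro!: Bochner_Integration.integrable_cong simp: indicator_def)

text \<open>
  Multiplying one bump by all polynomials already gives enough test functions: by density of the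
  polynomials the product of \<open>v\<close> with the bump vanishes, hence so does \<open>v\<close> near the centre of the bump.
\<close>
lemma fundamental_lemma:
  assumes v: "integrable (surf_on \<Omega>) v"
    and z: "\<And>\<phi>. \<phi> \<in> test_functions \<Omega> \<Longrightarrow> (\<integral>x. v x * \<phi> x \<partial>surf_on \<Omega>) = 0"
  shows "AE x in surf_on \<Omega>. v x = 0"
proof -
  have loc: "\<exists>V. open V \<and> x0 \<in> V \<and> (AE x in surf_on \<Omega>. x \<in> V \<longrightarrow> v x = 0)" if x0: "x0 \<in> \<Omega>" for x0
  proof -
    obtain \<psi> V where \<psi>: "\<psi> \<in> test_functions \<Omega>" and V: "open V" "x0 \<in> V" "\<And>x. x \<in> S2 \<Longrightarrow> x \<in> V \<Longrightarrow> \<psi> x \<noteq> 0"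
      using test_functions_bump[OF openin x0] by blast
    have s: "smooth_S2 \<psi>" using \<psi> by (simp add: test_functions_iff)
    have "integrable (surf_on \<Omega>) (\<lambda>x. v x * \<psi> x)"
      using v smooth_S2_continuous[OF s] borel subset_S2 by (rule integrable_mult_continuous)
    then have "integrable (surf_on S2) (zero_ext (\<lambda>x. v x * \<psi> x))"
      by (simp add: integrable_zero_ext)
    then have "AE x in surf_on S2. zero_ext (\<lambda>x. v x * \<psi> x) x = 0"
    proof (rule AE_zero_if_orthogonal_to_polynomials)
      fix n p assume p: "poly_less n p"
      have "{x \<in> S2. \<psi> x * p x \<noteq> 0} \<subseteq> {x \<in> S2. \<psi> x \<noteq> 0}" by auto
      then have "closure {x \<in> S2. \<psi> x * p x \<noteq> 0} \<subseteq> \<Omega>"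
        using \<psi> closure_mono unfolding test_functions_iff by blast
      then have "(\<lambda>x. \<psi> x * p x) \<in> test_functions \<Omega>"
        using s poly_less_smooth[OF p] by (simp add: test_functions_iff smooth_S2_mult)
      then have "integral\<^sup>L (surf_on S2) (zero_ext (\<lambda>x. v x * (\<psi> x * p x))) = 0"
        using z by (simp add: integral_zero_ext)
      then show "(\<integral>x. zero_ext (\<lambda>x. v x * \<psi> x) x * p x \<partial>surf_on S2) = 0"
        by (simp add: zero_ext_def[abs_def] mult.assoc)
    qed
    then have "AE x in surf. x \<in> S2 \<longrightarrow> zero_ext (\<lambda>x. v x * \<psi> x) x = 0"
      by (simp add: AE_surf_on)
    then have "AE x in surf. x \<in> \<Omega> \<longrightarrow> x \<in> V \<longrightarrow> v x = 0"
    proof eventually_elim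
      fix x assume x: "x \<in> S2 \<longrightarrow> zero_ext (\<lambda>x. v x * \<psi> x) x = 0"
      show "x \<in> \<Omega> \<longrightarrow> x \<in> V \<longrightarrow> v x = 0"
      proof (intro impI)
        assume xV: "x \<in> \<Omega>" "x \<in> V"
        then have "x \<in> S2" using subset_S2 by blast
        then show "v x = 0" using x xV V(3) by (simp add: zero_ext_def)
      qed
    qed
    then have "AE x in surf_on \<Omega>. x \<in> V \<longrightarrow> v x = 0"
      using AE_surf_on[OF borel] by simp
    then show ?thesis using V by blast
  qed
  then obtain V where V: "\<And>x0. x0 \<in> \<Omega> \<Longrightarrow> open (V x0) \<and> x0 \<in> V x0 \<and> (AE x in surf_on \<Omega>. x \<in> V x0 \<longrightarrow> v x = 0)"
    by metis
  obtain F where F: "F \<subseteq> V ` \<Omega>" "countable F" "\<Union>F = \<Union>(V ` \<Omega>)"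
    using Lindelof[of "V ` \<Omega>"] V by blast
  have "AE x in surf_on \<Omega>. \<forall>U\<in>F. x \<in> U \<longrightarrow> v x = 0"
    using F V by (subst AE_ball_countable) auto
  moreover have "AE x in surf_on \<Omega>. x \<in> \<Omega>" by (rule AE_I2) simp
  ultimately show ?thesis
  proof eventually_elim
    fix x assume *: "\<forall>U\<in>F. x \<in> U \<longrightarrow> v x = 0" "x \<in> \<Omega>"
    then have "x \<in> \<Union>(V ` \<Omega>)" using V by blast
    then show "v x = 0" using F(3) * by blast
  qed
qed

end

section \<open>Weak derivatives and Sobolev spaces\<close>

lemma tang_deriv_zero_off_support:
  assumes x: "x \<in> S2" "x \<notin> closure {x \<in> S2. \<phi> x \<noteq> 0}"
  shows "tang_deriv i \<phi> x = 0"
proof -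
  let ?K = "closure {x \<in> S2. \<phi> x \<noteq> 0}"
  have "continuous_on (- {0}) (sgn :: real^3 \<Rightarrow> real^3)"
    unfolding sgn_div_norm[abs_def] by (intro continuous_intros) auto
  then have op: "open (- {0} \<inter> sgn -` (- ?K))"
    by (intro continuous_open_preimage) auto
  have mem: "x \<in> - {0} \<inter> sgn -` (- ?K)" using x S2_nonzero by simp
  have "partial_deriv i (radial_ext \<phi>) x = partial_deriv i (\<lambda>x. 0) x"
  proof (rule partial_deriv_cong[OF op mem])
    fix y assume "y \<in> - {0} \<inter> sgn -` (- ?K)"
    then have "sgn y \<notin> {x \<in> S2. \<phi> x \<noteq> 0}" "sgn y \<in> S2"
      using closure_subset[of "{x \<in> S2. \<phi> x \<noteq> 0}"] sgn_in_S2[of y] by blast+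
    then show "radial_ext \<phi> y = 0" by (simp add: radial_ext_def)
  qed
  then show ?thesis by (simp add: tang_deriv_def partial_deriv_const)
qed

lemma tang_deriv_test_functions:
  assumes "\<phi> \<in> test_functions \<Omega>"
  shows "tang_deriv i \<phi> \<in> test_functions \<Omega>"
proof -
  have "{x \<in> S2. tang_deriv i \<phi> x \<noteq> 0} \<subseteq> closure {x \<in> S2. \<phi> x \<noteq> 0}"
    using tang_deriv_zero_off_support by blast
  then have "closure {x \<in> S2. tang_deriv i \<phi> x \<noteq> 0} \<subseteq> closure {x \<in> S2. \<phi> x \<noteq> 0}"
    by (rule closure_minimal) simp
  with assms show ?thesis by (auto simp: test_functions_iff intro: smooth_S2_tang_deriv)
qed

lemma test_functions_off:
  assumes "\<phi> \<in> test_functions \<Omega>" "x \<in> S2" "x \<notin> \<Omega>"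
  shows "\<phi> x = 0"
  using assms closure_subset[of "{x \<in> S2. \<phi> x \<noteq> 0}"] unfolding test_functions_iff by blast

lemma test_functions_combination:
  assumes "\<phi> \<in> test_functions \<Omega>" "\<psi> \<in> test_functions \<Omega>"
  shows "(\<lambda>x. a * \<phi> x + b * \<psi> x) \<in> test_functions \<Omega>"
proof -
  have "closure {x \<in> S2. a * \<phi> x + b * \<psi> x \<noteq> 0} \<subseteq> closure ({x \<in> S2. \<phi> x \<noteq> 0} \<union> {x \<in> S2. \<psi> x \<noteq> 0})"
    by (rule closure_mono) auto
  with assms show ?thesis
    by (auto simp: test_functions_iff closure_Un intro!: smooth_S2_add smooth_S2_cmult)
qed

context sphere_domain
begin

lemma L2_iff: "u \<in> L2 \<Omega> \<longleftrightarrow> u \<in> borel_measurable (surf_on \<Omega>) \<and> integrable (surf_on \<Omega>) (\<lambda>x. (u x)\<^sup>2)"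
  unfolding L2_def by (simp add: set_borel_measurable_surf_on set_integrable_surf_on borel)

lemma L2_mult_integrable:
  assumes "u \<in> L2 \<Omega>" "v \<in> L2 \<Omega>"
  shows "integrable (surf_on \<Omega>) (\<lambda>x. u x * v x)"
proof (rule Bochner_Integration.integrable_bound)
  show "integrable (surf_on \<Omega>) (\<lambda>x. (u x)\<^sup>2 + (v x)\<^sup>2)" using assms by (simp add: L2_iff)
  show "(\<lambda>x. u x * v x) \<in> borel_measurable (surf_on \<Omega>)" using assms by (auto simp: L2_iff)
  show "AE x in surf_on \<Omega>. norm (u x * v x) \<le> norm ((u x)\<^sup>2 + (v x)\<^sup>2)"
  proof (rule AE_I2)
    fix x
    have "2 * \<bar>u x\<bar> * \<bar>v x\<bar> \<le> (u x)\<^sup>2 + (v x)\<^sup>2"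
      using sum_squares_bound[of "\<bar>u x\<bar>" "\<bar>v x\<bar>"] by simp
    moreover have "0 \<le> \<bar>u x\<bar> * \<bar>v x\<bar>" by simp
    ultimately have "\<bar>u x\<bar> * \<bar>v x\<bar> \<le> (u x)\<^sup>2 + (v x)\<^sup>2" by linarith
    then show "norm (u x * v x) \<le> norm ((u x)\<^sup>2 + (v x)\<^sup>2)" by (simp add: abs_mult)
  qed
qed

lemma L2_add: "u \<in> L2 \<Omega> \<Longrightarrow> v \<in> L2 \<Omega> \<Longrightarrow> (\<lambda>x. u x + v x) \<in> L2 \<Omega>"
  using L2_mult_integrable[of u v] by (auto simp: L2_iff power2_sum mult.assoc)

lemma L2_cmult: "u \<in> L2 \<Omega> \<Longrightarrow> (\<lambda>x. c * u x) \<in> L2 \<Omega>"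
  by (auto simp: L2_iff power_mult_distrib)

definition ipL2 :: "(real^3 \<Rightarrow> real) \<Rightarrow> (real^3 \<Rightarrow> real) \<Rightarrow> real" where
  "ipL2 u v = (\<integral>x. u x * v x \<partial>surf_on \<Omega>)"

sublocale l2: semi_inner "L2 \<Omega>" ipL2
proof
  show "ipL2 (\<lambda>x. f x + g x) h = ipL2 f h + ipL2 g h" if "f \<in> L2 \<Omega>" "g \<in> L2 \<Omega>" "h \<in> L2 \<Omega>" for f g h
    using that by (simp add: ipL2_def distrib_right L2_mult_integrable)
  show "ipL2 (\<lambda>x. c * f x) h = c * ipL2 f h" for f h c
    by (simp add: ipL2_def mult.assoc)
  show "ipL2 f g = ipL2 g f" for f g
    by (simp add: ipL2_def mult.commute)
  show "0 \<le> ipL2 f f" for f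
    unfolding ipL2_def by (rule Bochner_Integration.integral_nonneg) simp
  show "(\<lambda>x. 0) \<in> L2 \<Omega>" by (simp add: L2_iff)
qed (simp_all add: L2_add L2_cmult)

lemma ipL2_AE_cong:
  assumes "u \<in> L2 \<Omega>" "v \<in> L2 \<Omega>" "u' \<in> L2 \<Omega>" "v' \<in> L2 \<Omega>"
    and "AE x in surf_on \<Omega>. u x = u' x" "AE x in surf_on \<Omega>. v x = v' x"
  shows "ipL2 u v = ipL2 u' v'"
  unfolding ipL2_def
proof (rule Bochner_Integration.integral_cong_AE)
  show "AE x in surf_on \<Omega>. u x * v x = u' x * v' x"
    using assms(5,6) by eventually_elim simp
qed (use assms in \<open>auto simp: L2_iff\<close>)

lemma continuous_L2:
  assumes f: "continuous_on S2 f"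
  shows "f \<in> L2 \<Omega>"
  unfolding L2_iff
proof
  show "f \<in> borel_measurable (surf_on \<Omega>)"
    using continuous_on_subset[OF f subset_S2] borel by (rule continuous_measurable_surf_on)
  show "integrable (surf_on \<Omega>) (\<lambda>x. (f x)\<^sup>2)"
    by (intro integrable_surf_on_continuous continuous_intros f borel subset_S2)
qed

lemma smooth_L2: "smooth_S2 f \<Longrightarrow> f \<in> L2 \<Omega>"
  by (intro continuous_L2 smooth_S2_continuous)

lemma test_smooth: "\<phi> \<in> test_functions \<Omega> \<Longrightarrow> smooth_S2 \<phi>"
  by (simp add: test_functions_iff)

lemma L2_integrable: "u \<in> L2 \<Omega> \<Longrightarrow> integrable (surf_on \<Omega>) u"
  using L2_mult_integrable[of u "\<lambda>x. 1"] smooth_L2[of "\<lambda>x. 1"] by simp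

lemma weak_deriv_iff:
  "weak_deriv \<Omega> i u v \<longleftrightarrow> (\<forall>\<phi>\<in>test_functions \<Omega>.
     ipL2 u (tang_deriv i \<phi>) = - ipL2 v \<phi> + ipL2 u (\<lambda>x. 2 * \<phi> x * x $ i))"
  unfolding weak_deriv_def ipL2_def by (simp add: set_lebesgue_integral_surf_on borel ac_simps)

lemma weak_deriv_combination:
  assumes "u \<in> L2 \<Omega>" "v \<in> L2 \<Omega>" "u' \<in> L2 \<Omega>" "v' \<in> L2 \<Omega>"
    and "weak_deriv \<Omega> i u u'" "weak_deriv \<Omega> i v v'"
  shows "weak_deriv \<Omega> i (\<lambda>x. a * u x + b * v x) (\<lambda>x. a * u' x + b * v' x)"
  unfolding weak_deriv_iff
proof
  fix \<phi> assume \<phi>: "\<phi> \<in> test_functions \<Omega>"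
  then have s: "smooth_S2 \<phi>" by (rule test_smooth)
  have L: "\<phi> \<in> L2 \<Omega>" "tang_deriv i \<phi> \<in> L2 \<Omega>" "(\<lambda>x. 2 * \<phi> x * x $ i) \<in> L2 \<Omega>"
    using s by (auto intro!: smooth_L2 smooth_S2_tang_deriv smooth_S2_mult smooth_S2_component smooth_S2_cmult)
  have lin: "ipL2 (\<lambda>x. a * f x + b * g x) h = a * ipL2 f h + b * ipL2 g h"
    if "f \<in> L2 \<Omega>" "g \<in> L2 \<Omega>" "h \<in> L2 \<Omega>" for f g h
    using that by (simp add: l2.B_add l2.B_cmult L2_cmult)
  have e: "ipL2 u (tang_deriv i \<phi>) = - ipL2 u' \<phi> + ipL2 u (\<lambda>x. 2 * \<phi> x * x $ i)"
    "ipL2 v (tang_deriv i \<phi>) = - ipL2 v' \<phi> + ipL2 v (\<lambda>x. 2 * \<phi> x * x $ i)"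
    using assms(5,6) \<phi> unfolding weak_deriv_iff by blast+
  show "ipL2 (\<lambda>x. a * u x + b * v x) (tang_deriv i \<phi>)
    = - ipL2 (\<lambda>x. a * u' x + b * v' x) \<phi> + ipL2 (\<lambda>x. a * u x + b * v x) (\<lambda>x. 2 * \<phi> x * x $ i)"
    unfolding lin[OF assms(1,2) L(2)] lin[OF assms(3,4) L(1)] lin[OF assms(1,2) L(3)] e
    by (simp only: distrib_left mult_minus_right minus_add_distrib ac_simps)
qed

lemma weak_deriv_AE_cong:
  assumes "u \<in> L2 \<Omega>" "u' \<in> L2 \<Omega>" "AE x in surf_on \<Omega>. u x = u' x" "weak_deriv \<Omega> i u v"
  shows "weak_deriv \<Omega> i u' v"
  unfolding weak_deriv_iff
proof
  fix \<phi> assume \<phi>: "\<phi> \<in> test_functions \<Omega>"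
  then have s: "smooth_S2 \<phi>" by (rule test_smooth)
  have L: "tang_deriv i \<phi> \<in> L2 \<Omega>" "(\<lambda>x. 2 * \<phi> x * x $ i) \<in> L2 \<Omega>"
    using s by (auto intro!: smooth_L2 smooth_S2_tang_deriv smooth_S2_mult smooth_S2_component smooth_S2_cmult)
  have cong: "ipL2 u h = ipL2 u' h" if "h \<in> L2 \<Omega>" for h
    using assms(1-3) that by (intro ipL2_AE_cong) auto
  have "ipL2 u (tang_deriv i \<phi>) = - ipL2 v \<phi> + ipL2 u (\<lambda>x. 2 * \<phi> x * x $ i)"
    using assms(4) \<phi> unfolding weak_deriv_iff by blast
  then show "ipL2 u' (tang_deriv i \<phi>) = - ipL2 v \<phi> + ipL2 u' (\<lambda>x. 2 * \<phi> x * x $ i)"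
    unfolding cong[OF L(1)] cong[OF L(2)] .
qed

text \<open>
  Two weak derivatives have the same integrals against all test functions.
\<close>
lemma weak_deriv_unique:
  assumes "u \<in> L2 \<Omega>" "v \<in> L2 \<Omega>" "v' \<in> L2 \<Omega>" "weak_deriv \<Omega> i u v" "weak_deriv \<Omega> i u v'"
  shows "AE x in surf_on \<Omega>. v x = v' x"
proof -
  have "AE x in surf_on \<Omega>. v x - v' x = 0"
  proof (rule fundamental_lemma)
    show "integrable (surf_on \<Omega>) (\<lambda>x. v x - v' x)"
      using assms by (intro Bochner_Integration.integrable_diff L2_integrable)
    fix \<phi> assume \<phi>: "\<phi> \<in> test_functions \<Omega>"
    have "ipL2 v \<phi> = ipL2 v' \<phi>"
      using assms(4,5) \<phi> unfolding weak_deriv_iff by fastforce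
    then have "ipL2 (\<lambda>x. v x - v' x) \<phi> = 0"
      using l2.B_diff[OF assms(2,3) smooth_L2[OF test_smooth[OF \<phi>]]] by simp
    then show "(\<integral>x. (v x - v' x) * \<phi> x \<partial>surf_on \<Omega>) = 0" by (simp add: ipL2_def)
  qed
  then show ?thesis by eventually_elim simp
qed

lemma D_weak_deriv:
  assumes "v \<in> L2 \<Omega>" "weak_deriv \<Omega> i u v"
  shows "D \<Omega> i u \<in> L2 \<Omega>" "weak_deriv \<Omega> i u (D \<Omega> i u)"
  using someI[of "\<lambda>v. v \<in> L2 \<Omega> \<and> weak_deriv \<Omega> i u v" v] assms unfolding D_def by auto

text \<open>
  The choice of a representative in the definition of \<open>D\<close> is harmless: any square integrable weak
  derivative of any representative of \<open>u\<close> agrees with it almost everywhere.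
\<close>
lemma D_AE_eq:
  assumes "u \<in> L2 \<Omega>" "u' \<in> L2 \<Omega>" "AE x in surf_on \<Omega>. u x = u' x" "v \<in> L2 \<Omega>" "weak_deriv \<Omega> i u v"
  shows "AE x in surf_on \<Omega>. D \<Omega> i u' x = v x" "D \<Omega> i u' \<in> L2 \<Omega>" "weak_deriv \<Omega> i u' (D \<Omega> i u')"
proof -
  have w: "weak_deriv \<Omega> i u' v" using assms(1-3,5) by (rule weak_deriv_AE_cong)
  show L: "D \<Omega> i u' \<in> L2 \<Omega>" and W: "weak_deriv \<Omega> i u' (D \<Omega> i u')"
    using D_weak_deriv[OF assms(4) w] by auto
  show "AE x in surf_on \<Omega>. D \<Omega> i u' x = v x"
    by (rule weak_deriv_unique[OF assms(2) L assms(4) W w])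
qed

lemma H1_L2: "u \<in> H1 \<Omega> \<Longrightarrow> u \<in> L2 \<Omega>"
  by (simp add: H1_def)

lemma H1_D:
  assumes "u \<in> H1 \<Omega>"
  shows "D \<Omega> i u \<in> L2 \<Omega>" "weak_deriv \<Omega> i u (D \<Omega> i u)"
  using assms D_weak_deriv unfolding H1_def by blast+

lemma H1_I: "u \<in> L2 \<Omega> \<Longrightarrow> (\<And>i. v i \<in> L2 \<Omega> \<and> weak_deriv \<Omega> i u (v i)) \<Longrightarrow> u \<in> H1 \<Omega>"
  unfolding H1_def by blast

lemma H1_AE_cong:
  assumes "u \<in> H1 \<Omega>" "u' \<in> L2 \<Omega>" "AE x in surf_on \<Omega>. u x = u' x"
  shows "u' \<in> H1 \<Omega>"
  using H1_D[OF assms(1)] weak_deriv_AE_cong[OF H1_L2[OF assms(1)] assms(2,3)]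
  by (intro H1_I[OF assms(2), of "\<lambda>i. D \<Omega> i u"]) auto

lemma D_AE_cong:
  assumes "u \<in> H1 \<Omega>" "u' \<in> L2 \<Omega>" "AE x in surf_on \<Omega>. u x = u' x"
  shows "AE x in surf_on \<Omega>. D \<Omega> i u' x = D \<Omega> i u x"
  using D_AE_eq(1)[OF H1_L2[OF assms(1)] assms(2,3) H1_D[OF assms(1)]] .

lemma H1_combination:
  assumes "u \<in> H1 \<Omega>" "v \<in> H1 \<Omega>"
  shows "(\<lambda>x. a * u x + b * v x) \<in> H1 \<Omega>"
    and "AE x in surf_on \<Omega>. D \<Omega> i (\<lambda>x. a * u x + b * v x) x = a * D \<Omega> i u x + b * D \<Omega> i v x"
proof -
  have L: "(\<lambda>x. a * u x + b * v x) \<in> L2 \<Omega>" "\<And>i. (\<lambda>x. a * D \<Omega> i u x + b * D \<Omega> i v x) \<in> L2 \<Omega>"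
    using assms by (simp_all add: L2_add L2_cmult H1_L2 H1_D)
  have W: "weak_deriv \<Omega> i (\<lambda>x. a * u x + b * v x) (\<lambda>x. a * D \<Omega> i u x + b * D \<Omega> i v x)" for i
    using assms by (intro weak_deriv_combination H1_L2 H1_D)
  show "(\<lambda>x. a * u x + b * v x) \<in> H1 \<Omega>"
    using L W by (intro H1_I[of _ "\<lambda>i x. a * D \<Omega> i u x + b * D \<Omega> i v x"]) auto
  show "AE x in surf_on \<Omega>. D \<Omega> i (\<lambda>x. a * u x + b * v x) x = a * D \<Omega> i u x + b * D \<Omega> i v x"
    using L W by (intro D_AE_eq) auto
qed

lemma H2_H1: "u \<in> H2 \<Omega> \<Longrightarrow> u \<in> H1 \<Omega>" "u \<in> H2 \<Omega> \<Longrightarrow> D \<Omega> i u \<in> H1 \<Omega>"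
  by (auto simp: H2_def)

lemma H2_combination:
  assumes "u \<in> H2 \<Omega>" "v \<in> H2 \<Omega>"
  shows "(\<lambda>x. a * u x + b * v x) \<in> H2 \<Omega>"
    and "AE x in surf_on \<Omega>. D \<Omega> j (D \<Omega> i (\<lambda>x. a * u x + b * v x)) x = a * D \<Omega> j (D \<Omega> i u) x + b * D \<Omega> j (D \<Omega> i v) x"
proof -
  let ?w = "\<lambda>x. a * u x + b * v x" and ?d = "\<lambda>i x. a * D \<Omega> i u x + b * D \<Omega> i v x"
  have w: "?w \<in> H1 \<Omega>" using assms by (intro H1_combination(1) H2_H1(1))
  have d: "?d i \<in> H1 \<Omega>" for i using assms by (intro H1_combination(1) H2_H1(2))
  have ae: "AE x in surf_on \<Omega>. ?d i x = D \<Omega> i ?w x" for i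
    using H1_combination(2)[OF H2_H1(1)[OF assms(1)] H2_H1(1)[OF assms(2)], of i a b]
    by eventually_elim simp
  show "?w \<in> H2 \<Omega>"
    unfolding H2_def using w H1_AE_cong[OF d H1_D(1)[OF w] ae] by simp
  have "AE x in surf_on \<Omega>. D \<Omega> j (D \<Omega> i ?w) x = D \<Omega> j (?d i) x"
    by (rule D_AE_cong[OF d H1_D(1)[OF w] ae])
  moreover have "AE x in surf_on \<Omega>. D \<Omega> j (?d i) x = a * D \<Omega> j (D \<Omega> i u) x + b * D \<Omega> j (D \<Omega> i v) x"
    using assms by (intro H1_combination(2) H2_H1(2))
  ultimately show "AE x in surf_on \<Omega>. D \<Omega> j (D \<Omega> i ?w) x = a * D \<Omega> j (D \<Omega> i u) x + b * D \<Omega> j (D \<Omega> i v) x"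
    by eventually_elim simp
qed

lemma ipL2_test:
  assumes "\<phi> \<in> test_functions \<Omega>"
  shows "ipL2 f \<phi> = ip f \<phi>" "ipL2 \<phi> f = ip \<phi> f"
  unfolding ipL2_def using test_functions_off[OF assms]
  by (intro integral_surf_on_support borel subset_S2; simp)+

lemma weak_deriv_test:
  assumes \<phi>: "\<phi> \<in> test_functions \<Omega>"
  shows "weak_deriv \<Omega> i \<phi> (tang_deriv i \<phi>)"
  unfolding weak_deriv_iff
proof
  fix \<psi> assume \<psi>: "\<psi> \<in> test_functions \<Omega>"
  note smooth = test_smooth[OF \<phi>] test_smooth[OF \<psi>]
  have "integral\<^sup>L (surf_on S2) (tang_deriv i (\<lambda>x. \<phi> x * \<psi> x))
      = (\<integral>x. tang_deriv i \<phi> x * \<psi> x + \<phi> x * tang_deriv i \<psi> x \<partial>surf_on S2)"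
    by (intro Bochner_Integration.integral_cong) (auto simp: tang_deriv_mult smooth)
  also have "\<dots> = ip (tang_deriv i \<phi>) \<psi> + ip \<phi> (tang_deriv i \<psi>)"
    by (intro Bochner_Integration.integral_add smooth_S2_integrable_mult smooth_S2_tang_deriv smooth)
  finally have "ip (tang_deriv i \<phi>) \<psi> + ip \<phi> (tang_deriv i \<psi>) = (\<integral>x. 2 * (\<phi> x * \<psi> x) * x $ i \<partial>surf_on S2)"
    using divergence_S2[OF smooth_S2_mult[OF smooth], of i] by simp
  also have "\<dots> = ip \<phi> (\<lambda>x. 2 * \<psi> x * x $ i)"
    by (simp add: ac_simps)
  finally show "ipL2 \<phi> (tang_deriv i \<psi>) = - ipL2 (tang_deriv i \<phi>) \<psi> + ipL2 \<phi> (\<lambda>x. 2 * \<psi> x * x $ i)"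
    unfolding ipL2_test[OF \<phi>] ipL2_test[OF \<psi>] by simp
qed

lemma test_H1:
  assumes \<phi>: "\<phi> \<in> test_functions \<Omega>"
  shows "\<phi> \<in> H1 \<Omega>" "AE x in surf_on \<Omega>. D \<Omega> i \<phi> x = tang_deriv i \<phi> x"
proof -
  have L: "\<phi> \<in> L2 \<Omega>" "tang_deriv j \<phi> \<in> L2 \<Omega>" for j
    using test_smooth[OF \<phi>] by (auto intro: smooth_L2 smooth_S2_tang_deriv)
  show "\<phi> \<in> H1 \<Omega>" using L weak_deriv_test[OF \<phi>] by (intro H1_I[of _ "\<lambda>i. tang_deriv i \<phi>"]) auto
  show "AE x in surf_on \<Omega>. D \<Omega> i \<phi> x = tang_deriv i \<phi> x"
    using L weak_deriv_test[OF \<phi>] by (intro D_AE_eq) auto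
qed

lemma test_H2:
  assumes \<phi>: "\<phi> \<in> test_functions \<Omega>"
  shows "\<phi> \<in> H2 \<Omega>" "AE x in surf_on \<Omega>. D \<Omega> j (D \<Omega> i \<phi>) x = tang_deriv j (tang_deriv i \<phi>) x"
proof -
  have t: "tang_deriv i \<phi> \<in> test_functions \<Omega>" for i using \<phi> by (rule tang_deriv_test_functions)
  have ae: "AE x in surf_on \<Omega>. tang_deriv i \<phi> x = D \<Omega> i \<phi> x" for i
    using test_H1(2)[OF \<phi>, of i] by eventually_elim simp
  have DL: "D \<Omega> i \<phi> \<in> L2 \<Omega>" for i by (rule H1_D(1)[OF test_H1(1)[OF \<phi>]])
  show "\<phi> \<in> H2 \<Omega>"
    unfolding H2_def using test_H1(1)[OF \<phi>] H1_AE_cong[OF test_H1(1)[OF t] DL ae] by simp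
  have "AE x in surf_on \<Omega>. D \<Omega> j (D \<Omega> i \<phi>) x = D \<Omega> j (tang_deriv i \<phi>) x"
    by (rule D_AE_cong[OF test_H1(1)[OF t] DL ae])
  with test_H1(2)[OF t[of i], of j]
  show "AE x in surf_on \<Omega>. D \<Omega> j (D \<Omega> i \<phi>) x = tang_deriv j (tang_deriv i \<phi>) x"
    by eventually_elim simp
qed

abbreviation sqdist :: "(real^3 \<Rightarrow> real) \<Rightarrow> (real^3 \<Rightarrow> real) \<Rightarrow> real" where
  "sqdist u v \<equiv> ipL2 (\<lambda>x. u x - v x) (\<lambda>x. u x - v x)"

lemma H2_L2:
  assumes "u \<in> H2 \<Omega>"
  shows "u \<in> L2 \<Omega>" "D \<Omega> i u \<in> L2 \<Omega>" "D \<Omega> j (D \<Omega> i u) \<in> L2 \<Omega>"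
  using assms by (auto intro: H1_L2 H1_D H2_H1)

lemma H2_norm_diff_test:
  assumes u: "u \<in> H2 \<Omega>" and \<phi>: "\<phi> \<in> test_functions \<Omega>"
  shows "H2_norm \<Omega> (\<lambda>x. u x - \<phi> x) = sqrt (sqdist u \<phi> + (\<Sum>i\<in>UNIV. sqdist (D \<Omega> i u) (tang_deriv i \<phi>))
    + (\<Sum>i\<in>UNIV. \<Sum>j\<in>UNIV. sqdist (D \<Omega> j (D \<Omega> i u)) (tang_deriv j (tang_deriv i \<phi>))))"
proof -
  let ?w = "\<lambda>x. 1 * u x + (-1) * \<phi> x"
  note \<phi>2 = test_H2[OF \<phi>] and s = test_smooth[OF \<phi>]
  have w: "?w \<in> H2 \<Omega>" using u \<phi>2 by (intro H2_combination)
  have sq: "(LINT x:\<Omega>|surf. (f x)\<^sup>2) = ipL2 f f" for f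
    by (simp add: set_lebesgue_integral_surf_on borel ipL2_def power2_eq_square)
  have 1: "ipL2 (D \<Omega> i ?w) (D \<Omega> i ?w) = sqdist (D \<Omega> i u) (tang_deriv i \<phi>)" for i
  proof -
    have "AE x in surf_on \<Omega>. D \<Omega> i ?w x = D \<Omega> i u x - tang_deriv i \<phi> x"
      using H1_combination(2)[OF H2_H1(1)[OF u] H2_H1(1)[OF \<phi>2(1)], of i 1 "-1"] test_H1(2)[OF \<phi>, of i]
      by eventually_elim simp
    then show ?thesis
      using w u s by (intro ipL2_AE_cong l2.diff_closed H2_L2 smooth_L2 smooth_S2_tang_deriv)
  qed
  have 2: "ipL2 (D \<Omega> j (D \<Omega> i ?w)) (D \<Omega> j (D \<Omega> i ?w)) = sqdist (D \<Omega> j (D \<Omega> i u)) (tang_deriv j (tang_deriv i \<phi>))" for i j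
  proof -
    have "AE x in surf_on \<Omega>. D \<Omega> j (D \<Omega> i ?w) x = D \<Omega> j (D \<Omega> i u) x - tang_deriv j (tang_deriv i \<phi>) x"
      using H2_combination(2)[OF u \<phi>2(1), of j i 1 "-1"] \<phi>2(2)[of j i]
      by eventually_elim simp
    then show ?thesis
      using w u s by (intro ipL2_AE_cong l2.diff_closed H2_L2 smooth_L2 smooth_S2_tang_deriv)
  qed
  have eq: "(\<lambda>x. u x - \<phi> x) = ?w" by auto
  show ?thesis
    unfolding H2_norm_def sq unfolding eq 1 2 by simp
qed

definition H2_limit :: "(nat \<Rightarrow> real^3 \<Rightarrow> real) \<Rightarrow> (real^3 \<Rightarrow> real) \<Rightarrow> bool" where
  "H2_limit \<phi> u \<longleftrightarrow> (\<forall>k. \<phi> k \<in> test_functions \<Omega>) \<and> (\<lambda>k. sqdist u (\<phi> k)) \<longlonglongrightarrow> 0 \<and>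
     (\<forall>i. (\<lambda>k. sqdist (D \<Omega> i u) (tang_deriv i (\<phi> k))) \<longlonglongrightarrow> 0) \<and>
     (\<forall>i j. (\<lambda>k. sqdist (D \<Omega> j (D \<Omega> i u)) (tang_deriv j (tang_deriv i (\<phi> k)))) \<longlonglongrightarrow> 0)"

text \<open>
  As \<open>D\<close> is linear only up to null sets, it is convenient to replace the norm of a difference by
  separate convergence of the function and of its first and second derivatives.
\<close>
lemma H20_iff_limit: "u \<in> H20 \<Omega> \<longleftrightarrow> u \<in> H2 \<Omega> \<and> (\<exists>\<phi>. H2_limit \<phi> u)"
proof (intro iffI conjI)
  assume u: "u \<in> H20 \<Omega>"
  then show u2: "u \<in> H2 \<Omega>" by (simp add: H20_def)
  have "\<exists>\<phi>\<in>test_functions \<Omega>. H2_norm \<Omega> (\<lambda>x. u x - \<phi> x) < inverse (real (Suc k))" for k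
    using u by (simp add: H20_def)
  then obtain \<phi> where \<phi>: "\<And>k. \<phi> k \<in> test_functions \<Omega>" "\<And>k. H2_norm \<Omega> (\<lambda>x. u x - \<phi> k x) < inverse (real (Suc k))"
    by metis
  let ?a = "\<lambda>k. sqdist u (\<phi> k)" and ?b = "\<lambda>k i. sqdist (D \<Omega> i u) (tang_deriv i (\<phi> k))"
    and ?c = "\<lambda>k i j. sqdist (D \<Omega> j (D \<Omega> i u)) (tang_deriv j (tang_deriv i (\<phi> k)))"
  let ?e = "\<lambda>k. (inverse (real (Suc k)))\<^sup>2"
  note s = test_smooth[OF \<phi>(1)]
  have a0: "0 \<le> ?a k" and b0: "0 \<le> ?b k i" and c0: "0 \<le> ?c k i j" for k i j
    using u2 s by (intro l2.B_nonneg l2.diff_closed H2_L2 smooth_L2 smooth_S2_tang_deriv; simp)+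
  have tot: "?a k + (\<Sum>i\<in>UNIV. ?b k i) + (\<Sum>i\<in>UNIV. \<Sum>j\<in>UNIV. ?c k i j) \<le> ?e k" for k
  proof (rule sqrt_le_D)
    show "sqrt (?a k + (\<Sum>i\<in>UNIV. ?b k i) + (\<Sum>i\<in>UNIV. \<Sum>j\<in>UNIV. ?c k i j)) \<le> inverse (real (Suc k))"
      using \<phi>(2)[of k] H2_norm_diff_test[OF u2 \<phi>(1)[of k]] by simp
  qed
  have B0: "0 \<le> (\<Sum>i\<in>UNIV. ?b k i)" and C0: "0 \<le> (\<Sum>j\<in>UNIV. ?c k i j)" and CC0: "0 \<le> (\<Sum>i\<in>UNIV. \<Sum>j\<in>UNIV. ?c k i j)" for k i
    by (intro sum_nonneg b0 c0)+
  have bB: "?b k i \<le> (\<Sum>i\<in>UNIV. ?b k i)" for k i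
    by (rule member_le_sum) (simp_all add: b0)
  have cC: "?c k i j \<le> (\<Sum>i\<in>UNIV. \<Sum>j\<in>UNIV. ?c k i j)" for k i j
  proof -
    have "?c k i j \<le> (\<Sum>j\<in>UNIV. ?c k i j)" by (rule member_le_sum) (simp_all add: c0)
    also have "\<dots> \<le> (\<Sum>i\<in>UNIV. \<Sum>j\<in>UNIV. ?c k i j)"
      by (rule member_le_sum[where f = "\<lambda>i. \<Sum>j\<in>UNIV. ?c k i j"]) (simp_all add: C0)
    finally show ?thesis .
  qed
  have e: "?e \<longlonglongrightarrow> 0"
    using tendsto_power[OF LIMSEQ_inverse_real_of_nat, of 2] by simp
  have conv: "f \<longlonglongrightarrow> 0" if "\<And>k. 0 \<le> f k" "\<And>k. f k \<le> ?e k" for f :: "nat \<Rightarrow> real"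
    using that by (intro tendsto_sandwich[OF _ _ tendsto_const e] always_eventually) auto
  have ae: "?a k \<le> ?e k" for k
    using tot[of k] B0[of k] CC0[of k] by linarith
  have be: "?b k i \<le> ?e k" for k i
  proof -
    have "?b k i \<le> (\<Sum>i\<in>UNIV. ?b k i)" by (rule bB)
    then show ?thesis using tot[of k] a0[of k] CC0[of k] by linarith
  qed
  have ce: "?c k i j \<le> ?e k" for k i j
  proof -
    have "?c k i j \<le> (\<Sum>i\<in>UNIV. \<Sum>j\<in>UNIV. ?c k i j)" by (rule cC)
    then show ?thesis using tot[of k] a0[of k] B0[of k] by linarith
  qed
  from ae be ce have "H2_limit \<phi> u"
    unfolding H2_limit_def using \<phi>(1) a0 b0 c0 by (intro conjI allI conv) auto
  then show "\<exists>\<phi>. H2_limit \<phi> u" by blast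
next
  assume "u \<in> H2 \<Omega> \<and> (\<exists>\<phi>. H2_limit \<phi> u)"
  then obtain \<phi> where u: "u \<in> H2 \<Omega>" and \<phi>: "H2_limit \<phi> u" by blast
  have t: "\<phi> k \<in> test_functions \<Omega>" for k using \<phi> by (simp add: H2_limit_def)
  have "(\<lambda>k. sqrt (sqdist u (\<phi> k) + (\<Sum>i\<in>UNIV. sqdist (D \<Omega> i u) (tang_deriv i (\<phi> k)))
      + (\<Sum>i\<in>UNIV. \<Sum>j\<in>UNIV. sqdist (D \<Omega> j (D \<Omega> i u)) (tang_deriv j (tang_deriv i (\<phi> k))))))
      \<longlonglongrightarrow> sqrt (0 + (\<Sum>i\<in>(UNIV::3 set). 0) + (\<Sum>i\<in>(UNIV::3 set). \<Sum>j\<in>(UNIV::3 set). 0))"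
    using \<phi> unfolding H2_limit_def by (intro tendsto_intros) auto
  then have lim: "(\<lambda>k. H2_norm \<Omega> (\<lambda>x. u x - \<phi> k x)) \<longlonglongrightarrow> 0"
    by (simp add: H2_norm_diff_test[OF u t])
  show "u \<in> H20 \<Omega>"
    unfolding H20_def
  proof (intro CollectI conjI u allI impI)
    fix \<epsilon> :: real assume "\<epsilon> > 0"
    then have "\<forall>\<^sub>F k in sequentially. H2_norm \<Omega> (\<lambda>x. u x - \<phi> k x) < \<epsilon>"
      using lim order_tendstoD(2) by blast
    then obtain k where "H2_norm \<Omega> (\<lambda>x. u x - \<phi> k x) < \<epsilon>"
      using eventually_happens sequentially_bot by blast
    then show "\<exists>\<phi>\<in>test_functions \<Omega>. H2_norm \<Omega> (\<lambda>x. u x - \<phi> x) < \<epsilon>" using t by blast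
  qed
qed

lemma sqdist_combination_tendsto:
  assumes L: "u \<in> L2 \<Omega>" "v \<in> L2 \<Omega>" "w \<in> L2 \<Omega>" "\<And>k::nat. f k \<in> L2 \<Omega>" "\<And>k. g k \<in> L2 \<Omega>" "\<And>k. h k \<in> L2 \<Omega>"
    and w: "AE x in surf_on \<Omega>. w x = a * u x + b * v x"
    and h: "\<And>k x. x \<in> \<Omega> \<Longrightarrow> h k x = a * f k x + b * g k x"
    and lim: "(\<lambda>k. sqdist u (f k)) \<longlonglongrightarrow> 0" "(\<lambda>k. sqdist v (g k)) \<longlonglongrightarrow> 0"
  shows "(\<lambda>k. sqdist w (h k)) \<longlonglongrightarrow> 0"
proof (rule tendsto_sandwich[OF always_eventually always_eventually tendsto_const])
  show "\<forall>k. 0 \<le> sqdist w (h k)" using L by (intro allI l2.B_nonneg l2.diff_closed)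
  show "\<forall>k. sqdist w (h k) \<le> 2 * a\<^sup>2 * sqdist u (f k) + 2 * b\<^sup>2 * sqdist v (g k)"
  proof
    fix k
    let ?F = "\<lambda>x. a * (u x - f k x)" and ?G = "\<lambda>x. b * (v x - g k x)"
    have uf: "(\<lambda>x. u x - f k x) \<in> L2 \<Omega>" and vg: "(\<lambda>x. v x - g k x) \<in> L2 \<Omega>"
      using L by (auto intro: l2.diff_closed)
    have F: "?F \<in> L2 \<Omega>" and G: "?G \<in> L2 \<Omega>" using uf vg by (auto intro: L2_cmult)
    have ae: "AE x in surf_on \<Omega>. w x - h k x = ?F x + ?G x"
    proof -
      have "AE x in surf_on \<Omega>. x \<in> \<Omega>" by (rule AE_I2) simp
      with w show ?thesis by eventually_elim (simp add: h algebra_simps)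
    qed
    have "sqdist w (h k) = ipL2 (\<lambda>x. ?F x + ?G x) (\<lambda>x. ?F x + ?G x)"
      using L F G ae by (intro ipL2_AE_cong l2.diff_closed l2.add_closed) auto
    also have "\<dots> = ipL2 ?F ?F + 2 * ipL2 ?F ?G + ipL2 ?G ?G" by (rule l2.B_square_add[OF F G])
    also have "\<dots> \<le> 2 * ipL2 ?F ?F + 2 * ipL2 ?G ?G"
    proof -
      have "0 \<le> ipL2 (\<lambda>x. ?F x - ?G x) (\<lambda>x. ?F x - ?G x)"
        using F G by (intro l2.B_nonneg l2.diff_closed)
      also have "\<dots> = ipL2 ?F ?F - 2 * ipL2 ?F ?G + ipL2 ?G ?G"
        using l2.B_square_add[OF F L2_cmult[OF G, of "-1"]] l2.B_cmult_square[OF G, of "-1"]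
          l2.B_cmult[OF G F, of "-1"] l2.B_commute[OF F L2_cmult[OF G, of "-1"]] l2.B_commute[OF F G]
        by simp
      finally show ?thesis by simp
    qed
    also have "\<dots> = 2 * a\<^sup>2 * sqdist u (f k) + 2 * b\<^sup>2 * sqdist v (g k)"
      unfolding l2.B_cmult_square[OF uf] l2.B_cmult_square[OF vg] by simp
    finally show "sqdist w (h k) \<le> 2 * a\<^sup>2 * sqdist u (f k) + 2 * b\<^sup>2 * sqdist v (g k)" .
  qed
  have "(\<lambda>k. 2 * a\<^sup>2 * sqdist u (f k) + 2 * b\<^sup>2 * sqdist v (g k)) \<longlonglongrightarrow> 2 * a\<^sup>2 * 0 + 2 * b\<^sup>2 * 0"
    by (intro tendsto_intros lim)
  then show "(\<lambda>k. 2 * a\<^sup>2 * sqdist u (f k) + 2 * b\<^sup>2 * sqdist v (g k)) \<longlonglongrightarrow> 0" by simp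
qed

lemma H20_H2: "u \<in> H20 \<Omega> \<Longrightarrow> u \<in> H2 \<Omega>"
  by (simp add: H20_def)

lemma H20_combination:
  assumes "u \<in> H20 \<Omega>" "v \<in> H20 \<Omega>"
  shows "(\<lambda>x. a * u x + b * v x) \<in> H20 \<Omega>"
proof -
  obtain \<phi> \<psi> where \<phi>: "H2_limit \<phi> u" and \<psi>: "H2_limit \<psi> v"
    using assms unfolding H20_iff_limit by blast
  have u: "u \<in> H2 \<Omega>" and v: "v \<in> H2 \<Omega>" using assms by (auto intro: H20_H2)
  let ?w = "\<lambda>x. a * u x + b * v x" and ?h = "\<lambda>k x. a * \<phi> k x + b * \<psi> k x"
  have w: "?w \<in> H2 \<Omega>" using u v by (rule H2_combination)
  have t: "\<phi> k \<in> test_functions \<Omega>" "\<psi> k \<in> test_functions \<Omega>" for k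
    using \<phi> \<psi> by (auto simp: H2_limit_def)
  have th: "?h k \<in> test_functions \<Omega>" for k using t by (intro test_functions_combination)
  note s = test_smooth[OF t(1)] test_smooth[OF t(2)] test_smooth[OF th]
  note L = H2_L2[OF u] H2_L2[OF v] H2_L2[OF w] smooth_L2[OF s(1)] smooth_L2[OF s(2)] smooth_L2[OF s(3)]
    smooth_L2[OF smooth_S2_tang_deriv[OF s(1)]] smooth_L2[OF smooth_S2_tang_deriv[OF s(2)]]
    smooth_L2[OF smooth_S2_tang_deriv[OF s(3)]]
    smooth_L2[OF smooth_S2_tang_deriv[OF smooth_S2_tang_deriv[OF s(1)]]]
    smooth_L2[OF smooth_S2_tang_deriv[OF smooth_S2_tang_deriv[OF s(2)]]]
    smooth_L2[OF smooth_S2_tang_deriv[OF smooth_S2_tang_deriv[OF s(3)]]]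
  have lin: "tang_deriv i (\<lambda>x. a * f x + b * g x) x = a * tang_deriv i f x + b * tang_deriv i g x"
    if "smooth_S2 f" "smooth_S2 g" "x \<in> S2" for i f g x
    using that S2_nonzero[OF that(3)] by (simp add: tang_deriv_add tang_deriv_cmult smooth_S2_cmult)
  have d1: "tang_deriv i (?h k) x = a * tang_deriv i (\<phi> k) x + b * tang_deriv i (\<psi> k) x" if "x \<in> S2" for i k x
    using lin[OF s(1,2) that] .
  have d2: "tang_deriv j (tang_deriv i (?h k)) x = a * tang_deriv j (tang_deriv i (\<phi> k)) x + b * tang_deriv j (tang_deriv i (\<psi> k)) x"
    if x: "x \<in> S2" for i j k x
  proof -
    have "tang_deriv j (tang_deriv i (?h k)) x = tang_deriv j (\<lambda>x. a * tang_deriv i (\<phi> k) x + b * tang_deriv i (\<psi> k) x) x"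
      by (rule tang_deriv_cong[OF d1 S2_nonzero[OF x]])
    then show ?thesis
      using lin[OF smooth_S2_tang_deriv[OF s(1)] smooth_S2_tang_deriv[OF s(2)] x] by simp
  qed
  have "H2_limit ?h ?w"
    unfolding H2_limit_def
  proof (intro conjI allI)
    show "?h k \<in> test_functions \<Omega>" for k by (rule th)
    show "(\<lambda>k. sqdist ?w (?h k)) \<longlonglongrightarrow> 0"
      by (rule sqdist_combination_tendsto[where u = u and v = v and f = \<phi> and g = \<psi> and a = a and b = b])
         (use \<phi> \<psi> in \<open>auto simp: H2_limit_def intro: L\<close>)
    show "(\<lambda>k. sqdist (D \<Omega> i ?w) (tang_deriv i (?h k))) \<longlonglongrightarrow> 0" for i
      by (rule sqdist_combination_tendsto[where u = "D \<Omega> i u" and v = "D \<Omega> i v"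
            and f = "\<lambda>k. tang_deriv i (\<phi> k)" and g = "\<lambda>k. tang_deriv i (\<psi> k)" and a = a and b = b,
            OF L(2,5,8) L(13) L(14) L(15) H1_combination(2)[OF H2_H1(1)[OF u] H2_H1(1)[OF v]]])
         (use \<phi> \<psi> d1 subset_S2 in \<open>auto simp: H2_limit_def\<close>)
    show "(\<lambda>k. sqdist (D \<Omega> j (D \<Omega> i ?w)) (tang_deriv j (tang_deriv i (?h k)))) \<longlonglongrightarrow> 0" for i j
      by (rule sqdist_combination_tendsto[where u = "D \<Omega> j (D \<Omega> i u)" and v = "D \<Omega> j (D \<Omega> i v)"
            and f = "\<lambda>k. tang_deriv j (tang_deriv i (\<phi> k))" and g = "\<lambda>k. tang_deriv j (tang_deriv i (\<psi> k))" and a = a and b = b,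
            OF L(3,6,9) L(16) L(17) L(18) H2_combination(2)[OF u v]])
         (use \<phi> \<psi> d2 subset_S2 in \<open>auto simp: H2_limit_def\<close>)
  qed
  with w show ?thesis unfolding H20_iff_limit by blast
qed

lemma zero_H20: "(\<lambda>x. 0) \<in> H20 \<Omega>"
proof -
  have t: "(\<lambda>x. 0) \<in> test_functions \<Omega>" by (simp add: test_functions_iff)
  have "H2_norm \<Omega> (\<lambda>x. 0 - 0) = 0"
  proof -
    have ae: "AE x in surf_on \<Omega>. D \<Omega> i (\<lambda>x. 0) x = 0" "AE x in surf_on \<Omega>. D \<Omega> j (D \<Omega> i (\<lambda>x. 0)) x = 0" for i j
    proof -
      show "AE x in surf_on \<Omega>. D \<Omega> i (\<lambda>x. 0) x = 0" using test_H1(2)[OF t, of i] by simp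
      have "tang_deriv i (\<lambda>x. 0) = (\<lambda>x. 0)" by auto
      then show "AE x in surf_on \<Omega>. D \<Omega> j (D \<Omega> i (\<lambda>x. 0)) x = 0"
        using test_H2(2)[OF t, of j i] by simp
    qed
    have z: "(LINT x:\<Omega>|surf. (f x)\<^sup>2) = 0" if "AE x in surf_on \<Omega>. f x = 0" for f :: "real^3 \<Rightarrow> real"
      unfolding set_lebesgue_integral_surf_on[OF borel] using that
      by (intro integral_eq_zero_AE) (auto elim: eventually_mono)
    show ?thesis by (simp add: H2_norm_def z[OF ae(1)] z[OF ae(2)])
  qed
  then show ?thesis
    using t test_H2(1)[OF t] unfolding H20_def by (auto intro!: bexI[of _ "\<lambda>x. 0"])
qed

end

section \<open>Comparison of the domain with the sphere\<close>

context sphere_domain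
begin

definition grad_ipL2 :: "(real^3 \<Rightarrow> real) \<Rightarrow> (real^3 \<Rightarrow> real) \<Rightarrow> real" where
  "grad_ipL2 u v = (\<Sum>i\<in>UNIV. ipL2 (D \<Omega> i u) (D \<Omega> i v))"

definition lap_ipL2 :: "(real^3 \<Rightarrow> real) \<Rightarrow> (real^3 \<Rightarrow> real) \<Rightarrow> real" where
  "lap_ipL2 u v = ipL2 (surf_laplacian \<Omega> u) (surf_laplacian \<Omega> v)"

lemma ipL2_sum:
  assumes "\<And>i. i \<in> I \<Longrightarrow> f i \<in> L2 \<Omega>" "\<And>j. j \<in> J \<Longrightarrow> g j \<in> L2 \<Omega>"
  shows "ipL2 (\<lambda>x. \<Sum>i\<in>I. f i x) (\<lambda>x. \<Sum>j\<in>J. g j x) = (\<Sum>i\<in>I. \<Sum>j\<in>J. ipL2 (f i) (g j))"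
proof -
  have gL: "(\<lambda>x. \<Sum>j\<in>J. g j x) \<in> L2 \<Omega>" using l2.sum_closed[of J g "\<lambda>_. 1"] assms(2) by simp
  have "ipL2 (\<lambda>x. \<Sum>i\<in>I. f i x) (\<lambda>x. \<Sum>j\<in>J. g j x) = (\<Sum>i\<in>I. ipL2 (f i) (\<lambda>x. \<Sum>j\<in>J. g j x))"
    using l2.B_sum[of I f "\<lambda>x. \<Sum>j\<in>J. g j x" "\<lambda>_. 1"] assms(1) gL by simp
  also have "\<dots> = (\<Sum>i\<in>I. \<Sum>j\<in>J. ipL2 (f i) (g j))"
  proof (intro sum.cong refl)
    fix i assume i: "i \<in> I"
    have "ipL2 (f i) (\<lambda>x. \<Sum>j\<in>J. g j x) = ipL2 (\<lambda>x. \<Sum>j\<in>J. g j x) (f i)"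
      by (rule l2.B_commute[OF assms(1)[OF i] gL])
    also have "\<dots> = (\<Sum>j\<in>J. ipL2 (g j) (f i))"
      using l2.B_sum[of J g "f i" "\<lambda>_. 1"] assms i by simp
    also have "\<dots> = (\<Sum>j\<in>J. ipL2 (f i) (g j))"
      using assms i by (intro sum.cong refl l2.B_commute)
    finally show "ipL2 (f i) (\<lambda>x. \<Sum>j\<in>J. g j x) = (\<Sum>j\<in>J. ipL2 (f i) (g j))" .
  qed
  finally show ?thesis .
qed

lemma surf_laplacian_L2: "u \<in> H2 \<Omega> \<Longrightarrow> surf_laplacian \<Omega> u \<in> L2 \<Omega>"
  unfolding surf_laplacian_def[abs_def] using l2.sum_closed[of UNIV "\<lambda>i. D \<Omega> i (D \<Omega> i u)" "\<lambda>_. 1"] H2_L2(3)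
  by simp

lemma integral_surf_grad:
  assumes "u \<in> H2 \<Omega>" "v \<in> H2 \<Omega>"
  shows "(LINT x:\<Omega>|surf. surf_grad \<Omega> u x \<bullet> surf_grad \<Omega> v x) = grad_ipL2 u v"
  unfolding set_lebesgue_integral_surf_on[OF borel] surf_grad_def inner_vec_def grad_ipL2_def ipL2_def
  using assms by (simp add: L2_mult_integrable H2_L2)

lemma integral_surf_laplacian:
  "(LINT x:\<Omega>|surf. surf_laplacian \<Omega> u x * surf_laplacian \<Omega> v x) = lap_ipL2 u v"
  unfolding set_lebesgue_integral_surf_on[OF borel] lap_ipL2_def ipL2_def ..

text \<open>
  For test functions this is the spectral inequality on the whole sphere; both sides are
  continuous in the norm of the second Sobolev space.
\<close>
lemma spectral_inequality_H20:
  assumes u: "u \<in> H20 \<Omega>" and K: "\<And>n. n \<ge> K \<Longrightarrow> z \<le> harmonic_eigenvalue n"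
  shows "z * grad_ipL2 u u - lap_ipL2 u u
    \<le> (\<Sum>i<K\<^sup>2. max (z - level i) 0 / level i * (\<Sum>j\<in>UNIV. ipL2 (D \<Omega> j u) (tang_deriv j (harmonic i)))\<^sup>2)"
proof -
  obtain \<phi> where \<phi>: "H2_limit \<phi> u" and u2: "u \<in> H2 \<Omega>" using u unfolding H20_iff_limit by blast
  have t: "\<phi> k \<in> test_functions \<Omega>" for k using \<phi> by (simp add: H2_limit_def)
  note s = test_smooth[OF t]
  have L1: "tang_deriv j (\<phi> k) \<in> L2 \<Omega>" and Ltt: "tang_deriv j (tang_deriv i (\<phi> k)) \<in> L2 \<Omega>"
    and Le: "tang_deriv j (harmonic m) \<in> L2 \<Omega>" for i j k m
    using s smooth_harmonic by (auto intro!: smooth_L2 smooth_S2_tang_deriv)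
  have grad: "grad_ip (\<phi> k) g = (\<Sum>j\<in>UNIV. ipL2 (tang_deriv j (\<phi> k)) (tang_deriv j g))" if "smooth_S2 g" for k g
    unfolding grad_ip_def using that s[of k] ipL2_test(2)[OF tang_deriv_test_functions[OF t[of k]]]
    by (simp add: smooth_S2_integrable_mult smooth_S2_tang_deriv)
  have lap: "ip (laplace_S2 (\<phi> k)) (laplace_S2 (\<phi> k))
      = (\<Sum>i\<in>UNIV. \<Sum>j\<in>UNIV. ipL2 (tang_deriv i (tang_deriv i (\<phi> k))) (tang_deriv j (tang_deriv j (\<phi> k))))" for k
  proof -
    have "tang_deriv i (tang_deriv i (\<phi> k)) x = 0" if "x \<in> S2" "x \<notin> \<Omega>" for i x
      using test_functions_off[OF tang_deriv_test_functions[OF tang_deriv_test_functions[OF t]] that] .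
    then have "laplace_S2 (\<phi> k) x = 0" if "x \<in> S2" "x \<notin> \<Omega>" for x
      using that by (simp add: laplace_S2_def)
    then have "ip (laplace_S2 (\<phi> k)) (laplace_S2 (\<phi> k)) = ipL2 (laplace_S2 (\<phi> k)) (laplace_S2 (\<phi> k))"
      unfolding ipL2_def by (intro integral_surf_on_support[symmetric] borel subset_S2) simp
    also have "\<dots> = (\<Sum>i\<in>UNIV. \<Sum>j\<in>UNIV. ipL2 (tang_deriv i (tang_deriv i (\<phi> k))) (tang_deriv j (tang_deriv j (\<phi> k))))"
      unfolding laplace_S2_def[abs_def] by (rule ipL2_sum) (rule Ltt)+
    finally show ?thesis .
  qed
  have lap_u: "lap_ipL2 u u = (\<Sum>i\<in>UNIV. \<Sum>j\<in>UNIV. ipL2 (D \<Omega> i (D \<Omega> i u)) (D \<Omega> j (D \<Omega> j u)))"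
    unfolding lap_ipL2_def surf_laplacian_def[abs_def] by (rule ipL2_sum) (rule H2_L2[OF u2])+
  have c1: "(\<lambda>k. sqdist (D \<Omega> j u) (tang_deriv j (\<phi> k))) \<longlonglongrightarrow> 0"
    and c2: "(\<lambda>k. sqdist (D \<Omega> j (D \<Omega> i u)) (tang_deriv j (tang_deriv i (\<phi> k)))) \<longlonglongrightarrow> 0" for i j
    using \<phi> by (auto simp: H2_limit_def)
  have c0: "(\<lambda>k. sqdist g g) \<longlonglongrightarrow> 0" for g by (simp add: ipL2_def)
  have lim1: "(\<lambda>k. z * grad_ip (\<phi> k) (\<phi> k) - ip (laplace_S2 (\<phi> k)) (laplace_S2 (\<phi> k)))
      \<longlonglongrightarrow> z * grad_ipL2 u u - lap_ipL2 u u"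
    unfolding grad[OF s] lap lap_u grad_ipL2_def
    by (intro tendsto_intros l2.tendsto_B L1 Ltt H2_L2[OF u2] c1 c2)
  have lim2: "(\<lambda>k. \<Sum>i<K\<^sup>2. max (z - level i) 0 / level i * (grad_ip (\<phi> k) (harmonic i))\<^sup>2)
      \<longlonglongrightarrow> (\<Sum>i<K\<^sup>2. max (z - level i) 0 / level i * (\<Sum>j\<in>UNIV. ipL2 (D \<Omega> j u) (tang_deriv j (harmonic i)))\<^sup>2)"
    unfolding grad[OF smooth_harmonic]
    by (intro tendsto_sum tendsto_mult tendsto_const tendsto_power l2.tendsto_B L1 Le H2_L2[OF u2] c1 c0)
  show ?thesis
    by (rule LIMSEQ_le[OF lim1 lim2]) (use spectral_inequality_smooth[OF s K] in blast)
qed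

text \<open>
  Vector fields are functions of a component index and a point, so that the theory of real-valued
  functions applies to them.
\<close>
sublocale vf: semi_inner "{F :: 3 \<times> (real^3) \<Rightarrow> real. \<forall>i. (\<lambda>x. F (i, x)) \<in> L2 \<Omega>}"
  "\<lambda>F G. \<Sum>i\<in>UNIV. ipL2 (\<lambda>x. F (i, x)) (\<lambda>x. G (i, x))"
proof
  show "(\<Sum>i\<in>UNIV. ipL2 (\<lambda>x. f (i, x) + g (i, x)) (\<lambda>x. h (i, x)))
      = (\<Sum>i\<in>UNIV. ipL2 (\<lambda>x. f (i, x)) (\<lambda>x. h (i, x))) + (\<Sum>i\<in>UNIV. ipL2 (\<lambda>x. g (i, x)) (\<lambda>x. h (i, x)))"
    if "f \<in> {F. \<forall>i. (\<lambda>x. F (i, x)) \<in> L2 \<Omega>}" "g \<in> {F. \<forall>i. (\<lambda>x. F (i, x)) \<in> L2 \<Omega>}"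
      "h \<in> {F. \<forall>i. (\<lambda>x. F (i, x)) \<in> L2 \<Omega>}" for f g h :: "3 \<times> (real^3) \<Rightarrow> real"
    using that by (simp add: l2.B_add sum.distrib)
  show "(\<Sum>i\<in>UNIV. ipL2 (\<lambda>x. c * f (i, x)) (\<lambda>x. h (i, x))) = c * (\<Sum>i\<in>UNIV. ipL2 (\<lambda>x. f (i, x)) (\<lambda>x. h (i, x)))"
    if "f \<in> {F. \<forall>i. (\<lambda>x. F (i, x)) \<in> L2 \<Omega>}" "h \<in> {F. \<forall>i. (\<lambda>x. F (i, x)) \<in> L2 \<Omega>}"
    for f h :: "3 \<times> (real^3) \<Rightarrow> real" and c
    using that by (simp add: l2.B_cmult sum_distrib_left)
  show "(\<Sum>i\<in>UNIV. ipL2 (\<lambda>x. f (i, x)) (\<lambda>x. g (i, x))) = (\<Sum>i\<in>UNIV. ipL2 (\<lambda>x. g (i, x)) (\<lambda>x. f (i, x)))"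
    for f g :: "3 \<times> (real^3) \<Rightarrow> real"
    by (simp add: ipL2_def mult.commute)
  show "0 \<le> (\<Sum>i\<in>UNIV. ipL2 (\<lambda>x. f (i, x)) (\<lambda>x. f (i, x)))"
    if "f \<in> {F. \<forall>i. (\<lambda>x. F (i, x)) \<in> L2 \<Omega>}" for f :: "3 \<times> (real^3) \<Rightarrow> real"
    using that by (intro sum_nonneg l2.B_nonneg) simp
qed (auto intro: L2_add L2_cmult l2.zero_closed)

definition grad_field :: "(real^3 \<Rightarrow> real) \<Rightarrow> 3 \<times> (real^3) \<Rightarrow> real" where
  "grad_field u = (\<lambda>(i, x). D \<Omega> i u x)"

lemma grad_field_closed: "u \<in> H2 \<Omega> \<Longrightarrow> grad_field u \<in> {F. \<forall>i. (\<lambda>x. F (i, x)) \<in> L2 \<Omega>}"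
  by (simp add: grad_field_def H2_L2(2))

lemma grad_ipL2_field:
  "grad_ipL2 u v = (\<Sum>i\<in>UNIV. ipL2 (\<lambda>x. grad_field u (i, x)) (\<lambda>x. grad_field v (i, x)))"
  by (simp add: grad_ipL2_def grad_field_def)

text \<open>
  The gradients of the \<open>u\<^sub>j\<close> are orthonormal in the space of vector fields on \<open>\<Omega>\<close>, where the
  restriction of the gradient of \<open>e\<close> also lives.
\<close>
lemma bessel_gradients:
  assumes J: "finite J" and u: "\<And>j. j \<in> J \<Longrightarrow> u j \<in> H2 \<Omega>"
    and on: "\<And>j k. j \<in> J \<Longrightarrow> k \<in> J \<Longrightarrow> grad_ipL2 (u j) (u k) = (if j = k then 1 else 0)"
    and e: "smooth_S2 e"
  shows "(\<Sum>j\<in>J. (\<Sum>i\<in>UNIV. ipL2 (D \<Omega> i (u j)) (tang_deriv i e))\<^sup>2)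
    \<le> (\<integral>x. (\<Sum>i\<in>UNIV. (tang_deriv i e x)\<^sup>2) \<partial>surf_on \<Omega>)"
proof -
  let ?V = "{F :: 3 \<times> (real^3) \<Rightarrow> real. \<forall>i. (\<lambda>x. F (i, x)) \<in> L2 \<Omega>}"
  let ?e = "\<lambda>(i, x). tang_deriv i e x"
  have eL: "tang_deriv i e \<in> L2 \<Omega>" for i using e by (intro smooth_L2 smooth_S2_tang_deriv)
  then have eV: "?e \<in> ?V" by simp
  have orth: "vf.orthonormal0 J (\<lambda>j. grad_field (u j))"
    unfolding vf.orthonormal0_def using grad_field_closed[OF u] on by (simp add: grad_ipL2_field[symmetric])
  have "ipL2 (tang_deriv i e) (D \<Omega> i v) = ipL2 (D \<Omega> i v) (tang_deriv i e)" for i v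
    by (simp add: ipL2_def mult.commute)
  then have "(\<Sum>j\<in>J. (\<Sum>i\<in>UNIV. ipL2 (D \<Omega> i (u j)) (tang_deriv i e))\<^sup>2)
      \<le> (\<Sum>i\<in>UNIV. ipL2 (tang_deriv i e) (tang_deriv i e))"
    using vf.bessel[OF J orth eV] by (simp add: grad_field_def)
  also have "\<dots> = (\<integral>x. (\<Sum>i\<in>UNIV. (tang_deriv i e x)\<^sup>2) \<partial>surf_on \<Omega>)"
    using eL by (simp add: ipL2_def L2_iff power2_eq_square)
  finally show ?thesis .
qed

lemma grad_ipL2_combination:
  assumes "u \<in> H20 \<Omega>" "v \<in> H20 \<Omega>" "w \<in> H20 \<Omega>"
  shows "grad_ipL2 (\<lambda>x. a * u x + b * v x) w = a * grad_ipL2 u w + b * grad_ipL2 v w"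
proof -
  note H = assms[THEN H20_H2]
  have c: "(\<lambda>x. a * u x + b * v x) \<in> H2 \<Omega>" using H by (intro H2_combination)
  have "ipL2 (D \<Omega> i (\<lambda>x. a * u x + b * v x)) (D \<Omega> i w) = a * ipL2 (D \<Omega> i u) (D \<Omega> i w) + b * ipL2 (D \<Omega> i v) (D \<Omega> i w)" for i
  proof -
    have "ipL2 (D \<Omega> i (\<lambda>x. a * u x + b * v x)) (D \<Omega> i w) = ipL2 (\<lambda>x. a * D \<Omega> i u x + b * D \<Omega> i v x) (D \<Omega> i w)"
      using H c H1_combination(2)[OF H2_H1(1)[OF H(1)] H2_H1(1)[OF H(2)], of i a b]
      by (intro ipL2_AE_cong H2_L2 L2_add L2_cmult) auto
    then show ?thesis using H by (simp add: l2.B_add l2.B_cmult L2_cmult H2_L2)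
  qed
  then show ?thesis by (simp add: grad_ipL2_def sum.distrib sum_distrib_left)
qed

lemma lap_ipL2_combination:
  assumes "u \<in> H20 \<Omega>" "v \<in> H20 \<Omega>" "w \<in> H20 \<Omega>"
  shows "lap_ipL2 (\<lambda>x. a * u x + b * v x) w = a * lap_ipL2 u w + b * lap_ipL2 v w"
proof -
  note H = assms[THEN H20_H2]
  have c: "(\<lambda>x. a * u x + b * v x) \<in> H2 \<Omega>" using H by (intro H2_combination)
  have "AE x in surf_on \<Omega>. \<forall>i\<in>UNIV. D \<Omega> i (D \<Omega> i (\<lambda>x. a * u x + b * v x)) x = a * D \<Omega> i (D \<Omega> i u) x + b * D \<Omega> i (D \<Omega> i v) x"
    using H2_combination(2)[OF H(1,2)] by (intro AE_finite_allI) auto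
  then have ae: "AE x in surf_on \<Omega>. surf_laplacian \<Omega> (\<lambda>x. a * u x + b * v x) x = a * surf_laplacian \<Omega> u x + b * surf_laplacian \<Omega> v x"
    by eventually_elim (simp add: surf_laplacian_def sum.distrib sum_distrib_left)
  note L = surf_laplacian_L2[OF c] H[THEN surf_laplacian_L2]
  have "lap_ipL2 (\<lambda>x. a * u x + b * v x) w = ipL2 (\<lambda>x. a * surf_laplacian \<Omega> u x + b * surf_laplacian \<Omega> v x) (surf_laplacian \<Omega> w)"
    unfolding lap_ipL2_def using L ae by (intro ipL2_AE_cong L2_add L2_cmult) auto
  also have "\<dots> = a * lap_ipL2 u w + b * lap_ipL2 v w"
    unfolding lap_ipL2_def using L by (simp add: l2.B_add l2.B_cmult L2_cmult)
  finally show ?thesis .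
qed

lemma grad_ipL2_commute: "grad_ipL2 u v = grad_ipL2 v u"
  by (simp add: grad_ipL2_def ipL2_def mult.commute)

lemma lap_ipL2_commute: "lap_ipL2 u v = lap_ipL2 v u"
  by (simp add: lap_ipL2_def ipL2_def mult.commute)

lemma buckling_space_H20: "u \<in> buckling_space \<Omega> \<Longrightarrow> u \<in> H20 \<Omega>"
  by (auto simp: buckling_space_def split: if_splits)

lemma buckling_space_combination:
  assumes "u \<in> buckling_space \<Omega>" "v \<in> buckling_space \<Omega>"
  shows "(\<lambda>x. a * u x + b * v x) \<in> buckling_space \<Omega>"
proof -
  have H: "u \<in> H20 \<Omega>" "v \<in> H20 \<Omega>" using assms by (auto intro: buckling_space_H20)
  note I = H[THEN H20_H2, THEN H2_L2(1), THEN L2_integrable]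
  have "(LINT x:\<Omega>|surf. a * u x + b * v x) = a * (LINT x:\<Omega>|surf. u x) + b * (LINT x:\<Omega>|surf. v x)"
    unfolding set_lebesgue_integral_surf_on[OF borel] using I by simp
  then show ?thesis
    using assms H20_combination[OF H] unfolding buckling_space_def by (auto split: if_splits)
qed

lemma zero_buckling_space: "(\<lambda>x. 0) \<in> buckling_space \<Omega>"
  using zero_H20 unfolding buckling_space_def by auto

lemma eigenspace_iff:
  "u \<in> buckling_eigenspace \<Omega> s \<longleftrightarrow> u \<in> buckling_space \<Omega> \<and> (\<forall>\<phi>\<in>buckling_space \<Omega>. lap_ipL2 u \<phi> = s * grad_ipL2 u \<phi>)"
  unfolding buckling_eigenspace_def integral_surf_laplacian
  using integral_surf_grad[OF H20_H2[OF buckling_space_H20] H20_H2[OF buckling_space_H20]] by auto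

lemma eigenspace_combination:
  assumes "u \<in> buckling_eigenspace \<Omega> s" "v \<in> buckling_eigenspace \<Omega> s"
  shows "(\<lambda>x. a * u x + b * v x) \<in> buckling_eigenspace \<Omega> s"
  using assms unfolding eigenspace_iff
  by (auto simp: buckling_space_combination lap_ipL2_combination grad_ipL2_combination buckling_space_H20 algebra_simps)

lemma zero_eigenspace: "(\<lambda>x. 0) \<in> buckling_eigenspace \<Omega> s"
proof -
  have "lap_ipL2 (\<lambda>x. 0) \<phi> = 0" "grad_ipL2 (\<lambda>x. 0) \<phi> = 0" if "\<phi> \<in> H20 \<Omega>" for \<phi>
    using lap_ipL2_combination[OF zero_H20 zero_H20 that, of 0 0] grad_ipL2_combination[OF zero_H20 zero_H20 that, of 0 0]
    by simp_all
  then show ?thesis unfolding eigenspace_iff by (simp add: zero_buckling_space buckling_space_H20)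
qed

lemma eigenspace_H20: "u \<in> buckling_eigenspace \<Omega> s \<Longrightarrow> u \<in> H20 \<Omega>"
  unfolding eigenspace_iff using buckling_space_H20 by blast

lemma semi_inner_eigenspace: "semi_inner (buckling_eigenspace \<Omega> s) grad_ipL2"
proof
  fix f g h and c :: real
  assume f: "f \<in> buckling_eigenspace \<Omega> s"
  show "(\<lambda>x. c * f x) \<in> buckling_eigenspace \<Omega> s"
    using eigenspace_combination[OF f f, of c 0] by simp
  show "0 \<le> grad_ipL2 f f"
    unfolding grad_ipL2_field by (intro vf.B_nonneg grad_field_closed H20_H2 eigenspace_H20[OF f])
  show "grad_ipL2 f g = grad_ipL2 g f" by (rule grad_ipL2_commute)
  show "grad_ipL2 (\<lambda>x. c * f x) h = c * grad_ipL2 f h" if "h \<in> buckling_eigenspace \<Omega> s"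
    using grad_ipL2_combination[OF f[THEN eigenspace_H20] f[THEN eigenspace_H20] that[THEN eigenspace_H20], of c 0] by simp
  assume g: "g \<in> buckling_eigenspace \<Omega> s"
  show "(\<lambda>x. f x + g x) \<in> buckling_eigenspace \<Omega> s"
    using eigenspace_combination[OF f g, of 1 1] by simp
  show "grad_ipL2 (\<lambda>x. f x + g x) h = grad_ipL2 f h + grad_ipL2 g h" if "h \<in> buckling_eigenspace \<Omega> s"
    using grad_ipL2_combination[OF f[THEN eigenspace_H20] g[THEN eigenspace_H20] that[THEN eigenspace_H20], of 1 1] by simp
qed (rule zero_eigenspace)

lemma eigenfunctions_orthogonal:
  assumes u: "u \<in> buckling_eigenspace \<Omega> s" and v: "v \<in> buckling_eigenspace \<Omega> t" and "s \<noteq> t"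
  shows "grad_ipL2 u v = 0"
proof -
  have "lap_ipL2 u v = s * grad_ipL2 u v" "lap_ipL2 v u = t * grad_ipL2 v u"
    using u v unfolding eigenspace_iff by auto
  then have "(s - t) * grad_ipL2 u v = 0"
    by (simp add: lap_ipL2_commute[of v u] grad_ipL2_commute[of v u] left_diff_distrib)
  then show ?thesis using assms(3) by simp
qed

text \<open>
  With a vanishing gradient both sides of the eigenvalue equation are 0, so that it holds for every
  number in place of \<open>s\<close>, in particular for \<open>- 1\<close>, where by positivity of the eigenvalues there are no
  eigenfunctions.
\<close>
lemma eigenfunction_zero_gradient:
  assumes \<sigma>: "buckling_eigenvalues \<Omega> \<sigma>" and u: "u \<in> buckling_eigenspace \<Omega> s" and z: "grad_ipL2 u u = 0"
  shows "AE x in surf. x \<in> \<Omega> \<longrightarrow> u x = 0"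
proof -
  have uV: "grad_field u \<in> {F. \<forall>i. (\<lambda>x. F (i, x)) \<in> L2 \<Omega>}"
    by (intro grad_field_closed H20_H2 eigenspace_H20[OF u])
  have 0: "grad_ipL2 u \<phi> = 0" if "\<phi> \<in> buckling_space \<Omega>" for \<phi>
    unfolding grad_ipL2_field
    by (rule vf.B_null[OF uV grad_field_closed[OF H20_H2[OF buckling_space_H20[OF that]]] z[unfolded grad_ipL2_field]])
  then have u1: "u \<in> buckling_eigenspace \<Omega> (-1)"
    using u unfolding eigenspace_iff by simp
  have pos: "0 < \<sigma> j" for j using \<sigma> by (simp add: buckling_eigenvalues_def)
  have "{j. \<sigma> j = -1} = {}"
  proof (rule equals0I)
    fix j assume "j \<in> {j. \<sigma> j = -1}"
    then show False using pos[of j] by simp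
  qed
  moreover have "has_dim_ae \<Omega> (buckling_eigenspace \<Omega> (-1)) (card {j. \<sigma> j = -1})"
    using \<sigma> unfolding buckling_eigenvalues_def by blast
  ultimately have "has_dim_ae \<Omega> (buckling_eigenspace \<Omega> (-1)) 0" by simp
  then show ?thesis using u1 unfolding has_dim_ae_def by auto
qed

text \<open>
  Gram--Schmidt with respect to gradients does not degenerate: a residual with vanishing gradient would
  be null and hence a linear relation between the basis functions.
\<close>
lemma orthonormal_eigenbasis:
  assumes \<sigma>: "buckling_eigenvalues \<Omega> \<sigma>"
  shows "\<exists>e. \<forall>k<card {j. \<sigma> j = s}. e k \<in> buckling_eigenspace \<Omega> s \<and>
    (\<forall>l<card {j. \<sigma> j = s}. grad_ipL2 (e k) (e l) = (if k = l then 1 else 0))"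
proof -
  let ?n = "card {j. \<sigma> j = s}" and ?E = "buckling_eigenspace \<Omega> s"
  interpret E: semi_inner ?E grad_ipL2 by (rule semi_inner_eigenspace)
  have "has_dim_ae \<Omega> ?E ?n" using \<sigma> unfolding buckling_eigenvalues_def by blast
  then obtain b where b: "\<And>i. i < ?n \<Longrightarrow> b i \<in> ?E"
    and ind: "\<And>c. (AE x in surf. x \<in> \<Omega> \<longrightarrow> (\<Sum>i<?n. c i * b i x) = 0) \<Longrightarrow> (\<forall>i<?n. c i = 0)"
    unfolding has_dim_ae_def by blast
  let ?e = "E.gram_schmidt b" and ?v = "E.gs_residual b"
  have on: "E.orthonormal0 {..<?n} ?e" by (rule E.orthonormal0_gram_schmidt_lessThan) (rule b)
  have one: "grad_ipL2 (?e k) (?e k) = 1" if k: "k < ?n" for k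
  proof -
    have eE: "?e k \<in> ?E" using E.orthonormal0_closed[OF on] k by simp
    have "E.orthonormal0 {..<k} ?e" using on by (rule E.orthonormal0_mono) (use k in auto)
    then have vE: "?v k \<in> ?E" unfolding E.gs_residual_def by (intro E.diff_closed b k E.proj_closed)
    have nz: "grad_ipL2 (?v k) (?v k) \<noteq> 0"
    proof
      assume "grad_ipL2 (?v k) (?v k) = 0"
      then have ae: "AE x in surf. x \<in> \<Omega> \<longrightarrow> ?v k x = 0" by (rule eigenfunction_zero_gradient[OF \<sigma> vE])
      obtain d where d: "\<And>x. ?v k x = b k x + (\<Sum>i<k. d i * b i x)"
        using E.gram_schmidt_triangular(2)[of b k] by blast
      let ?c = "\<lambda>i. if i = k then 1 else if i < k then d i else 0"
      have "(\<Sum>i<?n. ?c i * b i x) = ?v k x" for x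
      proof -
        have "(\<Sum>i<?n. ?c i * b i x) = (\<Sum>i<Suc k. ?c i * b i x)"
          using k by (intro sum.mono_neutral_right) auto
        then show ?thesis by (simp add: d)
      qed
      then have "\<forall>i<?n. ?c i = 0" using ae by (intro ind) simp
      then show False using k by auto
    qed
    have "?e k \<noteq> (\<lambda>x. 0)"
    proof
      assume "?e k = (\<lambda>x. 0)"
      then have "grad_ipL2 (?v k) (?v k) = 0 \<or> (\<forall>x. ?v k x = 0)"
        using E.gram_schmidt_eq[of b k] by (auto simp: fun_eq_iff)
      then show False
        using nz E.B_zero[OF E.zero_closed] by (metis ext)
    qed
    then show ?thesis using on k unfolding E.orthonormal0_def by auto
  qed
  show ?thesis
  proof (rule exI[of _ ?e], intro allI impI conjI)
    fix k l assume k: "k < ?n" and l: "l < ?n"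
    show "grad_ipL2 (?e k) (?e l) = (if k = l then 1 else 0)"
    proof (cases "k = l")
      case True
      then show ?thesis using one[OF k] by simp
    next
      case False
      then show ?thesis using on k l unfolding E.orthonormal0_def by simp
    qed
  qed (use E.orthonormal0_closed[OF on] in simp)
qed

lemma orthonormal_eigenfunctions:
  assumes \<sigma>: "buckling_eigenvalues \<Omega> \<sigma>"
  obtains u where "\<And>j::nat. u j \<in> buckling_eigenspace \<Omega> (\<sigma> j)"
    "\<And>j k. grad_ipL2 (u j) (u k) = (if j = k then 1 else 0)"
proof -
  have "\<exists>e. \<forall>s. \<forall>k<card {j. \<sigma> j = s}. e s k \<in> buckling_eigenspace \<Omega> s \<and>
    (\<forall>l<card {j. \<sigma> j = s}. grad_ipL2 (e s k) (e s l) = (if k = l then 1 else 0))"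
    by (rule choice) (use orthonormal_eigenbasis[OF \<sigma>] in blast)
  then obtain e where e: "\<And>s k. k < card {j. \<sigma> j = s} \<Longrightarrow> e s k \<in> buckling_eigenspace \<Omega> s"
    "\<And>s k l. k < card {j. \<sigma> j = s} \<Longrightarrow> l < card {j. \<sigma> j = s} \<Longrightarrow> grad_ipL2 (e s k) (e s l) = (if k = l then 1 else 0)"
    by blast
  have fin: "finite {j. \<sigma> j = s}" for s using \<sigma> by (simp add: buckling_eigenvalues_def)
  \<comment> \<open>the position of an index among those with the same eigenvalue\<close>
  define r where "r j = card {i. i < j \<and> \<sigma> i = \<sigma> j}" for j
  have r: "r j < card {i. \<sigma> i = \<sigma> j}" for j
    unfolding r_def by (rule psubset_card_mono[OF fin]) auto
  have r_less: "r j < r k" if "j < k" "\<sigma> j = \<sigma> k" for j k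
    unfolding r_def by (rule psubset_card_mono) (use that in auto)
  show ?thesis
  proof (rule that[of "\<lambda>j. e (\<sigma> j) (r j)"])
    show "e (\<sigma> j) (r j) \<in> buckling_eigenspace \<Omega> (\<sigma> j)" for j by (rule e(1)[OF r])
    show "grad_ipL2 (e (\<sigma> j) (r j)) (e (\<sigma> k) (r k)) = (if j = k then 1 else 0)" for j k
    proof (cases "\<sigma> j = \<sigma> k")
      case True
      have "r j = r k \<longleftrightarrow> j = k" using r_less[of j k] r_less[of k j] True by (metis less_irrefl linorder_neqE_nat)
      then show ?thesis using e(2)[OF r[of j] r[of k, folded True]] True by simp
    next
      case False
      then show ?thesis using eigenfunctions_orthogonal[OF e(1)[OF r] e(1)[OF r] False] by auto
    qed
  qed
qed

lemma sum_blocks: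
  fixes f :: "nat \<Rightarrow> real"
  shows "(\<Sum>i<K\<^sup>2. f i) = (\<Sum>n<K. \<Sum>i\<in>block n. f i)"
proof (induction K)
  case (Suc K)
  have "K\<^sup>2 \<le> (Suc K)\<^sup>2" by (intro power_mono) auto
  then have "{..<(Suc K)\<^sup>2} = {..<K\<^sup>2} \<union> block K" by (rule ivl_disj_un_one(2)[symmetric])
  moreover have "{..<K\<^sup>2} \<inter> block K = {}" by auto
  ultimately have "(\<Sum>i<(Suc K)\<^sup>2. f i) = (\<Sum>i<K\<^sup>2. f i) + (\<Sum>i\<in>block K. f i)"
    by (simp only: sum.union_disjoint finite_lessThan finite_atLeastLessThan)
  with Suc show ?case by simp
qed simp

lemma level_block: "i \<in> block n \<Longrightarrow> level i = harmonic_eigenvalue n"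
  unfolding level_def by (subst floor_sqrt_unique[of n i]) auto

text \<open>
  Expanding in harmonics, \<open>z - \<sigma>\<^sub>j\<close> is at most a combination of the numbers \<open>(z - l\<^sub>i)\<^sub>+\<close> with weights
  \<open>w\<^sub>i\<^sub>j\<close>. Summation over \<open>j\<close> is Bessel's inequality, and summation over the harmonics of one degree
  replaces their squared gradients by a constant, which is why only the area of \<open>\<Omega>\<close> remains.
\<close>
lemma riesz_mean_le_sphere_sum:
  assumes \<sigma>: "buckling_eigenvalues \<Omega> \<sigma>" and K: "\<And>n. n \<ge> K \<Longrightarrow> z \<le> harmonic_eigenvalue n"
  shows "(\<Sum>j<N. max (z - \<sigma> j) 0)
    \<le> measure surf \<Omega> / (4 * pi) * (\<Sum>n\<in>{1..<K}. (2 * real n + 1) * max (z - harmonic_eigenvalue n) 0)"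
proof -
  obtain u where u: "\<And>j::nat. u j \<in> buckling_eigenspace \<Omega> (\<sigma> j)"
    and on: "\<And>j k. grad_ipL2 (u j) (u k) = (if j = k then 1 else 0)"
    using orthonormal_eigenfunctions[OF \<sigma>] by blast
  let ?c = "\<lambda>i j. (\<Sum>k\<in>UNIV. ipL2 (D \<Omega> k (u j)) (tang_deriv k (harmonic i)))\<^sup>2"
  let ?m = "\<lambda>i. max (z - level i) 0 / level i"
  have m0: "0 \<le> ?m i" for i using level_nonneg by simp
  have one: "max (z - \<sigma> j) 0 \<le> (\<Sum>i<K\<^sup>2. ?m i * ?c i j)" for j
  proof -
    have "lap_ipL2 (u j) (u j) = \<sigma> j * grad_ipL2 (u j) (u j)" using u[of j] unfolding eigenspace_iff by blast
    then have "z - \<sigma> j = z * grad_ipL2 (u j) (u j) - lap_ipL2 (u j) (u j)" by (simp add: on)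
    also have "\<dots> \<le> (\<Sum>i<K\<^sup>2. ?m i * ?c i j)"
      by (rule spectral_inequality_H20[OF eigenspace_H20[OF u] K])
    finally have "z - \<sigma> j \<le> (\<Sum>i<K\<^sup>2. ?m i * ?c i j)" .
    moreover have "0 \<le> (\<Sum>i<K\<^sup>2. ?m i * ?c i j)" using m0 by (intro sum_nonneg mult_nonneg_nonneg) auto
    ultimately show ?thesis by simp
  qed
  let ?g = "\<lambda>i x. \<Sum>k\<in>UNIV. (tang_deriv k (harmonic i) x)\<^sup>2"
  have g: "smooth_S2 (?g i)" for i
    unfolding power2_eq_square by (intro smooth_S2_sum smooth_S2_mult smooth_S2_tang_deriv smooth_harmonic)
  have gi: "integrable (surf_on \<Omega>) (?g i)" for i by (rule smooth_S2_integrable[OF g borel subset_S2])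
  have "(\<Sum>j<N. max (z - \<sigma> j) 0) \<le> (\<Sum>j<N. \<Sum>i<K\<^sup>2. ?m i * ?c i j)" by (intro sum_mono one)
  also have "\<dots> = (\<Sum>i<K\<^sup>2. ?m i * (\<Sum>j<N. ?c i j))"
    by (subst sum.swap) (simp add: sum_distrib_left)
  also have "\<dots> \<le> (\<Sum>i<K\<^sup>2. ?m i * integral\<^sup>L (surf_on \<Omega>) (?g i))"
    using on u by (intro sum_mono mult_left_mono m0 bessel_gradients smooth_harmonic H20_H2 eigenspace_H20) auto
  also have "\<dots> = (\<Sum>n<K. \<Sum>i\<in>block n. ?m i * integral\<^sup>L (surf_on \<Omega>) (?g i))" by (rule sum_blocks)
  also have "\<dots> = (\<Sum>n<K. max (z - harmonic_eigenvalue n) 0 / harmonic_eigenvalue n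
      * (\<integral>x. (\<Sum>i\<in>block n. ?g i x) \<partial>surf_on \<Omega>))"
    using gi by (intro sum.cong refl) (simp add: level_block sum_distrib_left)
  also have "\<dots> \<le> (\<Sum>n<K. max (z - harmonic_eigenvalue n) 0 / harmonic_eigenvalue n
      * (harmonic_eigenvalue n * (2 * real n + 1) / (4 * pi) * measure surf \<Omega>))"
  proof (intro sum_mono mult_left_mono)
    fix n
    have "(\<integral>x. (\<Sum>i\<in>block n. ?g i x) \<partial>surf_on \<Omega>) \<le> (\<integral>x. harmonic_eigenvalue n * (2 * real n + 1) / (4 * pi) \<partial>surf_on \<Omega>)"
    proof (rule Bochner_Integration.integral_mono)
      show "integrable (surf_on \<Omega>) (\<lambda>x. \<Sum>i\<in>block n. ?g i x)" using gi by simp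
      show "integrable (surf_on \<Omega>) (\<lambda>x. harmonic_eigenvalue n * (2 * real n + 1) / (4 * pi))"
        by (intro smooth_S2_integrable borel subset_S2 smooth_S2_const)
      fix x assume "x \<in> space (surf_on \<Omega>)"
      then have "x \<in> S2" using subset_S2 by auto
      then show "(\<Sum>i\<in>block n. ?g i x) \<le> harmonic_eigenvalue n * (2 * real n + 1) / (4 * pi)"
        by (rule block_sum_gradients)
    qed
    also have "\<dots> = harmonic_eigenvalue n * (2 * real n + 1) / (4 * pi) * measure surf \<Omega>"
      using borel by (simp add: surf_on_def measure_restrict_space)
    finally show "(\<integral>x. (\<Sum>i\<in>block n. ?g i x) \<partial>surf_on \<Omega>) \<le> \<dots>" .
    show "0 \<le> max (z - harmonic_eigenvalue n) 0 / harmonic_eigenvalue n" by (simp add: harmonic_eigenvalue_def)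
  qed
  also have "\<dots> = (\<Sum>n\<in>{1..<K}. max (z - harmonic_eigenvalue n) 0 / harmonic_eigenvalue n
      * (harmonic_eigenvalue n * (2 * real n + 1) / (4 * pi) * measure surf \<Omega>))"
    by (rule sum.mono_neutral_right) (auto simp: harmonic_eigenvalue_def)
  also have "\<dots> = measure surf \<Omega> / (4 * pi) * (\<Sum>n\<in>{1..<K}. (2 * real n + 1) * max (z - harmonic_eigenvalue n) 0)"
    unfolding sum_distrib_left
  proof (intro sum.cong refl)
    fix n assume "n \<in> {1..<K}"
    then have "harmonic_eigenvalue n \<noteq> 0" by (simp add: harmonic_eigenvalue_def)
    then show "max (z - harmonic_eigenvalue n) 0 / harmonic_eigenvalue n
        * (harmonic_eigenvalue n * (2 * real n + 1) / (4 * pi) * measure surf \<Omega>)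
      = measure surf \<Omega> / (4 * pi) * ((2 * real n + 1) * max (z - harmonic_eigenvalue n) 0)"
      by (simp add: field_simps)
  qed
  finally show ?thesis .
qed

end

section \<open>The Riesz mean\<close>

text \<open>
  With \<open>N = (L + 1)\<^sup>2\<close> the sum telescopes to \<open>(N - 1) z - N (N - 1) / 2\<close>, and the square is completed.
\<close>
lemma sphere_sum_eq:
  "(\<Sum>n=1..L. (2 * real n + 1) * (z - harmonic_eigenvalue n))
    = (z - 1/2)\<^sup>2 / 2 - (z - ((real L + 1)\<^sup>2 - 1/2))\<^sup>2 / 2"
proof (induction L)
  case (Suc L)
  then show ?case
    by (simp add: harmonic_eigenvalue_def power2_eq_square field_simps)
qed (simp add: power2_eq_square)

text \<open>
  The numbers \<open>n (n + 1)\<close> increase, so the nonvanishing terms are the first ones.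
\<close>
lemma sphere_sum_truncated:
  "\<exists>L. (\<Sum>n=1..K. (2 * real n + 1) * max (z - harmonic_eigenvalue n) 0)
    = (\<Sum>n=1..L. (2 * real n + 1) * (z - harmonic_eigenvalue n))"
proof (induction K)
  case (Suc K)
  show ?case
  proof (cases "harmonic_eigenvalue (Suc K) \<le> z")
    case True
    have "harmonic_eigenvalue n \<le> z" if "n \<le> Suc K" for n
    proof -
      have "harmonic_eigenvalue n \<le> harmonic_eigenvalue (Suc K)"
        unfolding harmonic_eigenvalue_def using that by (intro mult_mono) auto
      with True show ?thesis by simp
    qed
    then show ?thesis by (intro exI[of _ "Suc K"] sum.cong) auto
  next
    case False
    with Suc show ?thesis by simp
  qed
qed (intro exI[of _ 0], simp)

theorem theorem6p3p1:
  fixes \<Omega> :: "(real^3) set" and \<sigma> :: "nat \<Rightarrow> real" and z :: real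
  assumes "openin (top_of_set S2) \<Omega>" and "connected \<Omega>"
    and "buckling_eigenvalues \<Omega> \<sigma>"
    and "z \<ge> 0"
  shows "riesz_mean1 \<sigma> z \<le> ennreal (measure surf \<Omega> / (8 * pi) * (z - 1/2)\<^sup>2) \<and>
         riesz_mean1 \<sigma> z \<le> ennreal (measure surf \<Omega> / (8 * pi) * z\<^sup>2)"
proof -
  interpret sphere_domain \<Omega> by standard (rule assms(1))
  obtain K0 where K0: "z \<le> real K0" using real_arch_simple by blast
  define K where "K = Suc K0"
  have K: "z \<le> harmonic_eigenvalue n" if "K \<le> n" for n
  proof -
    have "z \<le> real n * 1" using K0 that by (simp add: K_def)
    also have "\<dots> \<le> harmonic_eigenvalue n"
      unfolding harmonic_eigenvalue_def by (intro mult_left_mono) auto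
    finally show ?thesis .
  qed
  define S where "S = (\<Sum>n\<in>{1..<K}. (2 * real n + 1) * max (z - harmonic_eigenvalue n) 0)"
  have S: "S = (\<Sum>n=1..K0. (2 * real n + 1) * max (z - harmonic_eigenvalue n) 0)"
    unfolding S_def K_def by (simp add: atLeastLessThanSuc_atLeastAtMost)
  have S_le: "S \<le> (z - 1/2)\<^sup>2 / 2"
  proof -
    obtain L where "S = (\<Sum>n=1..L. (2 * real n + 1) * (z - harmonic_eigenvalue n))"
      using sphere_sum_truncated[of z K0] unfolding S by blast
    then show ?thesis unfolding sphere_sum_eq by simp
  qed
  have S_le_square: "S \<le> z\<^sup>2 / 2"
  proof (cases "z < 1/4")
    case True
    have "max (z - harmonic_eigenvalue n) 0 = 0" if "1 \<le> n" for n
    proof -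
      have "1 * 1 \<le> real n * (real n + 1)" using that by (intro mult_mono) auto
      then show ?thesis using True by (simp add: harmonic_eigenvalue_def)
    qed
    then have "S = 0" unfolding S by (intro sum.neutral) simp
    then show ?thesis by simp
  next
    case False
    then have "(z - 1/2)\<^sup>2 \<le> z\<^sup>2" by (simp add: power2_eq_square algebra_simps)
    then show ?thesis using S_le by simp
  qed
  have bound: "riesz_mean1 \<sigma> z \<le> ennreal (measure surf \<Omega> / (8 * pi) * t)" if t: "S \<le> t / 2" for t
    unfolding riesz_mean1_def
  proof (rule suminf_le_const)
    fix N
    have "(\<Sum>j<N. max (z - \<sigma> j) 0) \<le> measure surf \<Omega> / (4 * pi) * S"
      unfolding S_def by (rule riesz_mean_le_sphere_sum[OF assms(3) K])
    also have "\<dots> \<le> measure surf \<Omega> / (4 * pi) * (t / 2)" using t by (intro mult_left_mono) auto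
    finally have "(\<Sum>j<N. max (z - \<sigma> j) 0) \<le> measure surf \<Omega> / (8 * pi) * t" by simp
    then show "(\<Sum>j<N. ennreal (max (z - \<sigma> j) 0)) \<le> ennreal (measure surf \<Omega> / (8 * pi) * t)"
      by (simp add: sum_ennreal ennreal_leI)
  qed simp
  show ?thesis using bound[OF S_le] bound[OF S_le_square] by simp
qed

end
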